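(* Let $k\ge 2$ be an integer and let $\mathcal{G}$ be a congruence subgroup of $\mathrm{SL}_2(\mathbb{Z})$. Let $\mathcal{C}(\mathcal{G})$ denote the set of cusps of $\mathcal{G}$, $\mathcal{C}_\infty(\mathcal{G})$ the set of regular cusps of $\mathcal{G}$, and $\mathcal{E}_k(\mathcal{G})$ the space of Eisenstein series of weight $k$ on $\mathcal{G}$. Then \[\dim_{\mathbb{C}}\mathcal{E}_k(\mathcal{G})=\begin{cases}|\mathcal{C}(\mathcal{G})|, & \text{if } k \text{ is even and } k\ge 4;\\ |\mathcal{C}_\infty(\mathcal{G})|, & \text{if } k \text{ is odd and } -\mathrm{Id}\notin\mathcal{G};\\ |\mathcal{C}(\mathcal{G})|-1, & \text{if } k=2;\\ 0, & \text{otherwise.}\end{cases}\]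
   Context: $\mathcal{M}_k(\mathcal{G})$ and $\mathcal{S}_k(\mathcal{G})$ are the $\mathbb{C}$-vector spaces of holomorphic modular forms and cusp forms of weight $k$ on $\mathcal{G}$. The space of Eisenstein series $\mathcal{E}_k(\mathcal{G})$ is the linear complement of $\mathcal{S}_k(\mathcal{G})$ in $\mathcal{M}_k(\mathcal{G})$ that is orthogonal to $\mathcal{S}_k(\mathcal{G})$ for the Petersson inner product, i.e. $\{f\in\mathcal{M}_k(\mathcal{G}) : \langle f,g\rangle=0\ \text{for all } g\in\mathcal{S}_k(\mathcal{G})\}$, where $\langle f,g\rangle=\int_{\mathcal{G}\backslash\mathbb{H}} f(\tau)\overline{g(\tau)}\,\mathrm{Im}(\tau)^{k-2}\,dx\,dy$ with $\tau=x+iy$. A cusp of $\mathcal{G}$ is a $\mathcal{G}$-orbit in $\mathbb{P}^1(\mathbb{Q})$. Let $T=\begin{pmatrix}1&1\\0&1\end{pmatrix}$. For $x\in\mathbb{P}^1(\mathbb{Q})$ with stabilizer $\mathcal{G}_x$ in $\mathcal{G}$, choose $\gamma\in\mathrm{SL}_2(\mathbb{Z})$ with $\gamma\infty=x$; then for some $h\ge1$ the group $\gamma^{-1}\mathcal{G}_x\gamma$ is one of $\langle -\mathrm{Id},T^h\rangle$, $\langle T^h\rangle$, $\langle -T^h\rangle$. The cusp is regular in the first two cases and irregular in the third. *)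

theory Defs
  imports
    "HOL-Analysis.Analysis"
    "HOL-Library.Function_Algebras"
    "HOL-Algebra.Generated_Groups"
begin

section \<open>Congruence subgroups\<close>

definition SL2Z :: "(int ^ 2 ^ 2) monoid" where
  "SL2Z = \<lparr>carrier = {A. det A = 1}, mult = (**), one = mat 1\<rparr>"

lemma group_SL2Z: "group SL2Z"
proof (rule groupI)
  fix A :: "int ^ 2 ^ 2"
  assume "A \<in> carrier SL2Z"
  then have d: "A$1$1 * A$2$2 - A$1$2 * A$2$1 = 1"
    by (simp add: SL2Z_def det_2)
  define B :: "int ^ 2 ^ 2" where "B = vector [vector [A$2$2, - A$1$2], vector [- A$2$1, A$1$1]]"
  have "B \<in> carrier SL2Z" using d
    by (simp add: SL2Z_def B_def det_2 vector_2 algebra_simps)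
  moreover have "B ** A = mat 1" using d
    by (simp add: B_def vec_eq_iff forall_2 matrix_matrix_mult_def sum_2 mat_def vector_2 algebra_simps)
  ultimately show "\<exists>B\<in>carrier SL2Z. B \<otimes>\<^bsub>SL2Z\<^esub> A = \<one>\<^bsub>SL2Z\<^esub>"
    by (auto simp: SL2Z_def)
qed (simp_all add: SL2Z_def det_mul matrix_mul_assoc)

definition principal_congruence_subgroup :: "nat \<Rightarrow> (int ^ 2 ^ 2) set" where
  "principal_congruence_subgroup N =
     {A \<in> carrier SL2Z. \<forall>i j. A $ i $ j mod int N = (mat 1 :: int ^ 2 ^ 2) $ i $ j mod int N}"

definition congruence_subgroup :: "(int ^ 2 ^ 2) set \<Rightarrow> bool" where
  "congruence_subgroup G \<longleftrightarrow>
     subgroup G SL2Z \<and> (\<exists>N\<ge>1. principal_congruence_subgroup N \<subseteq> G)"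

section \<open>Cusps\<close>

text \<open>The projective line over the rationals is \<^typ>\<open>rat option\<close>, with \<^term>\<open>None\<close> as the point
  at infinity; matrices act by fractional linear transformations.\<close>

fun proj_act :: "int ^ 2 ^ 2 \<Rightarrow> rat option \<Rightarrow> rat option" where
  "proj_act A None =
     (if A$2$1 = 0 then None else Some (of_int (A$1$1) / of_int (A$2$1)))"
| "proj_act A (Some x) =
     (if of_int (A$2$1) * x + of_int (A$2$2) = 0 then None
      else Some ((of_int (A$1$1) * x + of_int (A$1$2)) / (of_int (A$2$1) * x + of_int (A$2$2))))"

definition cusps :: "(int ^ 2 ^ 2) set \<Rightarrow> rat option set set" where
  "cusps G = {{proj_act A x | A. A \<in> G} | x. True}"

definition cusp_stabilizer :: "(int ^ 2 ^ 2) set \<Rightarrow> rat option \<Rightarrow> (int ^ 2 ^ 2) set" where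
  "cusp_stabilizer G x = {A \<in> G. proj_act A x = x}"

definition T_mat :: "int ^ 2 ^ 2" where
  "T_mat = vector [vector [1, 1], vector [0, 1]]"

definition regular_cusp_point :: "(int ^ 2 ^ 2) set \<Rightarrow> rat option \<Rightarrow> bool" where
  "regular_cusp_point G x \<longleftrightarrow>
     (\<exists>C \<in> carrier SL2Z. proj_act C None = x \<and>
       (\<exists>h\<ge>1::nat.
         {inv\<^bsub>SL2Z\<^esub> C \<otimes>\<^bsub>SL2Z\<^esub> A \<otimes>\<^bsub>SL2Z\<^esub> C | A. A \<in> cusp_stabilizer G x}
           \<in> {generate SL2Z {- mat 1, T_mat [^]\<^bsub>SL2Z\<^esub> h}, generate SL2Z {T_mat [^]\<^bsub>SL2Z\<^esub> h}}))"

text \<open>Regularity does not depend on the representative of the orbit, nor on the matrix that moves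
  infinity to it.\<close>

definition regular_cusps :: "(int ^ 2 ^ 2) set \<Rightarrow> rat option set set" where
  "regular_cusps G = {c \<in> cusps G. \<exists>x\<in>c. regular_cusp_point G x}"

section \<open>Modular forms\<close>

definition upper_half_plane :: "complex set" where
  "upper_half_plane = {\<tau>. Im \<tau> > 0}"

definition aut_factor :: "int ^ 2 ^ 2 \<Rightarrow> complex \<Rightarrow> complex" where
  "aut_factor A \<tau> = of_int (A$2$1) * \<tau> + of_int (A$2$2)"

definition moebius :: "int ^ 2 ^ 2 \<Rightarrow> complex \<Rightarrow> complex" where
  "moebius A \<tau> = (of_int (A$1$1) * \<tau> + of_int (A$1$2)) / aut_factor A \<tau>"

definition slash :: "nat \<Rightarrow> (complex \<Rightarrow> complex) \<Rightarrow> int ^ 2 ^ 2 \<Rightarrow> complex \<Rightarrow> complex" where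
  "slash k f A \<tau> = f (moebius A \<tau>) / aut_factor A \<tau> ^ k"

text \<open>\<^term>\<open>F\<close> expresses \<^term>\<open>f\<close> through the local parameter \<open>q = exp (2 \<pi> \<i> \<tau> / h)\<close> at infinity
  and extends holomorphically to \<open>q = 0\<close>; the value \<open>F 0\<close> is the limit of \<open>f\<close> at \<open>\<i>\<infinity>\<close>. Any
  period \<open>h\<close> is allowed, so that at an irregular cusp in odd weight \<open>h\<close> is an even
  multiple of the cusp width.\<close>

definition q_expansion_at_infinity ::
    "nat \<Rightarrow> (complex \<Rightarrow> complex) \<Rightarrow> (complex \<Rightarrow> complex) \<Rightarrow> bool" where
  "q_expansion_at_infinity h F f \<longleftrightarrow>
     h \<ge> 1 \<and> F holomorphic_on ball 0 1 \<and>
     (\<forall>\<tau>\<in>upper_half_plane. f \<tau> = F (exp (2 * of_real pi * \<i> * \<tau> / of_nat h)))"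

text \<open>Functions on the upper half plane are represented by functions on \<^typ>\<open>complex\<close> that vanish
  elsewhere, so that two of them are equal iff they agree on the upper half plane.\<close>

definition modular_forms :: "nat \<Rightarrow> (int ^ 2 ^ 2) set \<Rightarrow> (complex \<Rightarrow> complex) set" where
  "modular_forms k G =
     {f. f holomorphic_on upper_half_plane \<and>
         (\<forall>\<tau>. \<tau> \<notin> upper_half_plane \<longrightarrow> f \<tau> = 0) \<and>
         (\<forall>A\<in>G. \<forall>\<tau>\<in>upper_half_plane. slash k f A \<tau> = f \<tau>) \<and>
         (\<forall>A\<in>carrier SL2Z. \<exists>h F. q_expansion_at_infinity h F (slash k f A))}"

definition cusp_forms :: "nat \<Rightarrow> (int ^ 2 ^ 2) set \<Rightarrow> (complex \<Rightarrow> complex) set" where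
  "cusp_forms k G =
     {f \<in> modular_forms k G.
        \<forall>A\<in>carrier SL2Z. \<exists>h F. q_expansion_at_infinity h F (slash k f A) \<and> F 0 = 0}"

section \<open>Petersson product and Eisenstein space\<close>

definition borel_fundamental_set :: "(int ^ 2 ^ 2) set \<Rightarrow> complex set \<Rightarrow> bool" where
  "borel_fundamental_set G D \<longleftrightarrow>
     D \<in> sets borel \<and> D \<subseteq> upper_half_plane \<and>
     (\<forall>\<tau>\<in>upper_half_plane. \<exists>!\<sigma>. \<sigma> \<in> D \<and> (\<exists>A\<in>G. moebius A \<tau> = \<sigma>))"

text \<open>The integral over the quotient by \<open>G\<close> is taken over a Borel set containing exactly one point of
  each \<open>G\<close>-orbit. Such sets exist (in each orbit take the points of largest imaginary part and
  among them the one with least nonnegative real part), and as the integrand times \<open>dx dy\<close> is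
  \<open>G\<close>-invariant, the choice is irrelevant. \<^term>\<open>lborel\<close> on \<^typ>\<open>complex\<close> is \<open>dx dy\<close>.\<close>

definition petersson ::
    "nat \<Rightarrow> (int ^ 2 ^ 2) set \<Rightarrow> (complex \<Rightarrow> complex) \<Rightarrow> (complex \<Rightarrow> complex) \<Rightarrow> complex" where
  "petersson k G f g =
     (LINT \<tau>:(SOME D. borel_fundamental_set G D)|lborel.
        f \<tau> * cnj (g \<tau>) * of_real (Im \<tau> powi (int k - 2)))"

definition eisenstein_space :: "nat \<Rightarrow> (int ^ 2 ^ 2) set \<Rightarrow> (complex \<Rightarrow> complex) set" where
  "eisenstein_space k G = {f \<in> modular_forms k G. \<forall>g\<in>cusp_forms k G. petersson k G f g = 0}"

definition fun_scale :: "complex \<Rightarrow> (complex \<Rightarrow> complex) \<Rightarrow> complex \<Rightarrow> complex" where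
  "fun_scale c f = (\<lambda>\<tau>. c * f \<tau>)"

global_interpretation cfun: vector_space fun_scale
  by unfold_locales (auto simp: fun_scale_def fun_eq_iff algebra_simps)

end

theory Submission
  imports Defs "HOL-Complex_Analysis.Complex_Analysis" "HOL-Real_Asymp.Real_Asymp"
begin

text \<open>The value of a modular form \<open>f\<close> at the cusp \<open>A \<infinity>\<close> is the limit of \<open>f|A\<close> as the imaginary part
  tends to infinity (\<open>cusp_value\<close>), and the cusp forms are the common kernel of these linear forms. The
  dimension of the space of Eisenstein series is the rank of the values at the cusps, for the following
  reason. The cusp forms are finitely generated (\<open>finitely_generated_cusp_forms\<close>): if all expansions of
  a cusp form vanish to a high order, the maximum modulus principle bounds the supremum of
  \<open>|f|\<^sup>2 Im\<^sup>k\<close> by half of itself. The Petersson product of a modular form and a cusp form converges,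
  as the product \<open>f g Im\<^sup>k\<close> is bounded and a fundamental set has finite hyperbolic area, and it is
  positive definite on cusp forms. So Gram-Schmidt splits every modular form into a cusp form and an
  Eisenstein form with the same values at the cusps (\<open>eisenstein_part\<close>), while an Eisenstein form with
  zero values is a cusp form orthogonal to itself (\<open>eisenstein_eq_0\<close>). The dimension of the space of
  Eisenstein series is therefore \<open>|I|\<close> for every set \<open>I\<close> of cusps such that the values at \<open>I\<close>
  determine all values and modular forms dual to them exist (\<open>eisenstein_dimension_criterion\<close>).

  For weight \<open>k \<ge> 3\<close> the dual forms are sums of \<open>(c \<tau> + d)\<^sup>-\<^sup>k\<close> over the bottom rows \<open>(c, d)\<close> of a coset
  \<open>D G\<close>. Termwise limits show that such a series vanishes at all cusps but one, where its value is
  \<open>1\<close>, or \<open>1 + (-1)\<^sup>k\<close> if the stabilizer of the cusp contains the negative of a translation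
  (\<open>eis_values\<close>). In odd weight every form vanishes at the latter cusps; these are the irregular cusps
  if \<open>-1\<close> is not in \<open>G\<close>, and all cusps otherwise.

  In weight two the series does not converge absolutely. Its place is taken by the values of the
  Weierstrass function at the \<open>N\<close>-torsion points of the lattice \<open>\<int>\<tau> + \<int>\<close>, where \<open>N\<close> is a multiple of the
  level. They are permuted by the modular group, and a linear combination with
  coefficients \<open>\<mu>\<close> has at the cusp \<open>A \<infinity>\<close> the value \<open>\<Sum>b. class_sum N b * \<mu> (b v)\<close>, where \<open>v\<close> is the
  bottom row of the inverse of \<open>A\<close>, up to an additive constant that is the same for all cusps. The classes \<open>\<plusminus>1\<close> dominate this operator, so it is inverted by a Neumann series
  (\<open>solve_class_sum_equation\<close>), and for every cusp there is a form that has the value \<open>1 + K\<close>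
  there and \<open>K\<close> at all other cusps (\<open>weight_two_form_at_cusp\<close>). On the other hand, the values of a
  weight two form sum to zero over the cosets of \<open>G\<close> (\<open>sum_cusp_values_weight_two\<close>): the trace is a
  form of level one, and the periods of its primitive vanish. This relation forces \<open>K \<noteq> 0\<close>,
  so differences of two such forms, suitably scaled, are dual to all cusps but one; it also says
  that the remaining value is determined, whence the \<open>-1\<close> in the formula.\<close>

(* The symbol denotes components of vectors below; a second reading as a coefficient of a power
   series would make every matrix entry ambiguous. *)
no_notation fps_nth (infixl \<open>$\<close> 75)

section \<open>The action of the modular group\<close>

lemma SL2Z_iff: "A \<in> carrier SL2Z \<longleftrightarrow> A$1$1 * A$2$2 - A$1$2 * A$2$1 = 1"
  by (simp add: SL2Z_def det_2)

lemma SL2Z_det_of_int: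
  "A \<in> carrier SL2Z \<Longrightarrow>
    of_int (A$1$1) * of_int (A$2$2) - of_int (A$1$2) * of_int (A$2$1) = (1 :: 'a :: ring_1)"
  unfolding SL2Z_iff by (simp flip: of_int_mult of_int_diff)

lemma SL2Z_mult [simp]: "A \<otimes>\<^bsub>SL2Z\<^esub> B = A ** B"
  by (simp add: SL2Z_def)

lemma SL2Z_one [simp]: "\<one>\<^bsub>SL2Z\<^esub> = mat 1"
  by (simp add: SL2Z_def)

interpretation SL2Z: group SL2Z
  by (rule group_SL2Z)

lemma mat2_eq_iff: "(A :: 'a ^ 2 ^ 2) = B \<longleftrightarrow>
    A$1$1 = B$1$1 \<and> A$1$2 = B$1$2 \<and> A$2$1 = B$2$1 \<and> A$2$2 = B$2$2"
  by (auto simp: vec_eq_iff forall_2)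

lemma mat2_mult_nth [simp]: "((A :: 'a::semiring_1 ^ 2 ^ 2) ** B) $ i $ j = A$i$1 * B$1$j + A$i$2 * B$2$j"
  by (simp add: matrix_matrix_mult_def sum_2)

lemma mat2_one_nth [simp]:
  "(mat 1 :: int ^ 2 ^ 2)$1$1 = 1" "(mat 1 :: int ^ 2 ^ 2)$2$2 = 1"
  "(mat 1 :: int ^ 2 ^ 2)$1$2 = 0" "(mat 1 :: int ^ 2 ^ 2)$2$1 = 0"
  by (simp_all add: mat_def)

definition mat2 :: "int \<Rightarrow> int \<Rightarrow> int \<Rightarrow> int \<Rightarrow> int ^ 2 ^ 2" where
  "mat2 a b c d = vector [vector [a, b], vector [c, d]]"

lemma mat2_nth [simp]:
  "mat2 a b c d $1$1 = a" "mat2 a b c d $1$2 = b" "mat2 a b c d $2$1 = c" "mat2 a b c d $2$2 = d"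
  by (simp_all add: mat2_def vector_2)

lemma mat1_in_SL2Z [simp]: "mat 1 \<in> carrier SL2Z" "- mat 1 \<in> carrier SL2Z"
  by (simp_all add: SL2Z_iff)

lemma SL2Z_closed [simp]: "A \<in> carrier SL2Z \<Longrightarrow> B \<in> carrier SL2Z \<Longrightarrow> A ** B \<in> carrier SL2Z"
  using SL2Z.m_closed by simp

lemma uminus_in_SL2Z [simp]: "- A \<in> carrier SL2Z \<longleftrightarrow> A \<in> carrier SL2Z"
  by (simp add: SL2Z_iff)

definition SL2Z_inv :: "int ^ 2 ^ 2 \<Rightarrow> int ^ 2 ^ 2" where
  "SL2Z_inv A = mat2 (A$2$2) (- A$1$2) (- A$2$1) (A$1$1)"

lemma SL2Z_inv_nth [simp]:
  "SL2Z_inv A $1$1 = A$2$2" "SL2Z_inv A $1$2 = - A$1$2"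
  "SL2Z_inv A $2$1 = - A$2$1" "SL2Z_inv A $2$2 = A$1$1"
  by (simp_all add: SL2Z_inv_def)

lemma SL2Z_inv_closed [simp]: "A \<in> carrier SL2Z \<Longrightarrow> SL2Z_inv A \<in> carrier SL2Z"
  by (simp add: SL2Z_iff algebra_simps)

lemma SL2Z_inv_cancel:
  assumes "A \<in> carrier SL2Z"
  shows "SL2Z_inv A ** A = mat 1" "A ** SL2Z_inv A = mat 1"
  using assms by (auto simp: SL2Z_iff mat2_eq_iff algebra_simps)

lemma inv_SL2Z: "A \<in> carrier SL2Z \<Longrightarrow> inv\<^bsub>SL2Z\<^esub> A = SL2Z_inv A"
  by (rule SL2Z.inv_equality) (simp_all add: SL2Z_inv_cancel)

lemma SL2Z_inv_cancel_left:
  assumes "A \<in> carrier SL2Z"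
  shows "SL2Z_inv A ** (A ** B) = B" "A ** (SL2Z_inv A ** B) = B"
  using SL2Z_inv_cancel[OF assms] by (simp_all add: matrix_mul_assoc)

lemma SL2Z_inv_cancel_right:
  assumes "A \<in> carrier SL2Z"
  shows "B ** SL2Z_inv A ** A = B" "B ** A ** SL2Z_inv A = B"
  using SL2Z_inv_cancel[OF assms] by (simp_all flip: matrix_mul_assoc)

lemma SL2Z_inv_inv [simp]: "SL2Z_inv (SL2Z_inv A) = A"
  by (simp add: mat2_eq_iff)

lemma SL2Z_inv_mult: "SL2Z_inv (A ** B) = SL2Z_inv B ** SL2Z_inv A"
  by (simp add: mat2_eq_iff algebra_simps)

lemma uminus_mat_mult:
  fixes A B :: "int ^ 2 ^ 2"
  shows "(- A) ** B = - (A ** B)" "A ** (- B) = - (A ** B)"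
  by (simp_all add: mat2_eq_iff)

definition transl :: "int \<Rightarrow> int ^ 2 ^ 2" where
  "transl n = mat2 1 n 0 1"

lemma transl_nth [simp]: "transl n $1$1 = 1" "transl n $1$2 = n" "transl n $2$1 = 0" "transl n $2$2 = 1"
  by (simp_all add: transl_def)

lemma transl_in_SL2Z [simp]: "transl n \<in> carrier SL2Z"
  by (simp add: SL2Z_iff)

lemma transl_mult: "transl m ** transl n = transl (m + n)"
  by (simp add: mat2_eq_iff algebra_simps)

lemma transl_0 [simp]: "transl 0 = mat 1"
  by (simp add: mat2_eq_iff)

lemma SL2Z_inv_transl [simp]: "SL2Z_inv (transl n) = transl (- n)"
  by (simp add: mat2_eq_iff)

lemma T_mat_pow: "T_mat [^]\<^bsub>SL2Z\<^esub> (n::nat) = transl (int n)"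
proof (induction n)
  case (Suc n)
  have T: "T_mat = transl 1" by (simp add: T_mat_def mat2_eq_iff vector_2)
  have "T_mat [^]\<^bsub>SL2Z\<^esub> Suc n = (T_mat [^]\<^bsub>SL2Z\<^esub> n) ** T_mat" by simp
  also have "\<dots> = transl (int n) ** transl 1" unfolding Suc.IH by (subst T) (rule refl)
  also have "\<dots> = transl (int (Suc n))" by (simp add: transl_mult add.commute)
  finally show ?case .
qed simp

lemma transl_int_pow: "transl m [^]\<^bsub>SL2Z\<^esub> (n::int) = transl (n * m)"
proof -
  have *: "transl m [^]\<^bsub>SL2Z\<^esub> (n::nat) = transl (int n * m)" for n
    by (induction n) (simp_all add: transl_mult algebra_simps)
  show ?thesis
    by (cases "n \<ge> 0")
      (auto simp: int_pow_def2 * inv_SL2Z)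
qed

subsection \<open>Action on the upper half-plane\<close>

abbreviation \<H> :: "complex set" where "\<H> \<equiv> upper_half_plane"

lemma in_H_iff: "\<tau> \<in> \<H> \<longleftrightarrow> Im \<tau> > 0"
  by (simp add: upper_half_plane_def)

lemma open_H [simp]: "open \<H>"
  unfolding upper_half_plane_def by (rule open_halfspace_Im_gt)

lemma convex_H [simp]: "convex \<H>"
  unfolding upper_half_plane_def by (rule convex_halfspace_Im_gt)

lemma linear_form_nonzero:
  fixes c d :: int
  assumes "\<tau> \<in> \<H>" "(c, d) \<noteq> (0, 0)"
  shows "of_int c * \<tau> + of_int d \<noteq> 0"
proof
  assume *: "of_int c * \<tau> + of_int d = 0"
  then have "Im (of_int c * \<tau> + of_int d) = 0" by simp
  then have "c = 0" using assms by (simp add: in_H_iff)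
  with * show False using assms by simp
qed

lemma aut_factor_nonzero: "A \<in> carrier SL2Z \<Longrightarrow> \<tau> \<in> \<H> \<Longrightarrow> aut_factor A \<tau> \<noteq> 0"
  unfolding aut_factor_def by (rule linear_form_nonzero) (auto simp: SL2Z_iff)

lemma Im_moebius:
  assumes "A \<in> carrier SL2Z" "\<tau> \<in> \<H>"
  shows "Im (moebius A \<tau>) = Im \<tau> / (cmod (aut_factor A \<tau>))\<^sup>2"
proof -
  have d: "real_of_int (A$1$1) * of_int (A$2$2) - of_int (A$1$2) * of_int (A$2$1) = 1"
    using assms(1) by (rule SL2Z_det_of_int)
  have "Im \<tau> * (of_int (A$1$1) * of_int (A$2$2) - of_int (A$1$2) * of_int (A$2$1)) = Im \<tau>"
    by (simp add: d)
  then have d2: "Im \<tau> * (of_int (A$1$1) * of_int (A$2$2)) = Im \<tau> + Im \<tau> * (of_int (A$1$2) * of_int (A$2$1))"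
    by (simp add: right_diff_distrib)
  show ?thesis
    unfolding moebius_def Im_divide cmod_power2
    by (rule arg_cong2[where f = "(/)"]) (use d2 in \<open>simp_all add: aut_factor_def algebra_simps\<close>)
qed

lemma moebius_in_H [simp]: "A \<in> carrier SL2Z \<Longrightarrow> \<tau> \<in> \<H> \<Longrightarrow> moebius A \<tau> \<in> \<H>"
  using aut_factor_nonzero[of A \<tau>] by (simp add: in_H_iff Im_moebius)

lemma aut_factor_mult:
  assumes "A \<in> carrier SL2Z" "B \<in> carrier SL2Z" "\<tau> \<in> \<H>"
  shows "aut_factor (A ** B) \<tau> = aut_factor A (moebius B \<tau>) * aut_factor B \<tau>"
  using aut_factor_nonzero[OF assms(2,3)]
  by (simp add: aut_factor_def[of A] moebius_def field_simps) (simp add: aut_factor_def field_simps)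

lemma moebius_mult:
  assumes "A \<in> carrier SL2Z" "B \<in> carrier SL2Z" "\<tau> \<in> \<H>"
  shows "moebius (A ** B) \<tau> = moebius A (moebius B \<tau>)"
proof -
  let ?j = "aut_factor B \<tau>"
  have j: "?j \<noteq> 0" using assms by (simp add: aut_factor_nonzero)
  have "(of_int ((A**B)$1$1) * \<tau> + of_int ((A**B)$1$2)) =
     (of_int (A$1$1) * moebius B \<tau> + of_int (A$1$2)) * ?j"
    using j by (simp add: moebius_def field_simps) (simp add: aut_factor_def field_simps)
  then show ?thesis
    using j unfolding moebius_def[of "A**B"] aut_factor_mult[OF assms]
    by (simp add: moebius_def[of A])
qed

lemma moebius_one [simp]: "moebius (mat 1) \<tau> = \<tau>"
  by (simp add: moebius_def aut_factor_def)

lemma moebius_uminus: "moebius (- A) \<tau> = moebius A \<tau>"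
proof -
  have "aut_factor (- A) \<tau> = - aut_factor A \<tau>" by (simp add: aut_factor_def)
  moreover have "of_int ((- A)$1$1) * \<tau> + of_int ((- A)$1$2) = - (of_int (A$1$1) * \<tau> + of_int (A$1$2))"
    by simp
  ultimately show ?thesis unfolding moebius_def by (metis minus_divide_divide)
qed

lemma moebius_transl [simp]: "moebius (transl n) \<tau> = \<tau> + of_int n"
  by (simp add: moebius_def aut_factor_def)

lemma aut_factor_transl [simp]: "aut_factor (transl n) \<tau> = 1"
  by (simp add: aut_factor_def)

lemma moebius_inverse:
  assumes "A \<in> carrier SL2Z" "\<tau> \<in> \<H>"
  shows "moebius (SL2Z_inv A) (moebius A \<tau>) = \<tau>" "moebius A (moebius (SL2Z_inv A) \<tau>) = \<tau>"
  using assms moebius_mult[of "SL2Z_inv A" A \<tau>] moebius_mult[of A "SL2Z_inv A" \<tau>]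
  by (simp_all add: SL2Z_inv_cancel)

lemma moebius_holomorphic [holomorphic_intros]:
  assumes "A \<in> carrier SL2Z" shows "moebius A holomorphic_on \<H>"
  unfolding moebius_def[abs_def] using aut_factor_nonzero[OF assms]
  by (auto intro!: holomorphic_intros simp: aut_factor_def[abs_def])

lemma moebius_deriv:
  assumes "A \<in> carrier SL2Z" "\<tau> \<in> \<H>"
  shows "(moebius A has_field_derivative 1 / (aut_factor A \<tau>)\<^sup>2) (at \<tau>)"
proof -
  have d: "of_int (A$1$1) * of_int (A$2$2) - of_int (A$1$2) * of_int (A$2$1) = (1::complex)"
    using assms(1) by (rule SL2Z_det_of_int)
  have nz: "of_int (A$2$1) * \<tau> + of_int (A$2$2) \<noteq> 0"
    using aut_factor_nonzero[OF assms] by (simp add: aut_factor_def)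
  have "of_int (A$1$1) * (of_int (A$2$1) * \<tau> + of_int (A$2$2)) -
      (of_int (A$1$1) * \<tau> + of_int (A$1$2)) * of_int (A$2$1) = 1"
    using d by (simp add: algebra_simps)
  then show ?thesis
    unfolding moebius_def[abs_def] aut_factor_def
    using nz by (auto intro!: derivative_eq_intros simp: power2_eq_square)
qed

lemma slash_mult:
  assumes "A \<in> carrier SL2Z" "B \<in> carrier SL2Z" "\<tau> \<in> \<H>"
  shows "slash k f (A ** B) \<tau> = slash k (slash k f A) B \<tau>"
  using assms by (simp add: slash_def moebius_mult aut_factor_mult power_mult_distrib)

lemma slash_uminus: "slash k f (- A) \<tau> = (- 1) ^ k * slash k f A \<tau>"
proof -
  have "aut_factor (- A) \<tau> = - 1 * aut_factor A \<tau>" by (simp add: aut_factor_def)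
  then have "aut_factor (- A) \<tau> ^ k = (- 1) ^ k * aut_factor A \<tau> ^ k"
    by (simp only: power_mult_distrib)
  then show ?thesis
    by (cases "even k") (auto simp: slash_def moebius_uminus)
qed

lemma slash_transl: "slash k f (transl n) \<tau> = f (\<tau> + of_int n)"
  by (simp add: slash_def)

lemma slash_cong:
  assumes "\<And>\<tau>. \<tau> \<in> \<H> \<Longrightarrow> f \<tau> = g \<tau>" "A \<in> carrier SL2Z" "\<tau> \<in> \<H>"
  shows "slash k f A \<tau> = slash k g A \<tau>"
  using assms by (simp add: slash_def)

lemma slash_add: "slash k (\<lambda>\<tau>. f \<tau> + g \<tau>) A \<tau> = slash k f A \<tau> + slash k g A \<tau>"
  by (simp add: slash_def add_divide_distrib)

lemma slash_cmult: "slash k (\<lambda>\<tau>. c * f \<tau>) A \<tau> = c * slash k f A \<tau>"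
  by (simp add: slash_def)

lemma slash_sum: "slash k (\<lambda>\<tau>. \<Sum>i\<in>I. f i \<tau>) A \<tau> = (\<Sum>i\<in>I. slash k (f i) A \<tau>)"
  by (simp add: slash_def sum_divide_distrib)

lemma slash_holomorphic:
  assumes "f holomorphic_on \<H>" "A \<in> carrier SL2Z"
  shows "slash k f A holomorphic_on \<H>"
proof -
  have "(f \<circ> moebius A) holomorphic_on \<H>"
    using assms by (intro holomorphic_on_compose_gen[where t = \<H>] moebius_holomorphic) auto
  then show ?thesis
    unfolding slash_def[abs_def] o_def
    using aut_factor_nonzero[OF assms(2)]
    by (auto intro!: holomorphic_intros simp: aut_factor_def[abs_def])
qed

subsection \<open>Action on the rational projective line\<close>

lemma proj_act_one [simp]: "proj_act (mat 1) x = x"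
  by (cases x) auto

text \<open>A point of the projective line is the class of a nonzero vector \<open>(p, q)\<close>, and
  the action is the linear one; this reduces identities about \<^const>\<open>proj_act\<close> to linear algebra.\<close>

definition proj_pt :: "rat \<Rightarrow> rat \<Rightarrow> rat option" where
  "proj_pt p q = (if q = 0 then None else Some (p / q))"

lemma proj_act_proj_pt:
  assumes "A \<in> carrier SL2Z" "(p, q) \<noteq> (0, 0)"
  shows "proj_act A (proj_pt p q) =
    proj_pt (of_int (A$1$1) * p + of_int (A$1$2) * q) (of_int (A$2$1) * p + of_int (A$2$2) * q)"
proof (cases "q = 0")
  case True
  then show ?thesis using assms by (auto simp: proj_pt_def)
next
  case False
  have e: "of_int (A$2$1) * (p / q) + of_int (A$2$2) = (of_int (A$2$1) * p + of_int (A$2$2) * q) / q"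
    "of_int (A$1$1) * (p / q) + of_int (A$1$2) = (of_int (A$1$1) * p + of_int (A$1$2) * q) / q"
    using False by (simp_all add: field_simps)
  show ?thesis using False unfolding proj_pt_def by (simp add: e del: times_divide_eq_right)
qed

lemma proj_pt_surj: obtains p q where "x = proj_pt p q" "(p, q) \<noteq> (0, 0)"
proof (cases x)
  case None
  then show ?thesis using that[of 1 0] by (simp add: proj_pt_def)
next
  case (Some y)
  then show ?thesis using that[of y 1] by (simp add: proj_pt_def)
qed

lemma proj_act_mult:
  assumes "A \<in> carrier SL2Z" "B \<in> carrier SL2Z"
  shows "proj_act (A ** B) x = proj_act A (proj_act B x)"
proof -
  obtain p q where x: "x = proj_pt p q" and nz: "(p, q) \<noteq> (0, 0)" by (rule proj_pt_surj)
  let ?p = "of_int (B$1$1) * p + of_int (B$1$2) * q" and ?q = "of_int (B$2$1) * p + of_int (B$2$2) * q"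
  have d: "of_int (B$1$1) * of_int (B$2$2) - of_int (B$1$2) * of_int (B$2$1) = (1::rat)"
    using assms(2) by (rule SL2Z_det_of_int)
  have nz': "(?p, ?q) \<noteq> (0, 0)"
  proof
    assume "(?p, ?q) = (0, 0)"
    then have z: "?p = 0" "?q = 0" by auto
    have "p = (of_int (B$1$1) * of_int (B$2$2) - of_int (B$1$2) * of_int (B$2$1)) * p" by (simp add: d)
    also have "\<dots> = of_int (B$2$2) * ?p - of_int (B$1$2) * ?q" by (simp add: algebra_simps)
    finally have "p = 0" by (simp only: z mult_zero_right diff_self)
    moreover have "q = (of_int (B$1$1) * of_int (B$2$2) - of_int (B$1$2) * of_int (B$2$1)) * q" by (simp add: d)
    then have "q = of_int (B$1$1) * ?q - of_int (B$2$1) * ?p" by (simp add: algebra_simps)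
    then have "q = 0" by (simp only: z mult_zero_right diff_self)
    ultimately show False using nz by simp
  qed
  show ?thesis
    using assms nz nz' by (simp add: x proj_act_proj_pt) (simp add: algebra_simps)
qed

lemma proj_act_inverse:
  assumes "A \<in> carrier SL2Z"
  shows "proj_act (SL2Z_inv A) (proj_act A x) = x" "proj_act A (proj_act (SL2Z_inv A) x) = x"
  using proj_act_mult[of "SL2Z_inv A" A x] proj_act_mult[of A "SL2Z_inv A" x] assms
  by (simp_all add: SL2Z_inv_cancel)

lemma coprime_column_SL2Z:
  assumes "coprime (a::int) c"
  obtains A where "A \<in> carrier SL2Z" "A$1$1 = a" "A$2$1 = c"
proof -
  obtain u v where "a * u + c * v = 1"
    using assms by (metis bezout_int coprime_imp_gcd_eq_1 mult.commute)
  then show ?thesis using that[of "mat2 a (- v) c u"] by (simp add: SL2Z_iff algebra_simps)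
qed

lemma proj_act_None_surj: obtains A where "A \<in> carrier SL2Z" "proj_act A None = x"
proof (cases x)
  case None
  then show ?thesis using that[of "mat 1"] by simp
next
  case (Some y)
  obtain a c where q: "quotient_of y = (a, c)" by fastforce
  then have "coprime a c" "c > 0" "y = of_int a / of_int c"
    using quotient_of_coprime quotient_of_denom_pos quotient_of_div by blast+
  then show ?thesis
    using Some by (elim coprime_column_SL2Z) (auto intro!: that)
qed

lemma proj_act_None_eq_iff:
  assumes "A \<in> carrier SL2Z"
  shows "proj_act A None = None \<longleftrightarrow> (\<exists>n. A = transl n \<or> A = - transl n)"
proof
  assume "proj_act A None = None"
  then have "A$2$1 = 0" by (auto split: if_splits)
  moreover from this have "A$1$1 * A$2$2 = 1" using assms by (simp add: SL2Z_iff)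
  ultimately have "A = transl (A$1$2) \<or> A = - transl (- A$1$2)"
    by (auto simp: zmult_eq_1_iff mat2_eq_iff)
  then show "\<exists>n. A = transl n \<or> A = - transl n" by blast
qed auto

section \<open>Congruence subgroups and their cosets\<close>

locale congruence_group =
  fixes G :: "(int ^ 2 ^ 2) set"
  assumes congruence: "congruence_subgroup G"
begin

lemma subgroup_G: "subgroup G SL2Z"
  using congruence by (simp add: congruence_subgroup_def)

lemma in_carrier [simp, intro]: "A \<in> G \<Longrightarrow> A \<in> carrier SL2Z"
  using subgroup.mem_carrier[OF subgroup_G] .

lemma mult_in [intro]: "A \<in> G \<Longrightarrow> B \<in> G \<Longrightarrow> A ** B \<in> G"
  using subgroup.m_closed[OF subgroup_G] by simp

lemma one_in [simp]: "mat 1 \<in> G"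
  using subgroup.one_closed[OF subgroup_G] by simp

lemma inv_in [intro]: "A \<in> G \<Longrightarrow> SL2Z_inv A \<in> G"
  using subgroup.m_inv_closed[OF subgroup_G, of A] by (simp add: inv_SL2Z)

definition level :: nat where
  "level = (SOME N. N \<ge> 1 \<and> principal_congruence_subgroup N \<subseteq> G)"

lemma level: "level \<ge> 1" "principal_congruence_subgroup level \<subseteq> G"
proof -
  have "\<exists>N. N \<ge> 1 \<and> principal_congruence_subgroup N \<subseteq> G"
    using congruence by (auto simp: congruence_subgroup_def)
  from someI_ex[OF this] show "level \<ge> 1" "principal_congruence_subgroup level \<subseteq> G"
    unfolding level_def by auto
qed

lemma congruent_one_in_G:
  assumes "A \<in> carrier SL2Z" "int level dvd A$1$1 - 1" "int level dvd A$1$2"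
    "int level dvd A$2$1" "int level dvd A$2$2 - 1"
  shows "A \<in> G"
proof -
  have "A \<in> principal_congruence_subgroup level"
    using assms unfolding principal_congruence_subgroup_def
    by (auto simp: forall_2 mod_eq_dvd_iff)
  then show ?thesis using level by blast
qed

text \<open>The principal congruence subgroup is normal in the full modular group.\<close>

lemma conj_congruent_in_G:
  assumes X: "X \<in> carrier SL2Z" and E: "E \<in> carrier SL2Z"
    and dv: "int level dvd E$1$1 - 1" "int level dvd E$1$2" "int level dvd E$2$1" "int level dvd E$2$2 - 1"
  shows "X ** E ** SL2Z_inv X \<in> G"
proof (rule congruent_one_in_G)
  let ?Y = "X ** E ** SL2Z_inv X"
  have d: "X$1$1 * X$2$2 = 1 + X$1$2 * X$2$1" using X by (simp add: SL2Z_iff)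
  have lin: "int level dvd (E$1$1 - 1) * p + E$2$1 * q + E$1$2 * r + (E$2$2 - 1) * s" for p q r s
    using dv by (intro dvd_add dvd_mult2)
  have "?Y$1$1 - 1 = (E$1$1 - 1) * (X$1$1 * X$2$2) + E$2$1 * (X$1$2 * X$2$2) + E$1$2 * (- X$1$1 * X$2$1) + (E$2$2 - 1) * (- X$1$2 * X$2$1)"
    "?Y$1$2 = (E$1$1 - 1) * (- X$1$1 * X$1$2) + E$2$1 * (- X$1$2 * X$1$2) + E$1$2 * (X$1$1 * X$1$1) + (E$2$2 - 1) * (X$1$1 * X$1$2)"
    "?Y$2$1 = (E$1$1 - 1) * (X$2$1 * X$2$2) + E$2$1 * (X$2$2 * X$2$2) + E$1$2 * (- X$2$1 * X$2$1) + (E$2$2 - 1) * (- X$2$1 * X$2$2)"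
    "?Y$2$2 - 1 = (E$1$1 - 1) * (- X$1$2 * X$2$1) + E$2$1 * (- X$1$2 * X$2$2) + E$1$2 * (X$1$1 * X$2$1) + (E$2$2 - 1) * (X$1$1 * X$2$2)"
    by (simp_all add: algebra_simps) (use d in \<open>simp_all add: algebra_simps\<close>)
  then show "int level dvd ?Y$1$1 - 1" "int level dvd ?Y$1$2" "int level dvd ?Y$2$1" "int level dvd ?Y$2$2 - 1"
    using lin by metis+
qed (use X E in auto)

lemma conj_transl_in_G:
  assumes "A \<in> carrier SL2Z" "int level dvd m"
  shows "A ** transl m ** SL2Z_inv A \<in> G"
  using assms by (intro conj_congruent_in_G) auto

definition coset :: "int ^ 2 ^ 2 \<Rightarrow> (int ^ 2 ^ 2) set" where
  "coset A = (\<lambda>B. B ** A) ` G"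

definition cosets :: "(int ^ 2 ^ 2) set set" where
  "cosets = coset ` carrier SL2Z"

definition coset_rep :: "(int ^ 2 ^ 2) set \<Rightarrow> int ^ 2 ^ 2" where
  "coset_rep c = (SOME A. A \<in> carrier SL2Z \<and> coset A = c)"

lemma coset_rep:
  assumes "c \<in> cosets" shows "coset_rep c \<in> carrier SL2Z" "coset (coset_rep c) = c"
proof -
  have "\<exists>A. A \<in> carrier SL2Z \<and> coset A = c" using assms by (auto simp: cosets_def)
  from someI_ex[OF this] show "coset_rep c \<in> carrier SL2Z" "coset (coset_rep c) = c"
    unfolding coset_rep_def by auto
qed

lemma coset_eqD:
  assumes "coset A = coset B" "A \<in> carrier SL2Z" "B \<in> carrier SL2Z"
  obtains C where "C \<in> G" "A = C ** B"
proof -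
  have "A \<in> coset A" unfolding coset_def by (intro image_eqI[of _ _ "mat 1"]) auto
  then have "A \<in> coset B" using assms by simp
  then show ?thesis using that by (auto simp: coset_def)
qed

lemma coset_mult_left:
  assumes "C \<in> G" "A \<in> carrier SL2Z" shows "coset (C ** A) = coset A"
proof (intro equalityI subsetI)
  fix X assume "X \<in> coset (C ** A)"
  then obtain B where "B \<in> G" "X = (B ** C) ** A" by (auto simp: coset_def matrix_mul_assoc)
  then show "X \<in> coset A" using assms by (auto simp: coset_def)
next
  fix X assume "X \<in> coset A"
  then obtain B where B: "B \<in> G" "X = B ** A" by (auto simp: coset_def)
  have "X = (B ** SL2Z_inv C) ** (C ** A)"
    using assms B by (simp add: matrix_mul_assoc SL2Z_inv_cancel_right)
  then show "X \<in> coset (C ** A)" using assms B unfolding coset_def by blast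
qed

lemma coset_rep_of_coset:
  assumes "A \<in> carrier SL2Z"
  obtains C where "C \<in> G" "coset_rep (coset A) = C ** A"
  using coset_eqD[of "coset_rep (coset A)" A] coset_rep[of "coset A"] assms
  by (metis cosets_def image_eqI)

text \<open>Matrices that agree modulo the level lie in the same coset.\<close>

lemma finite_cosets: "finite cosets"
proof -
  define red where "red A = (A$1$1 mod int level, A$1$2 mod int level, A$2$1 mod int level, A$2$2 mod int level)"
    for A :: "int ^ 2 ^ 2"
  have fin: "finite (red ` carrier SL2Z)"
  proof (rule finite_subset)
    let ?I = "{0..<int level}"
    show "red ` carrier SL2Z \<subseteq> ?I \<times> ?I \<times> ?I \<times> ?I" using level by (auto simp: red_def)
  qed auto
  have eq: "coset A = coset B" if "red A = red B" "A \<in> carrier SL2Z" "B \<in> carrier SL2Z" for A B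
  proof -
    let ?C = "A ** SL2Z_inv B"
    have "\<forall>i j. int level dvd A$i$j - B$i$j"
      unfolding forall_2 using that(1) by (simp add: red_def mod_eq_dvd_iff)
    then have dv: "int level dvd A$i$j - B$i$j" for i j :: 2 by blast
    have d: "B$1$1 * B$2$2 = 1 + B$1$2 * B$2$1" using that(3) by (simp add: SL2Z_iff)
    have "?C$1$1 - 1 = (A$1$1 - B$1$1) * B$2$2 - (A$1$2 - B$1$2) * B$2$1"
      "?C$1$2 = (A$1$2 - B$1$2) * B$1$1 - (A$1$1 - B$1$1) * B$1$2"
      "?C$2$1 = (A$2$1 - B$2$1) * B$2$2 - (A$2$2 - B$2$2) * B$2$1"
      "?C$2$2 - 1 = (A$2$2 - B$2$2) * B$1$1 - (A$2$1 - B$2$1) * B$1$2"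
      using d by (simp_all add: algebra_simps)
    moreover have "int level dvd (A$i$j - B$i$j) * x - (A$i'$j' - B$i'$j') * y" for i j i' j' x y
      by (intro dvd_diff[OF dvd_mult2[OF dv] dvd_mult2[OF dv]])
    ultimately have "?C \<in> G"
      using that dv by (intro congruent_one_in_G) (simp_all only: SL2Z_closed SL2Z_inv_closed)
    then have "coset (?C ** B) = coset B" using that by (intro coset_mult_left)
    then show ?thesis using that by (simp add: SL2Z_inv_cancel_right)
  qed
  have "cosets = (\<lambda>x. coset (SOME A. A \<in> carrier SL2Z \<and> red A = x)) ` red ` carrier SL2Z"
    unfolding cosets_def image_image
  proof (rule image_cong[OF refl])
    fix A assume A: "A \<in> carrier SL2Z"
    have "\<exists>B. B \<in> carrier SL2Z \<and> red B = red A" using A by blast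
    from someI_ex[OF this] show "coset A = coset (SOME B. B \<in> carrier SL2Z \<and> red B = red A)"
      by (intro eq A) simp_all
  qed
  then show ?thesis using fin by simp
qed

text \<open>Right multiplication by \<open>D\<close> permutes the cosets; the invariance of \<open>h\<close> absorbs the change of representatives.\<close>

lemma sum_cosets_translate:
  fixes h :: "int ^ 2 ^ 2 \<Rightarrow> 'b :: comm_monoid_add"
  assumes D: "D \<in> carrier SL2Z"
    and inv: "\<And>C A. C \<in> G \<Longrightarrow> A \<in> carrier SL2Z \<Longrightarrow> h (C ** A) = h A"
  shows "(\<Sum>c\<in>cosets. h (coset_rep c ** D)) = (\<Sum>c\<in>cosets. h (coset_rep c))"
proof -
  have wd: "h A = h B" if "coset A = coset B" "A \<in> carrier SL2Z" "B \<in> carrier SL2Z" for A B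
    using coset_eqD[OF that] inv that by metis
  have img: "(\<lambda>X. X ** D) ` coset A = coset (A ** D)" for A
    by (auto simp: coset_def image_iff matrix_mul_assoc)
  define i where "i c = (\<lambda>X. X ** D) ` c" for c :: "(int ^ 2 ^ 2) set"
  have inj: "inj_on i cosets"
  proof (rule inj_onI)
    fix c c' assume "i c = i c'"
    then have "(\<lambda>X. X ** SL2Z_inv D) ` i c = (\<lambda>X. X ** SL2Z_inv D) ` i c'" by simp
    then show "c = c'" using D by (simp add: i_def image_image SL2Z_inv_cancel_right)
  qed
  have sub: "i ` cosets \<subseteq> cosets"
    using D by (auto simp: i_def cosets_def img)
  have "i ` cosets = cosets"
    using finite_cosets inj sub by (metis endo_inj_surj)
  then have "(\<Sum>c\<in>cosets. h (coset_rep c)) = (\<Sum>c\<in>i ` cosets. h (coset_rep c))" by simp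
  also have "\<dots> = (\<Sum>c\<in>cosets. h (coset_rep (i c)))" using inj by (simp add: sum.reindex)
  also have "\<dots> = (\<Sum>c\<in>cosets. h (coset_rep c ** D))"
  proof (rule sum.cong[OF refl], rule wd)
    fix c assume c: "c \<in> cosets"
    then have ic: "i c \<in> cosets" using sub by blast
    show "coset (coset_rep (i c)) = coset (coset_rep c ** D)"
      using coset_rep[OF ic] coset_rep[OF c] img[of "coset_rep c"] by (simp add: i_def)
    show "coset_rep (i c) \<in> carrier SL2Z" "coset_rep c ** D \<in> carrier SL2Z"
      using coset_rep[OF ic] coset_rep[OF c] D by auto
  qed
  finally show ?thesis by simp
qed

end

section \<open>Values at the cusps\<close>

text \<open>Approach to the cusp at infinity, uniformly in the real part.\<close>

abbreviation at_ioo :: "complex filter" where "at_ioo \<equiv> filtercomap Im at_top"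

lemma eventually_at_ioo: "eventually P at_ioo \<longleftrightarrow> (\<exists>Y. \<forall>\<tau>. Im \<tau> \<ge> Y \<longrightarrow> P \<tau>)"
  by (simp add: eventually_filtercomap_at_top_linorder)

lemma at_ioo_neq_bot [simp]: "at_ioo \<noteq> bot"
proof
  assume "at_ioo = bot"
  then have "eventually (\<lambda>_. False) at_ioo" by simp
  then obtain Y where "\<forall>\<tau>. Im \<tau> \<ge> Y \<longrightarrow> False" unfolding eventually_at_ioo by blast
  from this[rule_format, of "Complex 0 Y"] show False by simp
qed

lemma eventually_in_H_at_ioo: "eventually (\<lambda>\<tau>. \<tau> \<in> \<H>) at_ioo"
  unfolding eventually_at_ioo by (intro exI[of _ 1]) (auto simp: in_H_iff)

lemma tendsto_at_ioo_transl:
  assumes "(f \<longlongrightarrow> L) at_ioo" shows "((\<lambda>\<tau>. f (\<tau> + of_int n)) \<longlongrightarrow> L) at_ioo"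
proof -
  have "filterlim (\<lambda>\<tau>. \<tau> + of_int n) at_ioo at_ioo"
    unfolding filterlim_filtercomap_iff by (simp add: o_def filterlim_filtercomap)
  from filterlim_compose[OF assms this] show ?thesis .
qed

definition qexp :: "nat \<Rightarrow> complex \<Rightarrow> complex" where
  "qexp h \<tau> = exp (2 * of_real pi * \<i> * \<tau> / of_nat h)"

lemma norm_qexp: "norm (qexp h \<tau>) = exp (- (2 * pi * Im \<tau> / real h))"
  by (simp add: qexp_def norm_exp_eq_Re)

lemma qexp_nonzero [simp]: "qexp h \<tau> \<noteq> 0"
  by (simp add: qexp_def)

lemma tendsto_qexp: 
  assumes "h \<ge> 1" shows "filterlim (qexp h) (at 0) at_ioo"
proof -
  have "((\<lambda>y. exp (- (2 * pi * y / real h))) \<longlongrightarrow> 0) at_top"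
    using assms by real_asymp
  then have "((\<lambda>\<tau>. norm (qexp h \<tau>)) \<longlongrightarrow> 0) at_ioo"
    unfolding norm_qexp by (rule filterlim_compose) (rule filterlim_filtercomap)
  then show ?thesis
    unfolding filterlim_at by (auto simp: tendsto_norm_zero_iff)
qed

lemma q_expansion_tendsto:
  assumes "q_expansion_at_infinity h F f" shows "(f \<longlongrightarrow> F 0) at_ioo"
proof -
  have h: "h \<ge> 1" and F: "F holomorphic_on ball 0 1" and f: "\<And>\<tau>. \<tau> \<in> \<H> \<Longrightarrow> f \<tau> = F (qexp h \<tau>)"
    using assms by (auto simp: q_expansion_at_infinity_def qexp_def)
  have "isCont F 0"
    using holomorphic_on_imp_continuous_on[OF F] by (simp add: continuous_on_eq_continuous_at)
  then have "((\<lambda>\<tau>. F (qexp h \<tau>)) \<longlongrightarrow> F 0) at_ioo"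
    unfolding isCont_def by (rule filterlim_compose) (rule tendsto_qexp[OF h])
  then show ?thesis
    by (rule Lim_transform_eventually)
      (use eventually_in_H_at_ioo in eventually_elim, simp add: f)
qed

text \<open>The inverse of \<^const>\<open>qexp\<close> up to periods is a logarithm; any branch gives the same function
  on the punctured disc, and the limit at infinity fills in the centre.\<close>

definition qext :: "nat \<Rightarrow> complex \<Rightarrow> (complex \<Rightarrow> complex) \<Rightarrow> complex \<Rightarrow> complex" where
  "qext h L f q = (if q = 0 then L else f (of_nat h * Ln q / (2 * of_real pi * \<i>)))"

lemma period_int_multiple:
  assumes per: "\<And>\<tau>. \<tau> \<in> \<H> \<Longrightarrow> f (\<tau> + of_nat h) = f \<tau>" and "\<tau> \<in> \<H>"
  shows "f (\<tau> + of_nat h * of_int n) = f \<tau>"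
proof -
  have *: "f (\<tau> + of_nat h * of_nat n) = f \<tau>" if "\<tau> \<in> \<H>" for n \<tau>
  proof (induction n)
    case (Suc n)
    have "\<tau> + of_nat h * of_nat n \<in> \<H>" using that by (simp add: in_H_iff)
    from per[OF this] Suc show ?case by (simp add: algebra_simps)
  qed simp
  show ?thesis
  proof (cases "n \<ge> 0")
    case True
    then show ?thesis using *[OF assms(2), of "nat n"] by simp
  next
    case False
    have "\<tau> + of_nat h * of_int n \<in> \<H>" using assms(2) by (simp add: in_H_iff)
    from *[OF this, of "nat (- n)"] False show ?thesis by simp
  qed
qed

lemma qext_qexp:
  assumes "h \<ge> 1" and per: "\<And>\<tau>. \<tau> \<in> \<H> \<Longrightarrow> f (\<tau> + of_nat h) = f \<tau>" and "\<tau> \<in> \<H>"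
  shows "qext h L f (qexp h \<tau>) = f \<tau>"
proof -
  have "exp (Ln (qexp h \<tau>)) = exp (2 * of_real pi * \<i> * \<tau> / of_nat h)"
    by (simp add: qexp_def)
  then obtain n :: int where n: "Ln (qexp h \<tau>) = 2 * of_real pi * \<i> * \<tau> / of_nat h + of_int (2 * n) * of_real pi * \<i>"
    unfolding exp_eq by (auto simp: algebra_simps)
  have "of_nat h * Ln (qexp h \<tau>) / (2 * of_real pi * \<i>) = \<tau> + of_nat h * of_int n"
    unfolding n using assms(1) by (simp add: field_simps)
  then show ?thesis
    using period_int_multiple[where f = f and h = h, OF per assms(3)] by (simp add: qext_def)
qed

text \<open>The expansion is holomorphic on the punctured disc by local branches of the logarithm, and its singularity
  at the centre is removable, because the limit exists.\<close>

lemma q_expansion_of_limit: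
  assumes h: "h \<ge> 1" and hol: "f holomorphic_on \<H>"
    and per: "\<And>\<tau>. \<tau> \<in> \<H> \<Longrightarrow> f (\<tau> + of_nat h) = f \<tau>" and lim: "(f \<longlongrightarrow> L) at_ioo"
  shows "q_expansion_at_infinity h (qext h L f) f"
proof -
  let ?F = "qext h L f"
  have "?F holomorphic_on ball 0 1 - {0}"
  proof (rule holomorphic_onI)
    fix q0 :: complex assume q0: "q0 \<in> ball 0 1 - {0}"
    \<comment> \<open>The quotient \<open>q / q0\<close> has positive real part on \<open>U\<close>, where \<open>Ln q0 + Ln (q / q0)\<close> is a holomorphic
      branch even if \<open>q0\<close> is a negative number.\<close>
    define U where "U = ball q0 (norm q0) \<inter> ball 0 1"
    define g where "g q = of_nat h * (Ln (q / q0) + Ln q0) / (2 * of_real pi * \<i>)" for q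
    have Re_pos: "Re (q / q0) > 0" if "q \<in> U" for q
    proof -
      have "norm (q / q0 - 1) < 1"
        using that q0 by (simp add: U_def dist_norm divide_simps norm_divide norm_minus_commute flip: diff_divide_distrib)
      moreover have "\<bar>Re (q / q0 - 1)\<bar> \<le> norm (q / q0 - 1)" by (rule abs_Re_le_cmod)
      ultimately show ?thesis by simp
    qed
    have gq: "qexp h (g q) = q" if "q \<in> U" for q
    proof -
      have "q / q0 \<noteq> 0" using Re_pos[OF that] by auto
      then have "q \<noteq> 0" by auto
      have "2 * of_real pi * \<i> * g q / of_nat h = Ln (q / q0) + Ln q0"
        using h by (simp add: g_def)
      then show ?thesis using q0 \<open>q \<noteq> 0\<close> by (simp add: qexp_def exp_add)
    qed
    have gH: "g q \<in> \<H>" if "q \<in> U" for q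
    proof -
      have "norm (qexp h (g q)) < 1" using gq[OF that] that by (simp add: U_def)
      then show ?thesis using h by (simp add: norm_qexp in_H_iff zero_less_mult_iff zero_less_divide_iff)
    qed
    have "(f \<circ> g) holomorphic_on U"
    proof (rule holomorphic_on_compose_gen[OF _ hol])
      show "g holomorphic_on U"
        unfolding g_def using q0 Re_pos
        by (intro holomorphic_intros) (force simp: complex_nonpos_Reals_iff)+
    qed (use gH in auto)
    moreover have "?F q = (f \<circ> g) q" if "q \<in> U" for q
      using qext_qexp[where f = f and h = h and L = L, OF h per gH[OF that]] gq[OF that] by simp
    ultimately have "?F holomorphic_on U" using holomorphic_transform by metis
    moreover have "open U" "q0 \<in> U" using q0 by (auto simp: U_def)
    ultimately show "?F field_differentiable at q0 within ball 0 1 - {0}"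
      using holomorphic_on_imp_differentiable_at field_differentiable_at_within by blast
  qed
  moreover have "(?F \<longlongrightarrow> ?F z) (at z within ball 0 1)" if "z \<in> {0}" for z
  proof -
    have "filterlim (\<lambda>q. of_nat h * Ln q / (2 * of_real pi * \<i>)) at_ioo (at 0)"
      unfolding filterlim_filtercomap_iff o_def
    proof (rule filterlim_cong[THEN iffD1, OF refl refl])
      show "\<forall>\<^sub>F q in at 0. - (real h * ln (norm q)) / (2 * pi) = Im (of_nat h * Ln q / (2 * of_real pi * \<i>))"
        unfolding eventually_at_filter by (auto simp: Im_divide power2_eq_square field_simps)
      have "filterlim (\<lambda>x::real. - (real h * ln x) / (2 * pi)) at_top (at_right 0)"
        using h by real_asymp
      moreover have "filterlim (norm :: complex \<Rightarrow> real) (at_right 0) (at 0)"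
        unfolding filterlim_at by (auto simp: eventually_at_filter intro!: tendsto_eq_intros)
      ultimately show "filterlim (\<lambda>q::complex. - (real h * ln (norm q)) / (2 * pi)) at_top (at 0)"
        by (rule filterlim_compose)
    qed
    from filterlim_compose[OF lim this]
    have "(?F \<longlongrightarrow> L) (at 0)"
      by (rule Lim_transform_eventually) (auto simp: eventually_at_filter qext_def)
    then show ?thesis using that by (simp add: qext_def[of h L f 0] Lim_at_imp_Lim_at_within)
  qed
  ultimately have "?F holomorphic_on ball 0 1"
    by (intro no_isolated_singularity'[of "{0}" ?F "ball 0 1"]; (simp; fail | assumption))
  then show ?thesis
    unfolding q_expansion_at_infinity_def using h qext_qexp[where f = f and h = h and L = L, OF h per] by (auto simp: qexp_def)
qed

text \<open>The argument is a matrix \<open>A\<close> and not the point \<open>A \<infinity>\<close>, because in odd weight the value depends on the sign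
  of \<open>A\<close>.\<close>

definition cusp_value :: "nat \<Rightarrow> (complex \<Rightarrow> complex) \<Rightarrow> int ^ 2 ^ 2 \<Rightarrow> complex" where
  "cusp_value k f A = Lim at_ioo (slash k f A)"

lemma cusp_value_eqI: "(slash k f A \<longlongrightarrow> L) at_ioo \<Longrightarrow> cusp_value k f A = L"
  unfolding cusp_value_def by (rule tendsto_Lim) auto

context congruence_group
begin

lemma level_dvd_transl_invariant:
  assumes inv: "\<forall>A\<in>G. \<forall>\<tau>\<in>\<H>. slash k f A \<tau> = f \<tau>" and "A \<in> carrier SL2Z" "\<tau> \<in> \<H>" "int level dvd m"
  shows "slash k f A (\<tau> + of_int m) = slash k f A \<tau>"
proof -
  let ?C = "A ** transl m ** SL2Z_inv A"
  have "slash k f A (\<tau> + of_int m) = slash k f (A ** transl m) \<tau>"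
    using assms by (simp add: slash_mult slash_transl)
  also have "A ** transl m = ?C ** A" using assms by (simp add: SL2Z_inv_cancel_right)
  also have "slash k f (?C ** A) \<tau> = slash k (slash k f ?C) A \<tau>"
    using assms by (intro slash_mult) auto
  also have "\<dots> = slash k f A \<tau>"
    using inv conj_transl_in_G[OF assms(2,4)] assms by (intro slash_cong) auto
  finally show ?thesis .
qed

text \<open>An expansion at a cusp exists as soon as the limit does, the level being a period there.\<close>

lemma modular_forms_iff:
  "f \<in> modular_forms k G \<longleftrightarrow> f holomorphic_on \<H> \<and> (\<forall>\<tau>. \<tau> \<notin> \<H> \<longrightarrow> f \<tau> = 0) \<and>
    (\<forall>A\<in>G. \<forall>\<tau>\<in>\<H>. slash k f A \<tau> = f \<tau>) \<and>
    (\<forall>A\<in>carrier SL2Z. \<exists>L. (slash k f A \<longlongrightarrow> L) at_ioo)"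
  (is "_ \<longleftrightarrow> ?R")
proof
  assume "f \<in> modular_forms k G"
  then show ?R unfolding modular_forms_def using q_expansion_tendsto by fast
next
  assume R: ?R
  have "\<exists>h F. q_expansion_at_infinity h F (slash k f A)" if A: "A \<in> carrier SL2Z" for A
  proof -
    obtain L where "(slash k f A \<longlongrightarrow> L) at_ioo" using R A by blast
    moreover have "slash k f A (\<tau> + of_nat level) = slash k f A \<tau>" if "\<tau> \<in> \<H>" for \<tau>
      using level_dvd_transl_invariant[of k f A \<tau> "int level"] R A that by simp
    ultimately show ?thesis
      using q_expansion_of_limit[OF level(1) slash_holomorphic] R A by blast
  qed
  then show "f \<in> modular_forms k G" using R by (simp add: modular_forms_def)
qed

lemma modular_formsD:
  assumes "f \<in> modular_forms k G"
  shows "f holomorphic_on \<H>" "\<And>\<tau>. \<tau> \<notin> \<H> \<Longrightarrow> f \<tau> = 0"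
    "\<And>A \<tau>. A \<in> G \<Longrightarrow> \<tau> \<in> \<H> \<Longrightarrow> slash k f A \<tau> = f \<tau>"
    "\<And>A. A \<in> carrier SL2Z \<Longrightarrow> (slash k f A \<longlongrightarrow> cusp_value k f A) at_ioo"
proof -
  show "(slash k f A \<longlongrightarrow> cusp_value k f A) at_ioo" if "A \<in> carrier SL2Z" for A
    using assms that unfolding modular_forms_iff by (metis cusp_value_eqI)
qed (use assms in \<open>auto simp: modular_forms_iff\<close>)

lemma slash_periodic:
  assumes "f \<in> modular_forms k G" "A \<in> carrier SL2Z" "\<tau> \<in> \<H>" "int level dvd m"
  shows "slash k f A (\<tau> + of_int m) = slash k f A \<tau>"
  using level_dvd_transl_invariant modular_formsD(3)[OF assms(1)] assms(2-) by blast

lemma q_expansion_level: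
  assumes "f \<in> modular_forms k G" "A \<in> carrier SL2Z"
  shows "q_expansion_at_infinity level (qext level (cusp_value k f A) (slash k f A)) (slash k f A)"
proof (rule q_expansion_of_limit)
  show "slash k f A (\<tau> + of_nat level) = slash k f A \<tau>" if "\<tau> \<in> \<H>" for \<tau>
    using slash_periodic[OF assms that, of "int level"] by simp
qed (use assms modular_formsD[OF assms(1)] level slash_holomorphic in auto)

lemma cusp_forms_iff:
  "f \<in> cusp_forms k G \<longleftrightarrow> f \<in> modular_forms k G \<and> (\<forall>A\<in>carrier SL2Z. cusp_value k f A = 0)"
proof
  assume *: "f \<in> cusp_forms k G"
  then have "(slash k f A \<longlongrightarrow> 0) at_ioo" if "A \<in> carrier SL2Z" for A
    using that q_expansion_tendsto unfolding cusp_forms_def by fastforce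
  then show "f \<in> modular_forms k G \<and> (\<forall>A\<in>carrier SL2Z. cusp_value k f A = 0)"
    using * by (auto simp: cusp_forms_def intro: cusp_value_eqI)
next
  assume *: "f \<in> modular_forms k G \<and> (\<forall>A\<in>carrier SL2Z. cusp_value k f A = 0)"
  have "\<exists>h F. q_expansion_at_infinity h F (slash k f A) \<and> F 0 = 0" if "A \<in> carrier SL2Z" for A
    using q_expansion_level[of f k A] * that
    by (intro exI[of _ level] exI[of _ "qext level 0 (slash k f A)"]) (auto simp: qext_def)
  then show "f \<in> cusp_forms k G" using * by (simp add: cusp_forms_def)
qed

lemma cusp_forms_modular: "f \<in> cusp_forms k G \<Longrightarrow> f \<in> modular_forms k G"
  by (simp add: cusp_forms_def)

lemma cusp_value_left_invariant:
  assumes "f \<in> modular_forms k G" "C \<in> G" "A \<in> carrier SL2Z"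
  shows "cusp_value k f (C ** A) = cusp_value k f A"
proof (rule cusp_value_eqI)
  have "slash k f (C ** A) \<tau> = slash k f A \<tau>" if "\<tau> \<in> \<H>" for \<tau>
    using that assms slash_cong[where A = A and \<tau> = \<tau>, OF modular_formsD(3)[OF assms(1,2)]] by (simp add: slash_mult)
  then show "(slash k f (C ** A) \<longlongrightarrow> cusp_value k f A) at_ioo"
    by (intro Lim_transform_eventually[OF modular_formsD(4)[OF assms(1,3)]])
      (use eventually_in_H_at_ioo in eventually_elim, simp)
qed

lemma cusp_value_transl:
  assumes "f \<in> modular_forms k G" "A \<in> carrier SL2Z"
  shows "cusp_value k f (A ** transl n) = cusp_value k f A"
proof (rule cusp_value_eqI)
  have "slash k f (A ** transl n) \<tau> = slash k f A (\<tau> + of_int n)" if "\<tau> \<in> \<H>" for \<tau>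
    using that assms by (simp add: slash_mult slash_transl)
  then show "(slash k f (A ** transl n) \<longlongrightarrow> cusp_value k f A) at_ioo"
    by (intro Lim_transform_eventually[OF tendsto_at_ioo_transl[OF modular_formsD(4)[OF assms]]])
      (use eventually_in_H_at_ioo in eventually_elim, simp)
qed

lemma cusp_value_uminus:
  assumes "f \<in> modular_forms k G" "A \<in> carrier SL2Z"
  shows "cusp_value k f (- A) = (- 1) ^ k * cusp_value k f A"
  unfolding cusp_value_def slash_uminus
  by (rule tendsto_Lim) (auto intro!: tendsto_intros modular_formsD(4)[OF assms] simp flip: cusp_value_def)

lemma modular_forms_lincomb:
  assumes "f \<in> modular_forms k G" "g \<in> modular_forms k G"
  shows "(\<lambda>\<tau>. a * f \<tau> + b * g \<tau>) \<in> modular_forms k G"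
    and "A \<in> carrier SL2Z \<Longrightarrow>
      cusp_value k (\<lambda>\<tau>. a * f \<tau> + b * g \<tau>) A = a * cusp_value k f A + b * cusp_value k g A"
proof -
  have lim: "(slash k (\<lambda>\<tau>. a * f \<tau> + b * g \<tau>) A \<longlongrightarrow> a * cusp_value k f A + b * cusp_value k g A) at_ioo"
    if "A \<in> carrier SL2Z" for A
    unfolding slash_add slash_cmult using assms that modular_formsD(4) by (intro tendsto_intros) auto
  then show "A \<in> carrier SL2Z \<Longrightarrow>
      cusp_value k (\<lambda>\<tau>. a * f \<tau> + b * g \<tau>) A = a * cusp_value k f A + b * cusp_value k g A"
    by (intro cusp_value_eqI)
  show "(\<lambda>\<tau>. a * f \<tau> + b * g \<tau>) \<in> modular_forms k G"
    unfolding modular_forms_iff slash_add slash_cmult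
    using lim[unfolded slash_add slash_cmult] modular_formsD[OF assms(1)] modular_formsD[OF assms(2)]
    by (auto intro!: holomorphic_intros)
qed

end

section \<open>Reduction theory and growth of cusp forms\<close>

definition strip :: "real \<Rightarrow> real \<Rightarrow> complex set" where
  "strip a b = {\<tau>. \<bar>Re \<tau>\<bar> \<le> a \<and> Im \<tau> \<ge> b}"

lemma strip_subset_H: "b > 0 \<Longrightarrow> strip a b \<subseteq> \<H>"
  by (auto simp: strip_def in_H_iff)

text \<open>The imaginary part \<open>c * Im \<tau>\<close> of the form controls \<open>c\<close>, and then the real part controls \<open>d\<close>.\<close>

lemma linear_form_lower_bound:
  assumes "b > 0" "a \<ge> 0"
  obtains \<delta> where "\<delta> > 0"
    "\<And>\<tau> c d. \<tau> \<in> strip a b \<Longrightarrow>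
      \<delta> * max \<bar>of_int c\<bar> \<bar>of_int d\<bar> \<le> norm (of_int c * \<tau> + of_int d)"
proof
  define \<delta> where "\<delta> = min b (1 / (1 + a / b))"
  show "\<delta> > 0" using assms by (simp add: \<delta>_def add_pos_nonneg)
  fix \<tau> and c d :: int assume \<tau>: "\<tau> \<in> strip a b"
  let ?z = "of_int c * \<tau> + of_int d"
  have "\<bar>Im ?z\<bar> \<le> norm ?z" by (rule abs_Im_le_cmod)
  then have c1: "\<bar>of_int c\<bar> * Im \<tau> \<le> norm ?z"
    using \<tau> assms by (simp add: abs_mult strip_def)
  have "\<bar>of_int c\<bar> * b \<le> \<bar>of_int c\<bar> * Im \<tau>"
    using \<tau> by (intro mult_left_mono) (auto simp: strip_def)
  with c1 have c2: "\<bar>of_int c\<bar> * b \<le> norm ?z" by linarith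
  have "\<bar>Re ?z\<bar> \<le> norm ?z" by (rule abs_Re_le_cmod)
  moreover have "\<bar>of_int d\<bar> \<le> \<bar>Re ?z\<bar> + \<bar>of_int c\<bar> * \<bar>Re \<tau>\<bar>"
    by (simp add: abs_mult[symmetric])
  moreover have "\<bar>of_int c\<bar> * \<bar>Re \<tau>\<bar> \<le> \<bar>of_int c\<bar> * a"
    using \<tau> by (intro mult_left_mono) (auto simp: strip_def)
  moreover have "\<bar>of_int c\<bar> * a \<le> norm ?z * (a / b)"
    using mult_right_mono[OF c2, of "a / b"] assms by simp
  ultimately have d: "\<bar>of_int d\<bar> \<le> norm ?z * (1 + a / b)"
    by (simp add: distrib_left)
  have pos: "1 + a / b > 0" using assms by (simp add: add_pos_nonneg)
  have "\<delta> * \<bar>of_int c\<bar> \<le> b * \<bar>of_int c\<bar>" by (intro mult_right_mono) (simp_all add: \<delta>_def)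
  moreover have "\<delta> * \<bar>of_int d\<bar> \<le> 1 / (1 + a / b) * \<bar>of_int d\<bar>" by (intro mult_right_mono) (simp_all add: \<delta>_def)
  moreover have "1 / (1 + a / b) * \<bar>of_int d\<bar> \<le> norm ?z" using d pos by (simp add: field_simps)
  ultimately show "\<delta> * max \<bar>of_int c\<bar> \<bar>of_int d\<bar> \<le> norm ?z"
    using c2 by (auto simp: max_def mult.commute)
qed

lemma finite_small_linear_forms:
  assumes "\<tau> \<in> \<H>" shows "finite {(c::int, d::int). norm (of_int c * \<tau> + of_int d) \<le> R}"
proof -
  have \<tau>: "\<tau> \<in> strip \<bar>Re \<tau>\<bar> (Im \<tau>)" "Im \<tau> > 0" using assms by (auto simp: strip_def in_H_iff)
  obtain \<delta> where \<delta>: "\<delta> > 0" and "\<And>\<tau>' c d. \<tau>' \<in> strip \<bar>Re \<tau>\<bar> (Im \<tau>) \<Longrightarrow>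
      \<delta> * max \<bar>of_int c\<bar> \<bar>of_int d\<bar> \<le> norm (of_int c * \<tau>' + of_int d)"
    using linear_form_lower_bound[OF \<tau>(2) abs_ge_zero] by blast
  note * = this(2)[OF \<tau>(1)]
  define m where "m = \<lfloor>R / \<delta>\<rfloor>"
  have "{(c::int, d::int). norm (of_int c * \<tau> + of_int d) \<le> R} \<subseteq> {-m..m} \<times> {-m..m}"
  proof clarify
    fix c d :: int assume "norm (of_int c * \<tau> + of_int d) \<le> R"
    with * have "\<delta> * max \<bar>of_int c\<bar> \<bar>of_int d\<bar> \<le> R" by (rule order_trans)
    then have "max \<bar>real_of_int c\<bar> \<bar>of_int d\<bar> \<le> R / \<delta>" by (simp only: pos_le_divide_eq[OF \<delta>] mult.commute)
    then have "\<bar>c\<bar> \<le> m" "\<bar>d\<bar> \<le> m" unfolding m_def by (simp_all add: le_floor_iff)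
    then show "c \<in> {-m..m} \<and> d \<in> {-m..m}" by auto
  qed
  then show ?thesis by (rule finite_subset) auto
qed

text \<open>Since \<open>Im (A \<tau>) = Im \<tau> / |c \<tau> + d|\<^sup>2\<close>, a lower bound for the imaginary part is an upper bound for a linear
  form in the bottom row.\<close>

lemma finite_Im_orbit:
  assumes "\<tau> \<in> \<H>" "y > 0"
  shows "finite {Im (moebius A \<tau>) | A. A \<in> carrier SL2Z \<and> Im (moebius A \<tau>) \<ge> y}" (is "finite ?S")
proof -
  let ?P = "{(c::int, d::int). norm (of_int c * \<tau> + of_int d) \<le> sqrt (Im \<tau> / y)}"
  have "?S \<subseteq> (\<lambda>(c, d). Im \<tau> / (norm (of_int c * \<tau> + of_int d))\<^sup>2) ` ?P"
  proof clarify
    fix A assume A: "A \<in> carrier SL2Z" "Im (moebius A \<tau>) \<ge> y"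
    let ?j = "aut_factor A \<tau>"
    have "(norm ?j)\<^sup>2 > 0" using aut_factor_nonzero[OF A(1) assms(1)] by simp
    then have "(norm ?j)\<^sup>2 \<le> Im \<tau> / y"
      using A assms by (simp add: Im_moebius field_simps)
    then have "norm ?j \<le> sqrt (Im \<tau> / y)" by (rule real_le_rsqrt)
    then have "(A$2$1, A$2$2) \<in> ?P" by (simp add: aut_factor_def)
    then show "Im (moebius A \<tau>) \<in> (\<lambda>(c, d). Im \<tau> / (norm (of_int c * \<tau> + of_int d))\<^sup>2) ` ?P"
      using A assms by (intro image_eqI) (auto simp: Im_moebius aut_factor_def)
  qed
  then show ?thesis using finite_small_linear_forms[OF assms(1)] finite_subset by blast
qed

lemma exists_max_Im:
  assumes "\<tau> \<in> \<H>" "G \<subseteq> carrier SL2Z" "mat 1 \<in> G"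
  obtains A where "A \<in> G" "\<And>B. B \<in> G \<Longrightarrow> Im (moebius B \<tau>) \<le> Im (moebius A \<tau>)"
proof -
  define S where "S = {Im (moebius A \<tau>) | A. A \<in> G \<and> Im (moebius A \<tau>) \<ge> Im \<tau>}"
  have "finite S" unfolding S_def
    by (rule finite_subset[OF _ finite_Im_orbit[OF assms(1), of "Im \<tau>"]])
      (use assms in \<open>auto simp: in_H_iff\<close>)
  moreover have "Im \<tau> \<in> S" unfolding S_def using assms(3) by (auto intro!: exI[of _ "mat 1"])
  ultimately have m: "Max S \<in> S" "\<And>x. x \<in> S \<Longrightarrow> x \<le> Max S"
    by (auto intro: Max_in)
  then obtain A where A: "A \<in> G" "Im (moebius A \<tau>) = Max S" unfolding S_def by auto
  show ?thesis
  proof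
    fix B assume "B \<in> G"
    then show "Im (moebius B \<tau>) \<le> Im (moebius A \<tau>)"
      using m(2)[of "Im (moebius B \<tau>)"] m(2)[OF \<open>Im \<tau> \<in> S\<close>] A(2)
      by (cases "Im (moebius B \<tau>) \<ge> Im \<tau>") (auto simp: S_def)
  qed (rule A)
qed

definition S_mat :: "int ^ 2 ^ 2" where "S_mat = mat2 0 (-1) 1 0"

lemma S_mat_in [simp]: "S_mat \<in> carrier SL2Z" by (simp add: S_mat_def SL2Z_iff)

lemma moebius_S_mat: "moebius S_mat \<tau> = - 1 / \<tau>"
  by (simp add: S_mat_def moebius_def aut_factor_def)

lemma aut_factor_S_mat: "aut_factor S_mat \<tau> = \<tau>"
  by (simp add: S_mat_def aut_factor_def)

text \<open>A point of maximal imaginary part in its orbit has norm at least one, as otherwise the inversion would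
  raise it. A translation moves it to the strip.\<close>

lemma reduction:
  assumes "\<tau> \<in> \<H>"
  obtains A where "A \<in> carrier SL2Z" "moebius A \<tau> \<in> strip (1/2) (1/2)"
proof -
  obtain A where A: "A \<in> carrier SL2Z"
    and max: "\<And>B. B \<in> carrier SL2Z \<Longrightarrow> Im (moebius B \<tau>) \<le> Im (moebius A \<tau>)"
    using exists_max_Im[OF assms order_refl mat1_in_SL2Z(1)] by blast
  define n where "n = round (Re (moebius A \<tau>))"
  define A' where "A' = transl (- n) ** A"
  define w where "w = moebius A' \<tau>"
  have A': "A' \<in> carrier SL2Z" using A by (simp add: A'_def)
  have w: "w = moebius A \<tau> - of_int n" using A assms by (simp add: w_def A'_def moebius_mult)
  have wH: "w \<in> \<H>" using A' assms by (simp add: w_def)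
  have re: "\<bar>Re w\<bar> \<le> 1/2"
    using of_int_round_abs_le[of "Re (moebius A \<tau>)"] by (simp add: w n_def abs_minus_commute)
  have "Im (moebius (S_mat ** A') \<tau>) \<le> Im w"
    using max[of "S_mat ** A'"] A' by (simp add: w)
  then have "Im w / (norm w)\<^sup>2 \<le> Im w"
    using A' assms wH by (simp add: moebius_mult Im_moebius[of S_mat] aut_factor_S_mat flip: w_def)
  moreover have "(norm w)\<^sup>2 > 0" using wH by (auto simp: in_H_iff)
  ultimately have "(norm w)\<^sup>2 \<ge> 1" using wH by (simp add: in_H_iff divide_le_eq)
  then have "(Re w)\<^sup>2 + (Im w)\<^sup>2 \<ge> 1" by (simp add: cmod_power2)
  moreover have "(Re w)\<^sup>2 \<le> (1/2)\<^sup>2" using power_mono[OF re abs_ge_zero, of 2] by (simp only: power2_abs)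
  moreover have "(1/2 :: real)\<^sup>2 = 1/4" by (simp add: power2_eq_square)
  ultimately have "(1/2)\<^sup>2 \<le> (Im w)\<^sup>2" by linarith
  moreover have "0 \<le> Im w" using wH by (simp add: in_H_iff)
  ultimately have "Im w \<ge> 1/2" by (rule power2_le_imp_le)
  then show ?thesis using that[OF A'] re by (simp add: strip_def w_def)
qed

lemma exists_period_reduction:
  assumes "N \<ge> 1"
  obtains n :: int where "0 \<le> Re \<tau> + real N * of_int n" "Re \<tau> + real N * of_int n \<le> real N"
proof
  define n where "n = \<lfloor>Re \<tau> / real N\<rfloor>"
  have "of_int n \<le> Re \<tau> / real N" "Re \<tau> / real N < of_int n + 1" by (auto simp: n_def)
  then show "0 \<le> Re \<tau> + real N * of_int (- n)" "Re \<tau> + real N * of_int (- n) \<le> real N"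
    using assms by (auto simp: field_simps)
qed

text \<open>Below the height where the limit takes over, the function is bounded on a compact rectangle, one period wide.\<close>

lemma periodic_vanishing_bounded:
  fixes u :: "complex \<Rightarrow> real"
  assumes cont: "continuous_on \<H> u" and N: "N \<ge> 1"
    and per: "\<And>\<tau> n. \<tau> \<in> \<H> \<Longrightarrow> u (\<tau> + of_nat N * of_int n) = u \<tau>"
    and lim: "(u \<longlongrightarrow> 0) at_ioo" and b: "b > 0"
  obtains C where "\<And>\<tau>. Im \<tau> \<ge> b \<Longrightarrow> u \<tau> \<le> C"
proof -
  have "eventually (\<lambda>\<tau>. u \<tau> < 1) at_ioo" using lim by (rule order_tendstoD) simp
  then obtain Y where Y: "\<And>\<tau>. Im \<tau> \<ge> Y \<Longrightarrow> u \<tau> < 1" unfolding eventually_at_ioo by blast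
  define K where "K = cbox (Complex 0 b) (Complex (real N) (max b Y))"
  have "K \<subseteq> \<H>" using b by (auto simp: K_def in_cbox_complex_iff in_H_iff)
  then have "compact (u ` K)"
    by (intro compact_continuous_image continuous_on_subset[OF cont]) (auto simp: K_def)
  then obtain C where C: "\<And>x. x \<in> u ` K \<Longrightarrow> x \<le> C"
    by (meson compact_imp_bounded bounded_real abs_le_D1)
  show ?thesis
  proof
    fix \<tau> assume im: "Im \<tau> \<ge> b"
    show "u \<tau> \<le> max C 1"
    proof (cases "Im \<tau> \<ge> Y")
      case True
      then show ?thesis using Y[of \<tau>] by simp
    next
      case False
      obtain n :: int where n: "0 \<le> Re \<tau> + real N * of_int n" "Re \<tau> + real N * of_int n \<le> real N"
        using exists_period_reduction[OF N] by blast
      have "\<tau> + of_nat N * of_int n \<in> K" using n im False by (simp add: K_def in_cbox_complex_iff)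
      then have "u (\<tau> + of_nat N * of_int n) \<le> C" using C by blast
      moreover have "\<tau> \<in> \<H>" using im b by (simp add: in_H_iff)
      ultimately show ?thesis using per by simp
    qed
  qed
qed

subsection \<open>Dividing a power series by its variable\<close>

text \<open>The value of the \<open>n\<close>-th iterate at zero is the \<open>n\<close>-th Taylor coefficient of \<open>F\<close>.\<close>

definition diff_quot :: "(complex \<Rightarrow> complex) \<Rightarrow> complex \<Rightarrow> complex" where
  "diff_quot F q = (if q = 0 then deriv F 0 else (F q - F 0) / q)"

lemma diff_quot_holomorphic:
  assumes "F holomorphic_on ball 0 r" shows "diff_quot F holomorphic_on ball 0 r"
  using pole_lemma_open[OF assms open_ball, of 0] unfolding diff_quot_def[abs_def] diff_zero .

lemma funpow_diff_quot_holomorphic: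
  "F holomorphic_on ball 0 r \<Longrightarrow> (diff_quot ^^ n) F holomorphic_on ball 0 r"
  by (induction n) (auto intro: diff_quot_holomorphic)

lemma funpow_diff_quot_eq:
  assumes "\<And>j. j < n \<Longrightarrow> (diff_quot ^^ j) F 0 = 0"
  shows "F q = q ^ n * (diff_quot ^^ n) F q"
  using assms
proof (induction n)
  case (Suc n)
  have "(diff_quot ^^ n) F q = q * (diff_quot ^^ Suc n) F q"
    using Suc.prems[of n] by (simp add: diff_quot_def[of "(diff_quot ^^ n) F"])
  with Suc show ?case by simp
qed simp

lemma diff_quot_lincomb:
  assumes "F holomorphic_on ball 0 r" "H holomorphic_on ball 0 r" "r > 0"
  shows "diff_quot (\<lambda>q. a * F q + b * H q) = (\<lambda>q. a * diff_quot F q + b * diff_quot H q)"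
proof -
  have "(F has_field_derivative deriv F 0) (at 0)" "(H has_field_derivative deriv H 0) (at 0)"
    using assms by (auto intro!: holomorphic_derivI[of _ "ball 0 r"])
  then have "deriv (\<lambda>q. a * F q + b * H q) 0 = a * deriv F 0 + b * deriv H 0"
    by (intro DERIV_imp_deriv DERIV_add DERIV_cmult)
  then show ?thesis
    by (auto simp: diff_quot_def fun_eq_iff field_simps)
qed

lemma funpow_diff_quot_lincomb:
  assumes "F holomorphic_on ball 0 r" "H holomorphic_on ball 0 r" "r > 0"
  shows "(diff_quot ^^ n) (\<lambda>q. a * F q + b * H q) =
    (\<lambda>q. a * (diff_quot ^^ n) F q + b * (diff_quot ^^ n) H q)"
  by (induction n) (simp_all add: diff_quot_lincomb[OF funpow_diff_quot_holomorphic
    funpow_diff_quot_holomorphic, OF assms(1,2,3)])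

subsection \<open>Invariant products are bounded\<close>

lemma tendsto_power_times_qexp:
  assumes "h \<ge> 1" shows "((\<lambda>\<tau>. Im \<tau> ^ k * norm (qexp h \<tau>)) \<longlongrightarrow> 0) at_ioo"
proof -
  define c where "c = 2 * pi / real h"
  have c: "c > 0" using assms by (simp add: c_def)
  have "((\<lambda>y. (1 / c ^ k) * ((c * y) ^ k / exp (c * y))) \<longlongrightarrow> (1 / c ^ k) * 0) at_top"
    by (intro tendsto_mult_left filterlim_compose[OF tendsto_power_div_exp_0])
      (use c in \<open>real_asymp\<close>)
  then have "((\<lambda>y. y ^ k * exp (- (2 * pi * y / real h))) \<longlongrightarrow> 0) at_top"
    using c assms by (simp add: power_mult_distrib exp_minus field_simps c_def)
  then show ?thesis unfolding norm_qexp by (rule filterlim_compose) (rule filterlim_filtercomap)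
qed

context congruence_group
begin

text \<open>Near a cusp, a cusp form is \<open>q\<close> times a bounded function, and \<open>|q|\<close> decays faster than any power of the
  imaginary part grows.\<close>

lemma cusp_form_decay:
  assumes f: "f \<in> modular_forms k G" and g: "g \<in> cusp_forms k G" and A: "A \<in> carrier SL2Z"
  shows "((\<lambda>\<tau>. norm (slash k f A \<tau>) * norm (slash k g A \<tau>) * Im \<tau> ^ k) \<longlongrightarrow> 0) at_ioo"
proof -
  have gm: "g \<in> modular_forms k G" and g0: "cusp_value k g A = 0"
    using g A by (auto simp: cusp_forms_iff)
  define F where "F = qext level 0 (slash k g A)"
  have qe: "q_expansion_at_infinity level F (slash k g A)"
    using q_expansion_level[OF gm A] by (simp add: g0 F_def)
  have Q: "diff_quot F holomorphic_on ball 0 1"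
    using qe by (intro diff_quot_holomorphic) (simp add: q_expansion_at_infinity_def)
  have "isCont (diff_quot F) 0"
    using holomorphic_on_imp_continuous_on[OF Q] by (simp add: continuous_on_eq_continuous_at)
  then have "((\<lambda>\<tau>. diff_quot F (qexp level \<tau>)) \<longlongrightarrow> diff_quot F 0) at_ioo"
    unfolding isCont_def by (rule filterlim_compose) (rule tendsto_qexp[OF level(1)])
  moreover have "((\<lambda>\<tau>. slash k f A \<tau>) \<longlongrightarrow> cusp_value k f A) at_ioo"
    using modular_formsD(4)[OF f A] .
  ultimately have "((\<lambda>\<tau>. norm (slash k f A \<tau>) * norm (diff_quot F (qexp level \<tau>)) *
      (Im \<tau> ^ k * norm (qexp level \<tau>))) \<longlongrightarrow> norm (cusp_value k f A) * norm (diff_quot F 0) * 0) at_ioo"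
    by (intro tendsto_intros tendsto_power_times_qexp level)
  moreover have "slash k g A \<tau> = qexp level \<tau> * diff_quot F (qexp level \<tau>)" if "\<tau> \<in> \<H>" for \<tau>
  proof -
    have "slash k g A \<tau> = F (qexp level \<tau>)" using qe that by (simp add: q_expansion_at_infinity_def qexp_def)
    also have "\<dots> = qexp level \<tau> * diff_quot F (qexp level \<tau>)" by (simp add: diff_quot_def F_def qext_def)
    finally show ?thesis .
  qed
  then have "eventually (\<lambda>\<tau>. norm (slash k f A \<tau>) * norm (diff_quot F (qexp level \<tau>)) *
      (Im \<tau> ^ k * norm (qexp level \<tau>)) = norm (slash k f A \<tau>) * norm (slash k g A \<tau>) * Im \<tau> ^ k) at_ioo"
    by (intro eventually_mono[OF eventually_in_H_at_ioo]) (simp add: norm_mult)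
  ultimately show ?thesis using Lim_transform_eventually by fastforce
qed

lemma moebius_slash_norm:
  assumes "A \<in> carrier SL2Z" "\<tau> \<in> \<H>"
  shows "norm (f (moebius A \<tau>)) * norm (g (moebius A \<tau>)) * Im (moebius A \<tau>) ^ k =
    norm (slash k f A \<tau>) * norm (slash k g A \<tau>) * Im \<tau> ^ k"
proof -
  have "norm (aut_factor A \<tau>) > 0" using aut_factor_nonzero[OF assms] by simp
  then show ?thesis
    unfolding Im_moebius[OF assms]
    by (simp add: slash_def norm_divide norm_power power_divide power_mult[symmetric] mult_2 power_add)
qed

lemma reduction_coset:
  assumes "\<tau> \<in> \<H>"
  obtains c w C where "c \<in> cosets" "w \<in> strip (1/2) (1/2)" "C \<in> G" "\<tau> = moebius (C ** coset_rep c) w"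
proof -
  obtain A where A: "A \<in> carrier SL2Z" "moebius A \<tau> \<in> strip (1/2) (1/2)"
    using reduction[OF assms] .
  obtain C where C: "C \<in> G" "coset_rep (coset (SL2Z_inv A)) = C ** SL2Z_inv A"
    using coset_rep_of_coset[of "SL2Z_inv A"] A by auto
  have "moebius (SL2Z_inv C ** coset_rep (coset (SL2Z_inv A))) (moebius A \<tau>) = \<tau>"
    using C A assms by (simp add: SL2Z_inv_cancel_left moebius_inverse)
  moreover have "coset (SL2Z_inv A) \<in> cosets" using A by (simp add: cosets_def)
  ultimately show ?thesis using that A C by (metis inv_in)
qed

text \<open>The function is invariant under the group. Reduction to the strip expresses its values by
  finitely many periodic functions above a fixed height, all of which vanish at infinity.\<close>

lemma cusp_product_bounded:
  assumes f: "f \<in> modular_forms k G" and g: "g \<in> cusp_forms k G"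
  obtains C where "\<And>\<tau>. \<tau> \<in> \<H> \<Longrightarrow> norm (f \<tau>) * norm (g \<tau>) * Im \<tau> ^ k \<le> C"
proof -
  have gm: "g \<in> modular_forms k G" using g by (rule cusp_forms_modular)
  define u where "u c \<tau> = norm (slash k f (coset_rep c) \<tau>) * norm (slash k g (coset_rep c) \<tau>) * Im \<tau> ^ k" for c \<tau>
  have "\<exists>C. \<forall>\<tau>. Im \<tau> \<ge> 1/2 \<longrightarrow> u c \<tau> \<le> C" if c: "c \<in> cosets" for c
  proof -
    note r = coset_rep[OF c]
    have "continuous_on \<H> (slash k f (coset_rep c))" "continuous_on \<H> (slash k g (coset_rep c))"
      using r modular_formsD(1)[OF f] modular_formsD(1)[OF gm]
      by (auto intro!: holomorphic_on_imp_continuous_on slash_holomorphic)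
    then have cont: "continuous_on \<H> (u c)" unfolding u_def by (intro continuous_intros)
    have per: "u c (\<tau> + of_nat level * of_int n) = u c \<tau>" if "\<tau> \<in> \<H>" for \<tau> n
      using slash_periodic[OF f r(1) that, of "int level * n"] slash_periodic[OF gm r(1) that, of "int level * n"]
      by (simp add: u_def)
    have lim: "(u c \<longlongrightarrow> 0) at_ioo"
      using cusp_form_decay[OF f g r(1)] by (simp add: u_def[abs_def])
    obtain C where "\<And>\<tau>. Im \<tau> \<ge> 1/2 \<Longrightarrow> u c \<tau> \<le> C"
      by (rule periodic_vanishing_bounded[where b = "1/2", OF cont level(1) per lim]) auto
    then show ?thesis by blast
  qed
  then obtain C where C: "\<And>c \<tau>. c \<in> cosets \<Longrightarrow> Im \<tau> \<ge> 1/2 \<Longrightarrow> u c \<tau> \<le> C c" by metis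
  show ?thesis
  proof
    fix \<tau> assume "\<tau> \<in> \<H>"
    then obtain c w D where c: "c \<in> cosets" and w: "w \<in> strip (1/2) (1/2)" and D: "D \<in> G"
      and \<tau>: "\<tau> = moebius (D ** coset_rep c) w" by (rule reduction_coset)
    note r = coset_rep[OF c]
    have wH: "w \<in> \<H>" using w strip_subset_H[of "1/2"] by auto
    have sl: "slash k h (D ** coset_rep c) w = slash k h (coset_rep c) w" if "h \<in> modular_forms k G" for h
      using slash_cong[where A = "coset_rep c" and \<tau> = w, OF modular_formsD(3)[OF that D] r(1) wH]
        slash_mult[OF in_carrier[OF D] r(1) wH] by simp
    have "norm (f \<tau>) * norm (g \<tau>) * Im \<tau> ^ k = u c w"
      unfolding \<tau> using D r wH by (subst moebius_slash_norm) (auto simp: u_def sl f gm)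
    also have "\<dots> \<le> C c" using C[OF c] w by (simp add: strip_def)
    also have "\<dots> \<le> Max (C ` cosets)" using c finite_cosets by simp
    finally show "norm (f \<tau>) * norm (g \<tau>) * Im \<tau> ^ k \<le> Max (C ` cosets)" .
  qed
qed

section \<open>The space of cusp forms is finite-dimensional\<close>

definition cusp_series :: "nat \<Rightarrow> (complex \<Rightarrow> complex) \<Rightarrow> (int ^ 2 ^ 2) set \<Rightarrow> complex \<Rightarrow> complex" where
  "cusp_series k f c = qext level (cusp_value k f (coset_rep c)) (slash k f (coset_rep c))"

lemma cusp_series:
  assumes "f \<in> modular_forms k G" "c \<in> cosets"
  shows "cusp_series k f c holomorphic_on ball 0 1"
    "\<And>\<tau>. \<tau> \<in> \<H> \<Longrightarrow> slash k f (coset_rep c) \<tau> = cusp_series k f c (qexp level \<tau>)"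
  using q_expansion_level[OF assms(1) coset_rep(1)[OF assms(2)]]
  by (auto simp: q_expansion_at_infinity_def cusp_series_def qexp_def)

lemma cusp_series_lincomb:
  assumes "f \<in> modular_forms k G" "g \<in> modular_forms k G" "c \<in> cosets"
  shows "cusp_series k (\<lambda>\<tau>. a * f \<tau> + b * g \<tau>) c = (\<lambda>q. a * cusp_series k f c q + b * cusp_series k g c q)"
  using modular_forms_lincomb(2)[OF assms(1,2) coset_rep(1)[OF assms(3)]]
  by (auto simp: cusp_series_def qext_def fun_eq_iff slash_add slash_cmult)

text \<open>If the expansion \<open>F\<close> vanishes to order \<open>n\<close>, then \<open>F q / q^n\<close> is holomorphic. On the circle that belongs to
  half the height of \<open>w\<close> it is bounded through \<open>M\<close>, so by the maximum modulus principle also at \<open>w\<close>;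
  the quotient of the two values of \<open>q^n\<close> is the gain, and \<open>2^k\<close> is the quotient of the two
  heights.\<close>

lemma slash_norm_contraction:
  assumes f: "f \<in> modular_forms k G" and c: "c \<in> cosets" and w: "Im w \<ge> 1/2"
    and M: "\<And>\<tau>. \<tau> \<in> \<H> \<Longrightarrow> (norm (slash k f (coset_rep c) \<tau>))\<^sup>2 * Im \<tau> ^ k \<le> M" "M \<ge> 0"
    and van: "\<And>j. j < n \<Longrightarrow> (diff_quot ^^ j) (cusp_series k f c) 0 = 0"
  shows "(norm (slash k f (coset_rep c) w))\<^sup>2 * Im w ^ k \<le> M * (2 ^ k * exp (- (pi * n / level)))"
proof -
  let ?f = "slash k f (coset_rep c)" and ?F = "cusp_series k f c"
  define H where "H = (diff_quot ^^ n) ?F"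
  have FH: "?F q = q ^ n * H q" for q unfolding H_def by (rule funpow_diff_quot_eq[OF van])
  have H: "H holomorphic_on ball 0 1"
    unfolding H_def by (intro funpow_diff_quot_holomorphic cusp_series f c)
  define y where "y = Im w"
  have y: "y \<ge> 1/2" using w by (simp add: y_def)
  \<comment> \<open>The norm of \<open>q\<close> at height \<open>y / 2\<close>; at \<open>w\<close> it is \<open>\<rho>\<^sup>2\<close>.\<close>
  define \<rho> where "\<rho> = exp (- (pi * y / level))"
  have \<rho>: "\<rho> > 0" "\<rho> < 1" using y level by (auto simp: \<rho>_def)
  have on_circle: "norm (H q) \<le> sqrt (M / (y / 2) ^ k) / \<rho> ^ n" if "norm q = \<rho>" for q
  proof -
    define \<tau> where "\<tau> = of_nat level * Ln q / (2 * of_real pi * \<i>)"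
    have q0: "q \<noteq> 0" using that \<rho> by auto
    have "Im \<tau> = - (real level * ln (norm q)) / (2 * pi)"
      using q0 by (simp add: \<tau>_def Im_divide power2_eq_square field_simps)
    then have im: "Im \<tau> = y / 2" using that level by (simp add: \<rho>_def)
    have "qexp level \<tau> = q" using q0 level by (simp add: qexp_def \<tau>_def)
    moreover have "\<tau> \<in> \<H>" using im y by (simp add: in_H_iff)
    ultimately have e: "?f \<tau> = q ^ n * H q" using cusp_series(2)[OF f c] FH by metis
    have "(norm (?f \<tau>))\<^sup>2 * (y / 2) ^ k \<le> M" using M(1)[OF \<open>\<tau> \<in> \<H>\<close>] im by simp
    then have "(norm (?f \<tau>))\<^sup>2 \<le> M / (y / 2) ^ k" using y by (simp add: pos_le_divide_eq del: power_divide)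
    then have "norm (?f \<tau>) \<le> sqrt (M / (y / 2) ^ k)" by (rule real_le_rsqrt)
    then show ?thesis using \<rho> that by (simp add: e norm_mult norm_power pos_le_divide_eq mult.commute)
  qed
  have inside: "norm (H q) \<le> sqrt (M / (y / 2) ^ k) / \<rho> ^ n" if "norm q \<le> \<rho>" for q
  proof (rule maximum_modulus_frontier[of H "cball 0 \<rho>"])
    show "H holomorphic_on interior (cball 0 \<rho>)"
      using \<rho> by (intro holomorphic_on_subset[OF H]) auto
    show "continuous_on (closure (cball 0 \<rho>)) H"
      using \<rho> by (intro continuous_on_subset[OF holomorphic_on_imp_continuous_on[OF H]]) auto
    show "norm (H z) \<le> sqrt (M / (y / 2) ^ k) / \<rho> ^ n" if "z \<in> frontier (cball 0 \<rho>)" for z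
      using that \<rho> by (intro on_circle) simp
  qed (use that in auto)
  have q: "norm (qexp level w) = \<rho>\<^sup>2"
    by (simp add: norm_qexp \<rho>_def y_def flip: exp_double)
  then have "norm (qexp level w) \<le> \<rho>" using \<rho> by (simp add: power2_eq_square)
  note b = inside[OF this]
  have wH: "w \<in> \<H>" using w by (simp add: in_H_iff)
  have "norm (?f w) = (\<rho>\<^sup>2) ^ n * norm (H (qexp level w))"
    using cusp_series(2)[OF f c wH] FH by (simp add: norm_mult norm_power q)
  also have "\<dots> \<le> (\<rho>\<^sup>2) ^ n * (sqrt (M / (y / 2) ^ k) / \<rho> ^ n)"
    using b by (intro mult_left_mono) auto
  also have "\<dots> = \<rho> ^ n * sqrt (M / (y / 2) ^ k)"
    using \<rho> by (simp add: power2_eq_square power_mult_distrib)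
  finally have "(norm (?f w))\<^sup>2 \<le> (\<rho> ^ n * sqrt (M / (y / 2) ^ k))\<^sup>2"
    by (intro power_mono) auto
  also have "\<dots> = (\<rho> ^ n)\<^sup>2 * (M / (y / 2) ^ k)"
    using M(2) y by (simp add: power_mult_distrib)
  finally have "(norm (?f w))\<^sup>2 * y ^ k \<le> (\<rho> ^ n)\<^sup>2 * (M / (y / 2) ^ k) * y ^ k"
    using y by (intro mult_right_mono) auto
  also have "\<dots> = M * (2 ^ k * (\<rho> ^ n)\<^sup>2)"
    using y by (simp add: power_divide field_simps)
  also have "(\<rho> ^ n)\<^sup>2 = exp (- (pi * n * (2 * y) / level))"
    by (simp add: \<rho>_def exp_of_nat_mult[symmetric] exp_double[symmetric] field_simps)
  also have "M * (2 ^ k * exp (- (pi * n * (2 * y) / level))) \<le> M * (2 ^ k * exp (- (pi * n / level)))"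
  proof -
    have "pi * n * 1 / level \<le> pi * n * (2 * y) / level"
      using y by (intro divide_right_mono mult_left_mono) auto
    then show ?thesis using M(2) by (intro mult_left_mono) auto
  qed
  finally show ?thesis by (simp add: y_def)
qed

text \<open>Reduction moves every point of the half-plane to the height at which the previous estimate applies, so the
  supremum of \<open>|f|\<^sup>2 Im\<^sup>k\<close> is at most half of itself.\<close>

lemma cusp_form_eq_0:
  assumes f: "f \<in> cusp_forms k G" and n: "2 ^ k * exp (- (pi * real n / real level)) \<le> 1 / 2"
    and van: "\<And>c j. c \<in> cosets \<Longrightarrow> j < n \<Longrightarrow> (diff_quot ^^ j) (cusp_series k f c) 0 = 0"
  shows "f = (\<lambda>_. 0)"
proof -
  have fm: "f \<in> modular_forms k G" using f by (rule cusp_forms_modular)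
  define \<phi> where "\<phi> \<tau> = (norm (f \<tau>))\<^sup>2 * Im \<tau> ^ k" for \<tau>
  obtain C where C: "\<And>\<tau>. \<tau> \<in> \<H> \<Longrightarrow> \<phi> \<tau> \<le> C"
    using cusp_product_bounded[OF fm f] by (metis \<phi>_def power2_eq_square)
  define M where "M = (SUP \<tau>\<in>\<H>. \<phi> \<tau>)"
  have bdd: "bdd_above (\<phi> ` \<H>)" using C by (auto intro!: bdd_aboveI2)
  have ne: "\<i> \<in> \<H>" by (simp add: in_H_iff)
  have leM: "\<phi> \<tau> \<le> M" if "\<tau> \<in> \<H>" for \<tau>
    unfolding M_def using bdd that by (rule cSUP_upper2[OF _ _ order_refl])
  have pos: "\<phi> \<tau> \<ge> 0" if "\<tau> \<in> \<H>" for \<tau> using that by (simp add: \<phi>_def in_H_iff)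
  have M0: "M \<ge> 0" using leM[OF ne] pos[OF ne] by linarith
  have slash_phi: "\<phi> (moebius A \<tau>) = (norm (slash k f A \<tau>))\<^sup>2 * Im \<tau> ^ k"
    if "A \<in> carrier SL2Z" "\<tau> \<in> \<H>" for A \<tau>
    using moebius_slash_norm[OF that, of f f k] by (simp add: \<phi>_def power2_eq_square)
  have half: "\<phi> \<tau> \<le> M / 2" if \<tau>H: "\<tau> \<in> \<H>" for \<tau>
  proof -
    obtain c w D where c: "c \<in> cosets" and w: "w \<in> strip (1/2) (1/2)" and D: "D \<in> G"
      and \<tau>: "\<tau> = moebius (D ** coset_rep c) w" using reduction_coset[OF \<tau>H] by blast
    note r = coset_rep[OF c]
    have wH: "w \<in> \<H>" using w strip_subset_H[of "1/2"] by auto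
    have "slash k f (D ** coset_rep c) w = slash k f (coset_rep c) w"
      using slash_cong[where A = "coset_rep c" and \<tau> = w, OF modular_formsD(3)[OF fm D] r(1) wH]
        slash_mult[OF in_carrier[OF D] r(1) wH] by simp
    then have "\<phi> \<tau> = (norm (slash k f (coset_rep c) w))\<^sup>2 * Im w ^ k"
      unfolding \<tau> using D r wH by (subst slash_phi) auto
    also have "\<dots> \<le> M * (2 ^ k * exp (- (pi * n / level)))"
    proof (rule slash_norm_contraction[OF fm c _ _ M0 van[OF c]])
      show "(norm (slash k f (coset_rep c) \<tau>))\<^sup>2 * Im \<tau> ^ k \<le> M" if "\<tau> \<in> \<H>" for \<tau>
        using leM[of "moebius (coset_rep c) \<tau>"] slash_phi[OF r(1) that] r that by simp
    qed (use w in \<open>auto simp: strip_def\<close>)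
    also have "\<dots> \<le> M * (1 / 2)" by (rule mult_left_mono[OF n M0])
    finally show ?thesis by simp
  qed
  have "M \<le> M / 2" unfolding M_def[symmetric]
    by (subst M_def) (rule cSUP_least, use ne half in auto)
  then have "M = 0" using M0 by simp
  show ?thesis
  proof
    fix \<tau>
    show "f \<tau> = 0"
    proof (cases "\<tau> \<in> \<H>")
      case True
      then have "\<phi> \<tau> = 0" using leM[OF True] pos[OF True] \<open>M = 0\<close> by simp
      then show ?thesis using True by (simp add: \<phi>_def in_H_iff)
    qed (use modular_formsD(2)[OF fm] in auto)
  qed
qed

end

lemma cfun_subspace_iff:
  "cfun.subspace V \<longleftrightarrow> (\<lambda>_. 0) \<in> V \<and> (\<forall>f\<in>V. \<forall>g\<in>V. \<forall>a b. (\<lambda>\<tau>. a * f \<tau> + b * g \<tau>) \<in> V)"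
proof
  assume V: "cfun.subspace V"
  have "(\<lambda>\<tau>. a * f \<tau> + b * g \<tau>) = fun_scale a f + fun_scale b g" for a b f g
    by (simp add: fun_scale_def fun_eq_iff)
  then show "(\<lambda>_. 0) \<in> V \<and> (\<forall>f\<in>V. \<forall>g\<in>V. \<forall>a b. (\<lambda>\<tau>. a * f \<tau> + b * g \<tau>) \<in> V)"
    using cfun.subspace_0[OF V] V
    by (auto simp: zero_fun_def intro!: cfun.subspace_add cfun.subspace_scale)
next
  assume R: "(\<lambda>_. 0) \<in> V \<and> (\<forall>f\<in>V. \<forall>g\<in>V. \<forall>a b. (\<lambda>\<tau>. a * f \<tau> + b * g \<tau>) \<in> V)"
  have "(\<lambda>\<tau>. 1 * f \<tau> + 1 * g \<tau>) = f + g" "(\<lambda>\<tau>. a * f \<tau> + 0 * f \<tau>) = fun_scale a f" for a f g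
    by (simp_all add: fun_scale_def fun_eq_iff)
  with R show "cfun.subspace V"
    unfolding cfun.subspace_def zero_fun_def by metis
qed

text \<open>A space on which finitely many linear forms have no common zero is finitely generated:
  adding the forms one at a time enlarges a generating set by at most one element.\<close>

lemma finitely_generated_of_linear_forms:
  fixes l :: "'i \<Rightarrow> (complex \<Rightarrow> complex) \<Rightarrow> complex"
  assumes "finite I" "cfun.subspace V"
    and "\<And>i f g a b. i \<in> I \<Longrightarrow> f \<in> V \<Longrightarrow> g \<in> V \<Longrightarrow> l i (\<lambda>\<tau>. a * f \<tau> + b * g \<tau>) = a * l i f + b * l i g"
    and "\<And>f. f \<in> V \<Longrightarrow> (\<And>i. i \<in> I \<Longrightarrow> l i f = 0) \<Longrightarrow> f = (\<lambda>_. 0)"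
  shows "\<exists>B. finite B \<and> B \<subseteq> V \<and> cfun.span B = V"
  using assms
proof (induction I arbitrary: V)
  case empty
  then have "V = {0}" by (auto simp: cfun_subspace_iff zero_fun_def)
  then show ?case by (intro exI[of _ "{}"]) auto
next
  case (insert i I)
  define W where "W = {f \<in> V. l i f = 0}"
  note lin = insert.prems(2) and V = insert.prems(1)
  have linW: "l j (\<lambda>\<tau>. a * f \<tau> + b * g \<tau>) = a * l j f + b * l j g"
    if "j \<in> insert i I" "f \<in> V" "g \<in> V" for j f g a b
    using lin[OF that] .
  have "l i (\<lambda>\<tau>. 0 * (\<lambda>_. 0) \<tau> + 0 * (\<lambda>_. 0) \<tau>) = 0 * l i (\<lambda>_. 0) + 0 * l i (\<lambda>_. 0)"
    using V by (intro linW) (simp_all add: cfun_subspace_iff)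
  then have l0: "l i (\<lambda>_. 0) = 0" by simp
  have W: "cfun.subspace W"
    unfolding cfun_subspace_iff
  proof (intro conjI ballI allI)
    show "(\<lambda>_. 0) \<in> W" using V l0 by (simp add: W_def cfun_subspace_iff)
  next
    fix f g a b assume fg: "f \<in> W" "g \<in> W"
    then have "l i (\<lambda>\<tau>. a * f \<tau> + b * g \<tau>) = 0"
      by (subst linW) (simp_all add: W_def)
    moreover have "(\<lambda>\<tau>. a * f \<tau> + b * g \<tau>) \<in> V"
      using V fg unfolding cfun_subspace_iff W_def by blast
    ultimately show "(\<lambda>\<tau>. a * f \<tau> + b * g \<tau>) \<in> W" by (simp add: W_def)
  qed
  have "\<exists>B. finite B \<and> B \<subseteq> W \<and> cfun.span B = W"
  proof (rule insert.IH[OF W])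
    fix f assume "f \<in> W" "\<And>j. j \<in> I \<Longrightarrow> l j f = 0"
    then show "f = (\<lambda>_. 0)" using insert.prems(3)[of f] by (auto simp: W_def)
  next
    fix j f g a b assume "j \<in> I" "f \<in> W" "g \<in> W"
    then show "l j (\<lambda>\<tau>. a * f \<tau> + b * g \<tau>) = a * l j f + b * l j g"
      by (intro linW) (auto simp: W_def)
  qed
  then obtain B where B: "finite B" "B \<subseteq> W" "cfun.span B = W" by blast
  show ?case
  proof (cases "\<exists>v\<in>V. l i v \<noteq> 0")
    case False
    then have "W = V" by (auto simp: W_def)
    then show ?thesis using B by blast
  next
    case True
    then obtain v where v: "v \<in> V" "l i v \<noteq> 0" by blast
    have "cfun.span (insert v B) = V"
    proof
      show "cfun.span (insert v B) \<subseteq> V"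
        using B v V by (intro cfun.span_minimal) (auto simp: W_def)
      show "V \<subseteq> cfun.span (insert v B)"
      proof
        fix f assume f: "f \<in> V"
        define t where "t = l i f / l i v"
        define w where "w = (\<lambda>\<tau>. 1 * f \<tau> + (- t) * v \<tau>)"
        have "w \<in> V" using f v V unfolding cfun_subspace_iff w_def by blast
        moreover have "l i w = 0" unfolding w_def using v by (subst linW[OF _ f v(1)]) (auto simp: t_def)
        ultimately have "w \<in> cfun.span B" using B by (simp add: W_def)
        then have "w \<in> cfun.span (insert v B)" using cfun.span_mono[of B "insert v B"] by blast
        moreover have "fun_scale t v \<in> cfun.span (insert v B)"
          by (intro cfun.span_scale cfun.span_base) simp
        ultimately have "w + fun_scale t v \<in> cfun.span (insert v B)" by (rule cfun.span_add)
        moreover have "w + fun_scale t v = f" by (simp add: w_def fun_scale_def fun_eq_iff)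
        ultimately show "f \<in> cfun.span (insert v B)" by simp
      qed
    qed
    then show ?thesis using B v by (intro exI[of _ "insert v B"]) (auto simp: W_def)
  qed
qed

context congruence_group
begin

lemma slash_zero [simp]: "slash k (\<lambda>_. 0) A = (\<lambda>_. 0)"
  by (simp add: slash_def fun_eq_iff)

lemma zero_modular [simp]: "(\<lambda>_. 0) \<in> modular_forms k G"
  unfolding modular_forms_iff by (auto intro!: exI[of _ 0])

lemma cusp_value_zero [simp]: "cusp_value k (\<lambda>_. 0) A = 0"
  by (rule cusp_value_eqI) simp

lemma subspace_cusp_forms: "cfun.subspace (cusp_forms k G)"
  unfolding cfun_subspace_iff
proof (intro conjI ballI allI)
  fix f g a b assume "f \<in> cusp_forms k G" "g \<in> cusp_forms k G"
  then show "(\<lambda>\<tau>. a * f \<tau> + b * g \<tau>) \<in> cusp_forms k G"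
    unfolding cusp_forms_iff by (simp add: modular_forms_lincomb)
qed (simp add: cusp_forms_iff)

lemma finitely_generated_cusp_forms:
  "\<exists>B. finite B \<and> B \<subseteq> cusp_forms k G \<and> cfun.span B = cusp_forms k G"
proof -
  have "((\<lambda>n. 2 ^ k * exp (- (pi * real n / real level))) \<longlongrightarrow> 2 ^ k * 0) sequentially"
  proof (rule tendsto_mult_left)
    show "((\<lambda>n. exp (- (pi * real n / real level))) \<longlongrightarrow> 0) sequentially"
      using level(1) by real_asymp
  qed
  then have "eventually (\<lambda>n. 2 ^ k * exp (- (pi * real n / real level)) < 1 / 2) sequentially"
    by (rule order_tendstoD) simp
  then obtain n where n: "2 ^ k * exp (- (pi * real n / real level)) < 1 / 2"
    by (meson eventually_sequentially order_refl)
  define l where "l = (\<lambda>(c, j) f. (diff_quot ^^ j) (cusp_series k f c) 0)"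
  show ?thesis
  proof (rule finitely_generated_of_linear_forms[of "cosets \<times> {..<n}" _ l])
    show "finite (cosets \<times> {..<n})" using finite_cosets by simp
    show "l i (\<lambda>\<tau>. a * f \<tau> + b * g \<tau>) = a * l i f + b * l i g"
      if "i \<in> cosets \<times> {..<n}" "f \<in> cusp_forms k G" "g \<in> cusp_forms k G" for i f g a b
      using that cusp_forms_modular
      by (auto simp: l_def cusp_series_lincomb funpow_diff_quot_lincomb[OF cusp_series(1) cusp_series(1) zero_less_one])
    show "f = (\<lambda>_. 0)" if "f \<in> cusp_forms k G" "\<And>i. i \<in> cosets \<times> {..<n} \<Longrightarrow> l i f = 0" for f
      using that n by (intro cusp_form_eq_0[of f k n]) (auto simp: l_def)
  qed (rule subspace_cusp_forms)
qed

end

section \<open>The hyperbolic area\<close>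

text \<open>The identification of the complex plane with \<^typ>\<open>real ^ 2\<close>, where linear maps have determinants.\<close>

definition complex_of_vec :: "real ^ 2 \<Rightarrow> complex" where
  "complex_of_vec x = Complex (x$1) (x$2)"

definition vec_of_complex :: "complex \<Rightarrow> real ^ 2" where
  "vec_of_complex z = vector [Re z, Im z]"

lemma vec_of_complex_nth [simp]: "vec_of_complex z $ 1 = Re z" "vec_of_complex z $ 2 = Im z"
  by (simp_all add: vec_of_complex_def vector_2)

lemma complex_of_vec_sel [simp]: "Re (complex_of_vec x) = x$1" "Im (complex_of_vec x) = x$2"
  by (simp_all add: complex_of_vec_def)

lemma complex_of_vec_inverse [simp]:
  "complex_of_vec (vec_of_complex z) = z" "vec_of_complex (complex_of_vec x) = x"
  by (simp_all add: complex_eq_iff vec_eq_iff forall_2)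

lemma bounded_linear_complex_of_vec: "bounded_linear complex_of_vec"
  unfolding linear_conv_bounded_linear[symmetric]
  by (intro linearI) (simp_all add: complex_eq_iff)

lemma bounded_linear_vec_of_complex: "bounded_linear vec_of_complex"
  unfolding linear_conv_bounded_linear[symmetric]
  by (intro linearI) (simp_all add: vec_eq_iff forall_2)

lemma measurable_complex_of_vec [measurable]: "complex_of_vec \<in> borel_measurable borel"
  by (intro borel_measurable_continuous_onI linear_continuous_on bounded_linear_complex_of_vec)

lemma distr_complex_of_vec: "distr lborel borel complex_of_vec = lborel"
proof (rule lborel_eqI[symmetric])
  fix l u :: complex assume le: "\<And>b. b \<in> Basis \<Longrightarrow> l \<bullet> b \<le> u \<bullet> b"
  have re: "Re l \<le> Re u" "Im l \<le> Im u" using le[of 1] le[of \<i>] by (auto simp: Basis_complex_def)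
  have B: "(Basis :: (real^2) set) = {axis 1 1, axis 2 1}"
    by (auto simp: Basis_vec_def UNIV_2)
  have ne: "axis 1 1 \<noteq> (axis 2 1 :: real^2)" by (simp add: axis_eq_axis)
  have "complex_of_vec -` box l u = box (vec_of_complex l) (vec_of_complex u)"
    by (auto simp: mem_box_cart forall_2 in_box_complex_iff)
  then have "emeasure (distr lborel borel complex_of_vec) (box l u) =
      emeasure lborel (box (vec_of_complex l) (vec_of_complex u))"
    by (simp add: emeasure_distr)
  also have "\<dots> = (\<Prod>b\<in>Basis. (vec_of_complex u - vec_of_complex l) \<bullet> b)"
    using re by (intro emeasure_lborel_box) (auto simp: B inner_axis)
  also have "\<dots> = (\<Prod>b\<in>Basis. (u - l) \<bullet> b)"
    using ne by (simp add: B inner_axis Basis_complex_def)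
  finally show "emeasure (distr lborel borel complex_of_vec) (box l u) = (\<Prod>b\<in>Basis. (u - l) \<bullet> b)" .
qed simp

lemma det_complex_mult:
  "det (matrix (\<lambda>h. vec_of_complex (w * complex_of_vec h))) = (norm w)\<^sup>2"
  unfolding cmod_power2 by (simp add: det_2 matrix_def axis_def power2_eq_square)

lemma measurable_moebius [measurable]: "moebius A \<in> borel_measurable borel"
  unfolding moebius_def[abs_def] aut_factor_def by measurable

lemma measurable_aut_factor [measurable]: "aut_factor A \<in> borel_measurable borel"
  unfolding aut_factor_def[abs_def] by measurable

lemma sets_H [measurable]: "\<H> \<in> sets borel"
  by (rule borel_open) simp

lemma moebius_image_eq_vimage:
  assumes "A \<in> carrier SL2Z" "X \<subseteq> \<H>"
  shows "moebius A ` X = \<H> \<inter> moebius (SL2Z_inv A) -` X"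
proof (intro equalityI subsetI)
  fix z assume "z \<in> moebius A ` X"
  then show "z \<in> \<H> \<inter> moebius (SL2Z_inv A) -` X" using assms by (auto simp: moebius_inverse subset_iff)
next
  fix z assume "z \<in> \<H> \<inter> moebius (SL2Z_inv A) -` X"
  then show "z \<in> moebius A ` X"
    using moebius_inverse(2)[OF assms(1), of z] by (intro image_eqI[of _ _ "moebius (SL2Z_inv A) z"]) auto
qed

lemma sets_moebius_image:
  assumes "A \<in> carrier SL2Z" "X \<subseteq> \<H>" "X \<in> sets borel"
  shows "moebius A ` X \<in> sets borel"
proof -
  have "moebius (SL2Z_inv A) -` X \<inter> space borel \<in> sets borel"
    by (rule measurable_sets[OF measurable_moebius assms(3)])
  then show ?thesis unfolding moebius_image_eq_vimage[OF assms(1,2)] using sets_H by auto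
qed

lemma inj_on_moebius: "A \<in> carrier SL2Z \<Longrightarrow> inj_on (moebius A) \<H>"
  by (rule inj_on_inverseI[of _ "moebius (SL2Z_inv A)"]) (rule moebius_inverse)

text \<open>The change of variables formula for a Moebius transformation, whose real Jacobian is
  \<open>norm (aut_factor A z) powi (-4)\<close>.\<close>

lemma emeasure_moebius_image_le:
  assumes A: "A \<in> carrier SL2Z" and X: "X \<in> sets borel" "X \<subseteq> \<H>"
  shows "emeasure lborel (moebius A ` X) \<le>
    (\<integral>\<^sup>+z. ennreal (1 / norm (aut_factor A z) ^ 4) * indicator X z \<partial>lborel)" (is "_ \<le> ?I")
proof (cases "?I = \<infinity>")
  case False
  define S where "S = complex_of_vec -` X"
  define r where "r x = 1 / norm (aut_factor A (complex_of_vec x)) ^ 4" for x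
  define g where "g x = vec_of_complex (moebius A (complex_of_vec x))" for x
  define g' where "g' x h = vec_of_complex (1 / (aut_factor A (complex_of_vec x))\<^sup>2 * complex_of_vec h)" for x h
  have S [measurable]: "S \<in> sets borel"
    using measurable_sets[OF measurable_complex_of_vec X(1)] by (simp add: S_def)
  have [measurable]: "r \<in> borel_measurable borel" unfolding r_def by measurable
  have det: "\<bar>det (matrix (g' x))\<bar> = r x" for x
    unfolding g'_def[abs_def] det_complex_mult by (simp add: r_def norm_divide norm_power power_divide flip: power_mult)
  have der: "(g has_derivative g' x) (at x within S)" if "x \<in> S" for x
  proof -
    let ?z = "complex_of_vec x"
    have zH: "?z \<in> \<H>" using that X by (auto simp: S_def)
    have "(moebius A has_derivative (\<lambda>h. 1 / (aut_factor A ?z)\<^sup>2 * h)) (at ?z)"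
      using moebius_deriv[OF A zH] unfolding has_field_derivative_def .
    from has_derivative_compose[OF bounded_linear_imp_has_derivative[OF bounded_linear_complex_of_vec] this]
    have "((\<lambda>x. moebius A (complex_of_vec x)) has_derivative
        (\<lambda>h. 1 / (aut_factor A ?z)\<^sup>2 * complex_of_vec h)) (at x within S)" .
    from has_derivative_compose[OF this bounded_linear_imp_has_derivative[OF bounded_linear_vec_of_complex]]
    show ?thesis unfolding g_def[abs_def] g'_def[abs_def] .
  qed
  have inj: "inj_on g S"
  proof (rule inj_onI)
    fix x y assume "x \<in> S" "y \<in> S" "g x = g y"
    then have "moebius A (complex_of_vec x) = moebius A (complex_of_vec y)"
      unfolding g_def by (metis complex_of_vec_inverse(1))
    then have "complex_of_vec x = complex_of_vec y"
      using inj_on_moebius[OF A] X \<open>x \<in> S\<close> \<open>y \<in> S\<close> by (auto simp: S_def inj_on_def)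
    then show "x = y" by (metis complex_of_vec_inverse(2))
  qed
  have I: "?I = (\<integral>\<^sup>+x. ennreal (r x) * indicator S x \<partial>lborel)"
    using X(1) by (subst distr_complex_of_vec[symmetric], subst nn_integral_distr)
      (auto simp: r_def S_def indicator_def intro!: nn_integral_cong)
  have I': "\<dots> = (\<integral>\<^sup>+x. ennreal (indicator S x * r x) \<partial>lborel)"
    by (intro nn_integral_cong) (auto simp: indicator_def)
  have int: "integrable lborel (\<lambda>x. indicator S x * r x)"
    using False unfolding I I' by (intro integrableI_nonneg) (auto simp: top.not_eq_extremum r_def)
  define m where "m = integral\<^sup>L lborel (\<lambda>x. indicator S x * r x)"
  have "((\<lambda>x. if x \<in> S then r x else 0) has_integral m) UNIV"
    using has_integral_integral_lborel[OF int] unfolding m_def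
    by (rule has_integral_eq_rhs[OF has_integral_eq[rotated]]) (auto simp: indicator_def)
  then have "((\<lambda>x. \<bar>det (matrix (g' x))\<bar>) has_integral m) S"
    by (simp add: det)
  then have gS: "g ` S \<in> lmeasurable" "measure lebesgue (g ` S) = m"
    using has_measure_differentiable_image[OF _ der inj, of m] S by auto
  have img: "complex_of_vec -` (moebius A ` X) = g ` S"
  proof (intro equalityI subsetI)
    fix x assume "x \<in> complex_of_vec -` (moebius A ` X)"
    then obtain z where z: "z \<in> X" "complex_of_vec x = moebius A z" by auto
    then have "g (vec_of_complex z) = x" by (metis g_def complex_of_vec_inverse)
    then show "x \<in> g ` S" using z by (intro image_eqI[of _ _ "vec_of_complex z"]) (auto simp: S_def)
  qed (auto simp: g_def S_def)
  have mX: "moebius A ` X \<in> sets borel" using sets_moebius_image A X by blast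
  have gSb: "g ` S \<in> sets borel"
    using measurable_sets[OF measurable_complex_of_vec mX] by (simp add: img)
  have "emeasure lborel (moebius A ` X) = emeasure lborel (g ` S)"
    using mX by (subst distr_complex_of_vec[symmetric]) (simp add: emeasure_distr img)
  also have "\<dots> = emeasure lebesgue (g ` S)" using gSb by simp
  also have "\<dots> = ennreal m" using emeasure_eq_measure2[OF gS(1)] gS(2) by simp
  also have "\<dots> = (\<integral>\<^sup>+x. ennreal (indicator S x * r x) \<partial>lborel)"
    unfolding m_def by (rule nn_integral_eq_integral[symmetric, OF int]) (auto simp: r_def)
  also have "\<dots> = ?I" by (simp only: I I')
  finally show ?thesis by simp
qed (metis top_greatest infinity_ennreal_def)

definition hyp :: "complex measure" where
  "hyp = density lborel (\<lambda>z. ennreal (1 / (Im z)\<^sup>2))"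

lemma sets_hyp [simp, measurable_cong]: "sets hyp = sets borel"
  by (simp add: hyp_def)

lemma emeasure_hyp: "X \<in> sets borel \<Longrightarrow> emeasure hyp X = (\<integral>\<^sup>+z. ennreal (1 / (Im z)\<^sup>2) * indicator X z \<partial>lborel)"
  unfolding hyp_def by (subst emeasure_density) (auto simp: measurable_completion)

text \<open>The density \<open>1 / (Im z)\<^sup>2\<close> compensates the Jacobian, because \<open>Im (A z) = Im z / |c z + d|\<^sup>2\<close>. Applied to a
  transformation and its inverse, the estimate says that the hyperbolic area is invariant.\<close>

lemma emeasure_hyp_moebius_le:
  assumes A: "A \<in> carrier SL2Z" and X: "X \<in> sets borel" "X \<subseteq> \<H>"
  shows "emeasure hyp (moebius A ` X) \<le> emeasure hyp X"
proof -
  let ?B = "SL2Z_inv A"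
  note [measurable] = X(1)
  \<comment> \<open>The bound for the measure of images, read as an inequality between two measures, passes to
    the integrals of the density.\<close>
  define M where "M = distr (restrict_space lborel \<H>) borel (moebius ?B)"
  define M' where "M' = density lborel (\<lambda>z. ennreal (1 / norm (aut_factor A z) ^ 4) * indicator \<H> z)"
  have meas: "moebius ?B \<in> measurable (restrict_space lborel \<H>) borel"
    by (rule measurable_restrict_space1) simp
  have le: "emeasure M Y \<le> emeasure M' Y" if Y [measurable]: "Y \<in> sets borel" for Y
  proof -
    have "emeasure M Y = emeasure lborel (\<H> \<inter> moebius ?B -` (Y \<inter> \<H>))"
    proof -
      have "moebius ?B -` Y \<inter> \<H> = \<H> \<inter> moebius ?B -` (Y \<inter> \<H>)" using A by auto
      then show ?thesis
        unfolding M_def using Y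
        by (subst emeasure_distr[OF meas]) (simp_all add: space_restrict_space emeasure_restrict_space)
    qed
    also have "\<dots> = emeasure lborel (moebius A ` (Y \<inter> \<H>))"
      using moebius_image_eq_vimage[OF A, of "Y \<inter> \<H>"] by simp
    also have "\<dots> \<le> (\<integral>\<^sup>+z. ennreal (1 / norm (aut_factor A z) ^ 4) * indicator (Y \<inter> \<H>) z \<partial>lborel)"
      by (rule emeasure_moebius_image_le[OF A]) auto
    also have "\<dots> = emeasure M' Y"
      unfolding M'_def using Y
      by (subst emeasure_density) (auto intro!: nn_integral_cong simp: indicator_def)
    finally show ?thesis .
  qed
  have sM: "sets M = sets borel" "sets M' = sets borel" "space M = UNIV" "space M' = UNIV"
    by (simp_all add: M_def M'_def)
  have "emeasure M Y \<le> emeasure M' Y" for Y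
    by (cases "Y \<in> sets borel") (use le in \<open>simp_all add: emeasure_notin_sets sM\<close>)
  then have "M \<le> M'"
    unfolding le_measure_iff by (simp add: sM le_fun_def)
  then have mono: "nn_integral M h \<le> nn_integral M' h" for h
    by (intro nn_integral_mono_measure) (simp_all add: M_def M'_def)
  let ?h = "\<lambda>z. ennreal (1 / (Im (moebius A z))\<^sup>2) * indicator X z"
  have h_meas: "?h \<in> borel_measurable borel" by measurable
  have img: "moebius A ` X \<in> sets borel" using sets_moebius_image A X by blast
  have "emeasure hyp (moebius A ` X) = (\<integral>\<^sup>+w. ennreal (1 / (Im w)\<^sup>2) * indicator (moebius A ` X) w \<partial>lborel)"
    by (rule emeasure_hyp[OF img])
  also have "\<dots> = (\<integral>\<^sup>+w. ?h (moebius ?B w) * indicator \<H> w \<partial>lborel)"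
  proof (rule nn_integral_cong)
    fix w
    have "w \<in> moebius A ` X \<longleftrightarrow> w \<in> \<H> \<and> moebius ?B w \<in> X"
      using moebius_image_eq_vimage[OF A X(2)] by auto
    then show "ennreal (1 / (Im w)\<^sup>2) * indicator (moebius A ` X) w = ?h (moebius ?B w) * indicator \<H> w"
      using moebius_inverse(2)[OF A, of w] by (auto simp: indicator_def)
  qed
  also have "\<dots> = nn_integral M ?h"
    unfolding M_def using h_meas meas
    by (subst nn_integral_distr) (simp_all add: nn_integral_restrict_space)
  also have "\<dots> \<le> nn_integral M' ?h" by (rule mono)
  also have "\<dots> = (\<integral>\<^sup>+z. ennreal (1 / norm (aut_factor A z) ^ 4) * indicator \<H> z * ?h z \<partial>lborel)"
    unfolding M'_def by (subst nn_integral_density) (use h_meas in \<open>auto simp: measurable_completion\<close>)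
  also have "\<dots> = (\<integral>\<^sup>+z. ennreal (1 / (Im z)\<^sup>2) * indicator X z \<partial>lborel)"
  proof (rule nn_integral_cong)
    fix z
    show "ennreal (1 / norm (aut_factor A z) ^ 4) * indicator \<H> z * ?h z = ennreal (1 / (Im z)\<^sup>2) * indicator X z"
    proof (cases "z \<in> X")
      case True
      then have zH: "z \<in> \<H>" using X by blast
      have "1 / norm (aut_factor A z) ^ 4 * (1 / (Im (moebius A z))\<^sup>2) = 1 / (Im z)\<^sup>2"
        using aut_factor_nonzero[OF A zH]
        by (simp add: Im_moebius[OF A zH] power_divide flip: power_mult)
      then have "ennreal (1 / norm (aut_factor A z) ^ 4) * ennreal (1 / (Im (moebius A z))\<^sup>2) = ennreal (1 / (Im z)\<^sup>2)"
        by (simp flip: ennreal_mult)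
      then show ?thesis using True zH by (simp add: indicator_def)
    qed (simp add: indicator_def)
  qed
  also have "\<dots> = emeasure hyp X" by (rule emeasure_hyp[OF X(1), symmetric])
  finally show ?thesis .
qed

lemma emeasure_hyp_strip_finite: "emeasure hyp (strip (1/2) (1/2)) < \<infinity>"
proof -
  \<comment> \<open>Boxes of area one above the height \<open>(n + 1) / 2\<close>.\<close>
  define Q where "Q n = cbox (Complex (-1/2) (1/2 + real n)) (Complex (1/2) (1/2 + real (Suc n)))" for n
  have cover: "strip (1/2) (1/2) \<subseteq> (\<Union>n. Q n)"
  proof
    fix z assume z: "z \<in> strip (1/2) (1/2)"
    define n where "n = nat \<lfloor>Im z - 1/2\<rfloor>"
    have "real n = of_int \<lfloor>Im z - 1/2\<rfloor>" using z by (simp add: n_def strip_def)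
    then have "real n \<le> Im z - 1/2" "Im z - 1/2 \<le> real n + 1" by linarith+
    then have "z \<in> Q n" using z by (auto simp: Q_def in_cbox_complex_iff strip_def abs_le_iff)
    then show "z \<in> (\<Union>n. Q n)" by blast
  qed
  have QB: "Q n \<in> sets borel" for n by (simp add: Q_def)
  have bound: "emeasure hyp (Q n) \<le> ennreal (4 / (real n + 1)\<^sup>2)" for n
  proof -
    have "emeasure hyp (Q n) = (\<integral>\<^sup>+z. ennreal (1 / (Im z)\<^sup>2) * indicator (Q n) z \<partial>lborel)"
      by (rule emeasure_hyp[OF QB])
    also have "\<dots> \<le> (\<integral>\<^sup>+z. ennreal (4 / (real n + 1)\<^sup>2) * indicator (Q n) z \<partial>lborel)"
    proof (rule nn_integral_mono)
      fix z
      have "1 / (Im z)\<^sup>2 \<le> 4 / (real n + 1)\<^sup>2" if "z \<in> Q n"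
      proof -
        have "(real n + 1) / 2 \<le> Im z" using that by (auto simp: Q_def in_cbox_complex_iff)
        then have "((real n + 1) / 2)\<^sup>2 \<le> (Im z)\<^sup>2" by (intro power_mono) auto
        moreover have "0 < ((real n + 1) / 2)\<^sup>2" by simp
        ultimately have "1 / (Im z)\<^sup>2 \<le> 1 / ((real n + 1) / 2)\<^sup>2"
          by (intro divide_left_mono mult_pos_pos) linarith+
        then show ?thesis by (simp add: power_divide)
      qed
      then show "ennreal (1 / (Im z)\<^sup>2) * indicator (Q n) z \<le> ennreal (4 / (real n + 1)\<^sup>2) * indicator (Q n) z"
        by (auto simp: indicator_def intro!: ennreal_leI)
    qed
    also have "\<dots> = ennreal (4 / (real n + 1)\<^sup>2) * emeasure lborel (Q n)"
      by (rule nn_integral_cmult_indicator) (simp add: Q_def)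
    also have "emeasure lborel (Q n) = 1"
      by (simp add: Q_def emeasure_lborel_cbox_eq Basis_complex_def)
    finally show ?thesis by simp
  qed
  have sm: "summable (\<lambda>n. 4 / (real n + 1)\<^sup>2)"
    using summable_mult[OF inverse_power_summable[THEN summable_Suc_iff[THEN iffD2], of 2], of 4]
    by (simp add: field_simps)
  have "strip (1/2) (1/2) = {z. -1/2 \<le> Re z} \<inter> {z. Re z \<le> 1/2} \<inter> {z. 1/2 \<le> Im z}"
    by (auto simp: strip_def abs_le_iff)
  then have "emeasure hyp (strip (1/2) (1/2)) \<le> emeasure hyp (\<Union>n. Q n)"
    using cover QB by (intro emeasure_mono) auto
  also have "\<dots> \<le> (\<Sum>n. emeasure hyp (Q n))"
    using QB by (intro emeasure_subadditive_countably) auto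
  also have "\<dots> \<le> (\<Sum>n. ennreal (4 / (real n + 1)\<^sup>2))" by (intro suminf_le bound) auto
  also have "\<dots> = ennreal (\<Sum>n. 4 / (real n + 1)\<^sup>2)" using sm by (intro suminf_ennreal2) auto
  also have "\<dots> < \<infinity>" by simp
  finally show ?thesis .
qed

section \<open>Fundamental sets and the Petersson product\<close>

lemma finite_image_factor:
  assumes "finite (f ` P)" "\<And>x y. x \<in> P \<Longrightarrow> y \<in> P \<Longrightarrow> f x = f y \<Longrightarrow> h x = h y"
  shows "finite (h ` P)"
proof -
  have "h ` P = (\<lambda>z. h (inv_into P f z)) ` f ` P"
    unfolding image_image
    by (intro image_cong refl assms(2)) (auto simp: inv_into_into f_inv_into_f)
  then show ?thesis using assms(1) by simp
qed

lemma same_bottom_row: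
  assumes "A \<in> carrier SL2Z" "B \<in> carrier SL2Z" "A$2$1 = B$2$1" "A$2$2 = B$2$2"
  obtains n where "A = transl n ** B"
proof
  have d: "B$1$1 * B$2$2 = 1 + B$1$2 * B$2$1" "A$1$1 * B$2$2 = 1 + A$1$2 * B$2$1"
    using assms by (simp_all add: SL2Z_iff)
  have "A ** SL2Z_inv B = transl (A$1$2 * B$1$1 - A$1$1 * B$1$2)"
    using assms(3,4) d by (simp add: mat2_eq_iff algebra_simps)
  then show "A = transl (A$1$2 * B$1$1 - A$1$1 * B$1$2) ** B"
    using SL2Z_inv_cancel_right(1)[OF assms(2), of A] by simp
qed

text \<open>There are finitely many bottom rows. A bottom row determines the point up to a translation, and the
  integral part of the real part determines the translation.\<close>

lemma finite_orbit_in_strip: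
  assumes "\<tau> \<in> \<H>" "y > 0"
  shows "finite {moebius A \<tau> | A. A \<in> carrier SL2Z \<and> moebius A \<tau> \<in> strip R y}"
proof -
  define P where "P = {A \<in> carrier SL2Z. moebius A \<tau> \<in> strip R y}"
  define key where "key A = ((A$2$1, A$2$2), \<lfloor>Re (moebius A \<tau>)\<rfloor>)" for A :: "int^2^2"
  let ?L = "{(c::int, d::int). norm (of_int c * \<tau> + of_int d) \<le> sqrt (Im \<tau> / y)}"
  have "key ` P \<subseteq> ?L \<times> {\<lfloor>- R\<rfloor>..\<lfloor>R\<rfloor>}"
  proof (rule image_subsetI)
    fix A assume "A \<in> P"
    then have A: "A \<in> carrier SL2Z" "Im (moebius A \<tau>) \<ge> y" "\<bar>Re (moebius A \<tau>)\<bar> \<le> R"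
      by (auto simp: P_def strip_def)
    let ?j = "aut_factor A \<tau>"
    have "(norm ?j)\<^sup>2 > 0" using aut_factor_nonzero[OF A(1) assms(1)] by simp
    then have "(norm ?j)\<^sup>2 \<le> Im \<tau> / y"
      using A assms by (simp add: Im_moebius field_simps)
    then have "norm ?j \<le> sqrt (Im \<tau> / y)" by (rule real_le_rsqrt)
    then show "key A \<in> ?L \<times> {\<lfloor>- R\<rfloor>..\<lfloor>R\<rfloor>}"
      using A(3) by (auto simp: key_def aut_factor_def intro!: floor_mono)
  qed
  then have "finite (key ` P)"
    by (rule finite_subset) (intro finite_cartesian_product finite_small_linear_forms assms finite_atLeastAtMost_int)
  then have "finite ((\<lambda>A. moebius A \<tau>) ` P)"
  proof (rule finite_image_factor)
    fix A B assume AB: "A \<in> P" "B \<in> P" "key A = key B"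
    then obtain n where n: "A = transl n ** B"
      using same_bottom_row[of A B] by (auto simp: P_def key_def)
    have e: "moebius A \<tau> = moebius B \<tau> + of_int n"
      using AB assms unfolding n by (simp add: moebius_mult P_def)
    then have "\<lfloor>Re (moebius A \<tau>)\<rfloor> = \<lfloor>Re (moebius B \<tau>)\<rfloor> + n" by simp
    then have "n = 0" using AB by (simp add: key_def)
    with e show "moebius A \<tau> = moebius B \<tau>" by simp
  qed
  moreover have "{moebius A \<tau> | A. A \<in> carrier SL2Z \<and> moebius A \<tau> \<in> strip R y} = (\<lambda>A. moebius A \<tau>) ` P"
    by (auto simp: P_def)
  ultimately show ?thesis by simp
qed

context congruence_group
begin

text \<open>In every orbit, choose among the points of maximal imaginary part the one with the smallest nonnegative real
  part. It exists since orbits are finite in strips, and the choice is expressed by countably many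
  Borel conditions.\<close>

lemma borel_fundamental_set_exists: "\<exists>D. borel_fundamental_set G D"
proof -
  define D where "D = {\<tau> \<in> \<H>. Re \<tau> \<ge> 0 \<and> (\<forall>A. A \<in> G \<longrightarrow> Im (moebius A \<tau>) \<le> Im \<tau> \<and>
    (Im (moebius A \<tau>) = Im \<tau> \<longrightarrow> Re (moebius A \<tau>) \<ge> 0 \<longrightarrow> Re \<tau> \<le> Re (moebius A \<tau>)))}"
  have "D = {\<tau> \<in> space borel. \<tau> \<in> \<H> \<and> Re \<tau> \<ge> 0 \<and> (\<forall>A. A \<in> G \<longrightarrow> Im (moebius A \<tau>) \<le> Im \<tau> \<and>
    (Im (moebius A \<tau>) = Im \<tau> \<longrightarrow> Re (moebius A \<tau>) \<ge> 0 \<longrightarrow> Re \<tau> \<le> Re (moebius A \<tau>)))}"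
    by (simp add: D_def)
  also have "\<dots> \<in> sets borel" by measurable
  finally have "D \<in> sets borel" .
  have D_max: "Im (moebius C \<sigma>) \<le> Im \<sigma>" if "\<sigma> \<in> D" "C \<in> G" for \<sigma> C
    using that by (simp add: D_def)
  have D_min: "Re \<sigma> \<le> Re (moebius C \<sigma>)"
    if "\<sigma> \<in> D" "C \<in> G" "Im (moebius C \<sigma>) = Im \<sigma>" "Re (moebius C \<sigma>) \<ge> 0" for \<sigma> C
    using that by (simp add: D_def)
  have D_nonneg: "Re \<sigma> \<ge> 0" if "\<sigma> \<in> D" for \<sigma>
    using that by (simp add: D_def)
  note \<open>D \<in> sets borel\<close>
  moreover have "\<exists>!\<sigma>. \<sigma> \<in> D \<and> (\<exists>A\<in>G. moebius A \<tau> = \<sigma>)" if \<tau>: "\<tau> \<in> \<H>" for \<tau>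
  proof (rule ex_ex1I)
    fix \<sigma> \<sigma>' assume "\<sigma> \<in> D \<and> (\<exists>A\<in>G. moebius A \<tau> = \<sigma>)" "\<sigma>' \<in> D \<and> (\<exists>A\<in>G. moebius A \<tau> = \<sigma>')"
    then obtain A B where AB: "A \<in> G" "B \<in> G" "\<sigma> = moebius A \<tau>" "\<sigma>' = moebius B \<tau>" "\<sigma> \<in> D" "\<sigma>' \<in> D" by blast
    have "moebius (B ** SL2Z_inv A) \<sigma> = \<sigma>'" "moebius (A ** SL2Z_inv B) \<sigma>' = \<sigma>"
      using AB \<tau> by (simp_all add: moebius_mult moebius_inverse)
    moreover have "B ** SL2Z_inv A \<in> G" "A ** SL2Z_inv B \<in> G" using AB by auto
    ultimately have "Im \<sigma>' \<le> Im \<sigma>" "Im \<sigma> \<le> Im \<sigma>'"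
      "Im \<sigma>' = Im \<sigma> \<Longrightarrow> Re \<sigma> \<le> Re \<sigma>'" "Im \<sigma> = Im \<sigma>' \<Longrightarrow> Re \<sigma>' \<le> Re \<sigma>"
      using D_max D_min D_nonneg AB(5,6) by metis+
    then show "\<sigma> = \<sigma>'" by (simp add: complex_eq_iff)
  next
    obtain A where A: "A \<in> G" and max: "\<And>B. B \<in> G \<Longrightarrow> Im (moebius B \<tau>) \<le> Im (moebius A \<tau>)"
      using exists_max_Im[OF \<tau>, of G] by auto
    define m where "m = Im (moebius A \<tau>)"
    have m: "m > 0" using A \<tau> moebius_in_H[of A \<tau>] by (simp add: m_def in_H_iff)
    obtain n :: int where n: "0 \<le> Re (moebius A \<tau>) + real level * of_int n"
      using exists_period_reduction[OF level(1), of "moebius A \<tau>"] by blast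
    define A' where "A' = transl (int level * n) ** A"
    have "transl (int level * n) \<in> G"
      using conj_transl_in_G[of "mat 1" "int level * n"] by (simp add: SL2Z_inv_def mat2_eq_iff congruent_one_in_G)
    then have A': "A' \<in> G" using A by (auto simp: A'_def)
    have mA': "moebius A' \<tau> = moebius A \<tau> + of_int (int level * n)"
      unfolding A'_def using A \<tau> by (subst moebius_mult) auto
    define R where "R = Re (moebius A' \<tau>)"
    have R0: "R \<ge> 0" using n by (simp add: R_def mA')
    define V where "V = {moebius B \<tau> | B. B \<in> G \<and> Im (moebius B \<tau>) = m \<and> 0 \<le> Re (moebius B \<tau>) \<and> Re (moebius B \<tau>) \<le> R}"
    have "finite V"
      by (rule finite_subset[OF _ finite_orbit_in_strip[OF \<tau> m, of R]]) (auto simp: V_def strip_def)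
    moreover have "moebius A' \<tau> \<in> V"
      unfolding V_def using A' R0 by (auto simp: mA' m_def R_def intro!: exI[of _ A'])
    ultimately obtain \<sigma> where \<sigma>: "\<sigma> \<in> V" and min: "\<And>w. w \<in> V \<Longrightarrow> Re \<sigma> \<le> Re w"
      using ex_min_if_finite[of "Re ` V"] by (metis (no_types, lifting) arg_min_if_finite(1) arg_min_least empty_iff)
    then obtain B where B: "B \<in> G" "\<sigma> = moebius B \<tau>" "Im \<sigma> = m" "0 \<le> Re \<sigma>" "Re \<sigma> \<le> R" by (auto simp: V_def)
    have "\<sigma> \<in> D"
      unfolding D_def
    proof (intro CollectI conjI allI impI)
      show "\<sigma> \<in> \<H>" using B \<tau> by simp
      fix C assume C: "C \<in> G"
      have e: "moebius C \<sigma> = moebius (C ** B) \<tau>" using B C \<tau> by (simp add: moebius_mult)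
      have CB: "C ** B \<in> G" using B C by auto
      show "Im (moebius C \<sigma>) \<le> Im \<sigma>" using max[OF CB] B(3) by (simp only: e m_def)
      assume "Im (moebius C \<sigma>) = Im \<sigma>" "0 \<le> Re (moebius C \<sigma>)"
      then show "Re \<sigma> \<le> Re (moebius C \<sigma>)"
        using min[of "moebius C \<sigma>"] CB B unfolding V_def e by (cases "Re (moebius (C ** B) \<tau>) \<le> R") auto
    qed (use B in auto)
    then show "\<exists>\<sigma>. \<sigma> \<in> D \<and> (\<exists>A\<in>G. moebius A \<tau> = \<sigma>)" using B by blast
  qed
  ultimately have "borel_fundamental_set G D" by (auto simp: borel_fundamental_set_def D_def)
  then show ?thesis by blast
qed

definition fund :: "complex set" where "fund = (SOME D. borel_fundamental_set G D)"

lemma fund: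
  shows fund_borel: "fund \<in> sets borel" and fund_subset_H: "fund \<subseteq> \<H>"
    and fund_meets: "\<And>\<tau>. \<tau> \<in> \<H> \<Longrightarrow> \<exists>A\<in>G. moebius A \<tau> \<in> fund"
    and fund_unique: "\<And>\<sigma> A. \<sigma> \<in> fund \<Longrightarrow> A \<in> G \<Longrightarrow> moebius A \<sigma> \<in> fund \<Longrightarrow> moebius A \<sigma> = \<sigma>"
proof -
  have F: "borel_fundamental_set G fund"
    unfolding fund_def by (rule someI_ex[OF borel_fundamental_set_exists])
  then show "fund \<in> sets borel" "fund \<subseteq> \<H>" by (auto simp: borel_fundamental_set_def)
  show "\<exists>A\<in>G. moebius A \<tau> \<in> fund" if "\<tau> \<in> \<H>" for \<tau>
    using F that unfolding borel_fundamental_set_def by blast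
  show "moebius A \<sigma> = \<sigma>" if "\<sigma> \<in> fund" "A \<in> G" "moebius A \<sigma> \<in> fund" for \<sigma> A
  proof -
    have "\<sigma> \<in> \<H>" using that \<open>fund \<subseteq> \<H>\<close> by blast
    then have "\<exists>!\<sigma>'. \<sigma>' \<in> fund \<and> (\<exists>A\<in>G. moebius A \<sigma> = \<sigma>')"
      using F by (simp add: borel_fundamental_set_def)
    moreover have "\<exists>A\<in>G. moebius A \<sigma> = \<sigma>" by (rule bexI[of _ "mat 1"]) auto
    ultimately show ?thesis using that by blast
  qed
qed

text \<open>Cut the fundamental set into countably many pieces, each moved into the strip by one element of the
  modular group. Pieces moved by elements of one and the same coset have disjoint images, so the
  area of the fundamental set is at most the index times the area of the strip.\<close>

lemma emeasure_hyp_fund_finite: "emeasure hyp fund < \<infinity>"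
proof -
  define F where "F = strip (1/2) (1/2)"
  have FH: "F \<subseteq> \<H>" unfolding F_def by (rule strip_subset_H) simp
  have FB [measurable]: "F \<in> sets borel"
  proof -
    have "F = {z. -1/2 \<le> Re z} \<inter> {z. Re z \<le> 1/2} \<inter> {z. 1/2 \<le> Im z}"
      by (auto simp: strip_def abs_le_iff F_def)
    then show ?thesis by simp
  qed
  \<comment> \<open>The first matrix, in a fixed enumeration, that moves \<open>\<tau>\<close> to the strip has the number \<open>n\<close>, and
    its inverse lies in the coset \<open>c\<close>.\<close>
  define X where "X c n = {\<tau> \<in> fund. \<exists>A. (A \<in> carrier SL2Z \<and> to_nat A = n \<and> coset (SL2Z_inv A) = c) \<and>
      moebius A \<tau> \<in> F \<and> (\<forall>B. (B \<in> carrier SL2Z \<and> to_nat B < n) \<longrightarrow> moebius B \<tau> \<notin> F)}" for c n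
  define Y where "Y c n = moebius (from_nat n) ` X c n" for c n
  note fund_borel [measurable]
  have XB: "X c n \<in> sets borel" for c n
  proof -
    have "X c n = {\<tau> \<in> space borel. \<tau> \<in> fund \<and> (\<exists>A. (A \<in> carrier SL2Z \<and> to_nat A = n \<and> coset (SL2Z_inv A) = c) \<and>
      moebius A \<tau> \<in> F \<and> (\<forall>B. (B \<in> carrier SL2Z \<and> to_nat B < n) \<longrightarrow> moebius B \<tau> \<notin> F))}"
      by (simp add: X_def)
    also have "\<dots> \<in> sets borel" by measurable
    finally show ?thesis .
  qed
  have XH: "X c n \<subseteq> \<H>" for c n using fund_subset_H by (auto simp: X_def)
  have cover: "fund \<subseteq> (\<Union>c\<in>cosets. \<Union>n. X c n)"
  proof
    fix \<tau> assume \<tau>: "\<tau> \<in> fund"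
    then obtain A0 where A0: "A0 \<in> carrier SL2Z" "moebius A0 \<tau> \<in> F"
      using reduction[of \<tau>] fund_subset_H unfolding F_def by blast
    define Q where "Q n \<longleftrightarrow> (\<exists>A \<in> carrier SL2Z. to_nat A = n \<and> moebius A \<tau> \<in> F)" for n
    have "Q (to_nat A0)" using A0 by (auto simp: Q_def)
    then have "Q (LEAST n. Q n)" by (rule LeastI)
    then obtain A where A: "A \<in> carrier SL2Z" "to_nat A = (LEAST n. Q n)" "moebius A \<tau> \<in> F" by (auto simp: Q_def)
    have "moebius B \<tau> \<notin> F" if "B \<in> carrier SL2Z" "to_nat B < (LEAST n. Q n)" for B
      using not_less_Least[OF that(2)] that(1) by (auto simp: Q_def)
    then have "\<tau> \<in> X (coset (SL2Z_inv A)) (LEAST n. Q n)"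
      unfolding X_def using \<tau> A by blast
    moreover have "coset (SL2Z_inv A) \<in> cosets" using A by (simp add: cosets_def)
    ultimately show "\<tau> \<in> (\<Union>c\<in>cosets. \<Union>n. X c n)" by blast
  qed
  have X_cases: "X c n = {} \<or> (from_nat n \<in> carrier SL2Z \<and> coset (SL2Z_inv (from_nat n)) = c \<and> Y c n \<subseteq> F)" for c n
    by (auto simp: X_def Y_def)
  have YB: "Y c n \<in> sets borel" for c n
    using X_cases[of c n] sets_moebius_image[OF _ XH XB] by (auto simp: Y_def)
  have le: "emeasure hyp (X c n) \<le> emeasure hyp (Y c n)" for c n
    using X_cases[of c n]
  proof
    assume *: "from_nat n \<in> carrier SL2Z \<and> coset (SL2Z_inv (from_nat n)) = c \<and> Y c n \<subseteq> F"
    let ?A = "from_nat n :: int^2^2"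
    have "moebius (SL2Z_inv ?A) ` Y c n = X c n"
      unfolding Y_def image_image using moebius_inverse(1)[of ?A] * XH[of c n]
      by (simp add: subset_iff cong: image_cong)
    then show ?thesis
      using emeasure_hyp_moebius_le[of "SL2Z_inv ?A", OF _ YB[of c n]] * FH by auto
  qed simp
  have disj: "disjoint_family (Y c)" for c
    unfolding disjoint_family_on_def
  proof (intro ballI impI equalityI subsetI)
    fix n m w assume nm: "n \<noteq> m" and w: "w \<in> Y c n \<inter> Y c m"
    then obtain \<sigma> \<sigma>' where \<sigma>: "\<sigma> \<in> X c n" "w = moebius (from_nat n) \<sigma>" "\<sigma>' \<in> X c m" "w = moebius (from_nat m) \<sigma>'"
      by (auto simp: Y_def)
    let ?A = "from_nat n :: int^2^2" and ?B = "from_nat m :: int^2^2"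
    have AB: "?A \<in> carrier SL2Z" "?B \<in> carrier SL2Z" "coset (SL2Z_inv ?A) = coset (SL2Z_inv ?B)"
      using X_cases[of c n] X_cases[of c m] \<sigma> by auto
    obtain C where C: "C \<in> G" "SL2Z_inv ?A = C ** SL2Z_inv ?B"
      using coset_eqD[OF AB(3)] AB by auto
    have H: "\<sigma> \<in> \<H>" "\<sigma>' \<in> \<H>" using \<sigma> XH by blast+
    have "\<sigma> = moebius (SL2Z_inv ?A) w" using \<sigma> H AB by (simp add: moebius_inverse)
    also have "\<dots> = moebius C (moebius (SL2Z_inv ?B) w)"
      unfolding C(2) using C AB H \<sigma> by (intro moebius_mult) auto
    also have "moebius (SL2Z_inv ?B) w = \<sigma>'" using \<sigma>(4) H AB by (simp add: moebius_inverse)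
    finally have e: "\<sigma> = moebius C \<sigma>'" .
    have "\<sigma> \<in> fund" "\<sigma>' \<in> fund" using \<sigma> by (auto simp: X_def)
    then have ss: "\<sigma> = \<sigma>'" using fund_unique[of \<sigma>' C] C e by simp
    have "\<not> n < m" "\<not> m < n" using \<sigma>(1,3) unfolding ss X_def by auto
    with nm show "w \<in> {}" by simp
  qed auto
  have "emeasure hyp fund \<le> emeasure hyp (\<Union>c\<in>cosets. \<Union>n. X c n)"
  proof (rule emeasure_mono[OF cover])
    show "(\<Union>c\<in>cosets. \<Union>n. X c n) \<in> sets hyp"
      using XB finite_cosets by (intro sets.finite_UN sets.countable_UN) auto
  qed
  also have "\<dots> \<le> (\<Sum>c\<in>cosets. emeasure hyp (\<Union>n. X c n))"
    using XB finite_cosets by (intro emeasure_subadditive_finite) auto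
  also have "\<dots> \<le> (\<Sum>c\<in>cosets. emeasure hyp F)"
  proof (rule sum_mono)
    fix c
    have "emeasure hyp (\<Union>n. X c n) \<le> (\<Sum>n. emeasure hyp (X c n))"
      using XB by (intro emeasure_subadditive_countably) auto
    also have "\<dots> \<le> (\<Sum>n. emeasure hyp (Y c n))" by (intro suminf_le le) auto
    also have "\<dots> = emeasure hyp (\<Union>n. Y c n)" using YB disj by (intro suminf_emeasure) auto
    also have "\<dots> \<le> emeasure hyp F"
    proof (intro emeasure_mono)
      show "(\<Union>n. Y c n) \<subseteq> F" using X_cases[of c] by (fastforce simp: Y_def)
    qed simp
    finally show "emeasure hyp (\<Union>n. X c n) \<le> emeasure hyp F" .
  qed
  also have "\<dots> < \<infinity>"
    using emeasure_hyp_strip_finite by (simp add: F_def ennreal_mult_less_top of_nat_less_top)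
  finally show ?thesis .
qed

lemma petersson_alt: "petersson k G f g =
    (LINT \<tau>|lborel. indicator fund \<tau> *\<^sub>R (f \<tau> * cnj (g \<tau>) * of_real (Im \<tau> powi (int k - 2))))"
  by (simp add: petersson_def fund_def set_lebesgue_integral_def)

text \<open>The integrand is a bounded function times the density of the hyperbolic area.\<close>

lemma petersson_integrable:
  assumes f: "f \<in> modular_forms k G" and g: "g \<in> cusp_forms k G"
  shows "integrable lborel (\<lambda>\<tau>. indicator fund \<tau> *\<^sub>R (f \<tau> * cnj (g \<tau>) * of_real (Im \<tau> powi (int k - 2))))"
    (is "integrable _ ?h")
proof -
  obtain C where C: "\<And>\<tau>. \<tau> \<in> \<H> \<Longrightarrow> norm (f \<tau>) * norm (g \<tau>) * Im \<tau> ^ k \<le> C"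
    using cusp_product_bounded[OF f g] by blast
  note fund_borel [measurable]
  have base: "integrable lborel (\<lambda>\<tau>. indicator fund \<tau> * (1 / (Im \<tau>)\<^sup>2))"
  proof (rule integrableI_nonneg)
    have "(\<integral>\<^sup>+\<tau>. ennreal (indicator fund \<tau> * (1 / (Im \<tau>)\<^sup>2)) \<partial>lborel) = emeasure hyp fund"
      unfolding emeasure_hyp[OF fund_borel] by (intro nn_integral_cong) (simp add: indicator_def)
    then show "(\<integral>\<^sup>+\<tau>. ennreal (indicator fund \<tau> * (1 / (Im \<tau>)\<^sup>2)) \<partial>lborel) < \<infinity>"
      using emeasure_hyp_fund_finite by simp
  qed auto
  show ?thesis
  proof (rule Bochner_Integration.integrable_bound)
    show "integrable lborel (\<lambda>\<tau>. C * (indicator fund \<tau> * (1 / (Im \<tau>)\<^sup>2)))"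
      using base by (intro integrable_mult_right)
    have "continuous_on \<H> f" "continuous_on \<H> g"
      using modular_formsD(1)[OF f] modular_formsD(1)[OF cusp_forms_modular[OF g]]
      by (simp_all add: holomorphic_on_imp_continuous_on)
    then have "continuous_on \<H> (\<lambda>\<tau>. f \<tau> * cnj (g \<tau>) * of_real (Im \<tau> powi (int k - 2)))"
      by (intro continuous_intros) (auto simp: in_H_iff)
    then have "(\<lambda>\<tau>. indicator \<H> \<tau> *\<^sub>R (f \<tau> * cnj (g \<tau>) * of_real (Im \<tau> powi (int k - 2)))) \<in> borel_measurable borel"
      by (rule borel_measurable_continuous_on_indicator[OF sets_H])
    then have "(\<lambda>\<tau>. indicator fund \<tau> *\<^sub>R (indicator \<H> \<tau> *\<^sub>R (f \<tau> * cnj (g \<tau>) * of_real (Im \<tau> powi (int k - 2))))) \<in> borel_measurable borel"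
      by measurable
    also have "(\<lambda>\<tau>. indicator fund \<tau> *\<^sub>R (indicator \<H> \<tau> *\<^sub>R (f \<tau> * cnj (g \<tau>) * of_real (Im \<tau> powi (int k - 2))))) = ?h"
      using fund_subset_H by (auto simp: fun_eq_iff indicator_def)
    finally show "?h \<in> borel_measurable lborel" by simp
    show "AE \<tau> in lborel. norm (?h \<tau>) \<le> norm (C * (indicator fund \<tau> * (1 / (Im \<tau>)\<^sup>2)))"
    proof (rule AE_I2)
      fix \<tau>
      show "norm (?h \<tau>) \<le> norm (C * (indicator fund \<tau> * (1 / (Im \<tau>)\<^sup>2)))"
      proof (cases "\<tau> \<in> fund")
        case True
        then have H: "\<tau> \<in> \<H>" using fund_subset_H by blast
        then have im: "Im \<tau> > 0" by (simp add: in_H_iff)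
        have "Im \<tau> powi (int k - 2) = Im \<tau> ^ k / (Im \<tau>)\<^sup>2"
          using im by (simp add: power_int_diff)
        then have "norm (?h \<tau>) = norm (f \<tau>) * norm (g \<tau>) * Im \<tau> ^ k / (Im \<tau>)\<^sup>2"
          using True im by (simp add: norm_mult norm_divide norm_power)
        also have "\<dots> \<le> C / (Im \<tau>)\<^sup>2" by (rule divide_right_mono[OF C[OF H]]) simp
        also have "\<dots> \<le> norm (C * (indicator fund \<tau> * (1 / (Im \<tau>)\<^sup>2)))"
          using True by (simp add: divide_right_mono)
        finally show ?thesis .
      qed simp
    qed
  qed
qed

lemma petersson_lincomb_left:
  assumes "f \<in> modular_forms k G" "f' \<in> modular_forms k G" "g \<in> cusp_forms k G"
  shows "petersson k G (\<lambda>\<tau>. a * f \<tau> + b * f' \<tau>) g = a * petersson k G f g + b * petersson k G f' g"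
proof -
  have "petersson k G (\<lambda>\<tau>. a * f \<tau> + b * f' \<tau>) g = (LINT \<tau>|lborel.
      a * (indicator fund \<tau> *\<^sub>R (f \<tau> * cnj (g \<tau>) * of_real (Im \<tau> powi (int k - 2)))) +
      b * (indicator fund \<tau> *\<^sub>R (f' \<tau> * cnj (g \<tau>) * of_real (Im \<tau> powi (int k - 2)))))"
    unfolding petersson_alt by (intro Bochner_Integration.integral_cong refl) (auto simp: indicator_def algebra_simps)
  also have "\<dots> = a * petersson k G f g + b * petersson k G f' g"
    unfolding petersson_alt
    by (simp only: Bochner_Integration.integral_add[OF integrable_mult_right[OF petersson_integrable[OF assms(1,3)]]
      integrable_mult_right[OF petersson_integrable[OF assms(2,3)]]] integral_mult_right_zero)
  finally show ?thesis .
qed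

lemma petersson_lincomb_right:
  assumes "f \<in> cusp_forms k G" "f' \<in> cusp_forms k G" "g \<in> modular_forms k G"
  shows "petersson k G g (\<lambda>\<tau>. a * f \<tau> + b * f' \<tau>) = cnj a * petersson k G g f + cnj b * petersson k G g f'"
proof -
  have "petersson k G g (\<lambda>\<tau>. a * f \<tau> + b * f' \<tau>) = (LINT \<tau>|lborel.
      cnj a * (indicator fund \<tau> *\<^sub>R (g \<tau> * cnj (f \<tau>) * of_real (Im \<tau> powi (int k - 2)))) +
      cnj b * (indicator fund \<tau> *\<^sub>R (g \<tau> * cnj (f' \<tau>) * of_real (Im \<tau> powi (int k - 2)))))"
    unfolding petersson_alt by (intro Bochner_Integration.integral_cong refl) (auto simp: indicator_def algebra_simps)
  also have "\<dots> = cnj a * petersson k G g f + cnj b * petersson k G g f'"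
    unfolding petersson_alt
    by (simp only: Bochner_Integration.integral_add[OF integrable_mult_right[OF petersson_integrable[OF assms(3,1)]]
      integrable_mult_right[OF petersson_integrable[OF assms(3,2)]]] integral_mult_right_zero)
  finally show ?thesis .
qed

text \<open>If the norm of a cusp form vanishes, its nonzero set meets the fundamental set in a null set; the
  countably many translates of that null set cover the nonzero set, which is open.\<close>

lemma petersson_definite:
  assumes g: "g \<in> cusp_forms k G" and 0: "petersson k G g g = 0"
  shows "g = (\<lambda>_. 0)"
proof -
  have gm: "g \<in> modular_forms k G" using g by (rule cusp_forms_modular)
  note gD = modular_formsD[OF gm]
  define u where "u \<tau> = indicator fund \<tau> * ((norm (g \<tau>))\<^sup>2 * Im \<tau> powi (int k - 2))" for \<tau>
  have eq: "indicator fund \<tau> *\<^sub>R (g \<tau> * cnj (g \<tau>) * of_real (Im \<tau> powi (int k - 2))) = complex_of_real (u \<tau>)" for \<tau>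
    by (simp add: u_def indicator_def complex_norm_square[symmetric])
  have "integrable lborel (\<lambda>\<tau>. complex_of_real (u \<tau>))"
    using petersson_integrable[OF gm g] by (simp only: eq)
  then have int: "integrable lborel u" by (simp only: complex_of_real_integrable_eq)
  have "complex_of_real (integral\<^sup>L lborel u) = 0"
    using 0 by (simp only: petersson_alt eq integral_complex_of_real)
  then have "integral\<^sup>L lborel u = 0" by simp
  moreover have nn: "u \<tau> \<ge> 0" for \<tau>
  proof (cases "\<tau> \<in> fund")
    case True
    then have "Im \<tau> > 0" using fund_subset_H by (auto simp: in_H_iff)
    then show ?thesis using True by (simp add: u_def zero_le_power_int)
  qed (simp add: u_def)
  ultimately have "AE \<tau> in lborel. u \<tau> = 0"
    using integral_nonneg_eq_0_iff_AE[OF int] by simp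
  moreover define N where "N = {\<tau> \<in> fund. g \<tau> \<noteq> 0}"
  have "u \<tau> \<noteq> 0" if "\<tau> \<in> N" for \<tau>
  proof -
    have "Im \<tau> > 0" using that fund_subset_H by (auto simp: N_def in_H_iff)
    then show ?thesis using that by (simp add: u_def N_def)
  qed
  ultimately have "AE \<tau> in lborel. \<tau> \<notin> N" by (auto elim: eventually_mono)
  then obtain N' where "N \<subseteq> N'" "N' \<in> null_sets lborel"
    unfolding eventually_ae_filter by auto
  then have negN: "negligible N"
    by (meson negligible_iff_null_sets negligible_subset null_sets_completionI)
  define U where "U = {\<tau> \<in> \<H>. g \<tau> \<noteq> 0}"
  have "U \<subseteq> (\<Union>A\<in>G. moebius A ` N)"
  proof
    fix \<tau> assume \<tau>: "\<tau> \<in> U"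
    then have H: "\<tau> \<in> \<H>" by (simp add: U_def)
    obtain A where A: "A \<in> G" "moebius A \<tau> \<in> fund" using fund_meets[OF H] by blast
    have "g (moebius A \<tau>) \<noteq> 0"
      using gD(3)[OF A(1) H] \<tau> by (auto simp: slash_def U_def)
    then have "moebius A \<tau> \<in> N" using A by (simp add: N_def)
    moreover have "\<tau> = moebius (SL2Z_inv A) (moebius A \<tau>)" using A H by (simp add: moebius_inverse)
    ultimately show "\<tau> \<in> (\<Union>A\<in>G. moebius A ` N)" using A by blast
  qed
  moreover have "negligible (\<Union>A\<in>G. moebius A ` N)"
  proof (rule negligible_countable_Union)
    show "countable ((\<lambda>A. moebius A ` N) ` G)" by simp
    fix X assume "X \<in> (\<lambda>A. moebius A ` N) ` G"
    then obtain A where A: "A \<in> G" "X = moebius A ` N" by blast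
    have "moebius A differentiable_on N"
      unfolding differentiable_on_def
    proof
      fix \<tau> assume "\<tau> \<in> N"
      then have "\<tau> \<in> \<H>" using fund_subset_H by (auto simp: N_def)
      from moebius_deriv[OF in_carrier[OF A(1)] this]
      show "moebius A differentiable at \<tau> within N"
        using has_field_derivative_imp_has_derivative differentiableI differentiable_at_withinI by blast
    qed
    then show "negligible X" unfolding A(2) by (intro negligible_differentiable_image_negligible negN) simp_all
  qed
  ultimately have "negligible U" by (rule negligible_subset[rotated])
  moreover have "open U"
  proof -
    have "U = \<H> \<inter> g -` (- {0})" by (auto simp: U_def)
    then show ?thesis
      using continuous_open_preimage[OF holomorphic_on_imp_continuous_on[OF gD(1)] open_H, of "- {0}"] by (simp add: open_Compl)
  qed
  ultimately have "U = {}" using open_not_negligible by blast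
  then show ?thesis using gD(2) by (auto simp: U_def fun_eq_iff)
qed

text \<open>Gram-Schmidt: the next generator is first made orthogonal to the span of the previous ones, and divisions
  by its norm are harmless, because the norm is zero for the zero form only.\<close>

lemma orthogonal_projection:
  assumes "finite B" "B \<subseteq> cusp_forms k G" "f \<in> modular_forms k G"
  shows "\<exists>g\<in>cfun.span B. \<forall>h\<in>cfun.span B. petersson k G (\<lambda>\<tau>. f \<tau> - g \<tau>) h = 0"
  using assms
proof (induction B arbitrary: f)
  case empty
  have "petersson k G f (\<lambda>_. 0) = 0" for f by (simp add: petersson_alt)
  then show ?case by (simp add: zero_fun_def)
next
  case (insert v B)
  have spanS: "cfun.span B \<subseteq> cusp_forms k G"
    using insert.prems(1) subspace_cusp_forms by (intro cfun.span_minimal) auto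
  have v: "v \<in> cusp_forms k G" using insert.prems by simp
  have vm: "v \<in> modular_forms k G" using v by (rule cusp_forms_modular)
  have fm: "f \<in> modular_forms k G" by fact
  obtain p where p: "p \<in> cfun.span B" "\<And>h. h \<in> cfun.span B \<Longrightarrow> petersson k G (\<lambda>\<tau>. v \<tau> - p \<tau>) h = 0"
    using insert.IH[OF _ vm] insert.prems by auto
  obtain q where q: "q \<in> cfun.span B" "\<And>h. h \<in> cfun.span B \<Longrightarrow> petersson k G (\<lambda>\<tau>. f \<tau> - q \<tau>) h = 0"
    using insert.IH[OF _ fm] insert.prems by auto
  define w where "w = (\<lambda>\<tau>. 1 * v \<tau> + (- 1) * p \<tau>)"
  have pS: "p \<in> cusp_forms k G" and qS: "q \<in> cusp_forms k G" using p q spanS by auto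
  note pm = cusp_forms_modular[OF pS] and qm = cusp_forms_modular[OF qS]
  have wS: "w \<in> cusp_forms k G"
    using subspace_cusp_forms v pS unfolding cfun_subspace_iff w_def by blast
  note wm = cusp_forms_modular[OF wS]
  have w_orth: "petersson k G w h = 0" if "h \<in> cfun.span B" for h
    using p(2)[OF that] by (simp add: w_def)
  define t where "t = petersson k G (\<lambda>\<tau>. f \<tau> - q \<tau>) w / petersson k G w w"
  have tw: "t * petersson k G w w = petersson k G (\<lambda>\<tau>. f \<tau> - q \<tau>) w"
  proof (cases "petersson k G w w = 0")
    case True
    then have "w = (\<lambda>_. 0)" by (rule petersson_definite[OF wS])
    then show ?thesis by (simp add: petersson_alt)
  qed (simp add: t_def)
  have fq: "(\<lambda>\<tau>. f \<tau> - q \<tau>) \<in> modular_forms k G"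
    using modular_forms_lincomb(1)[OF fm qm, of 1 "-1"] by simp
  define g where "g = (\<lambda>\<tau>. q \<tau> + t * w \<tau>)"
  have sub: "cfun.span B \<subseteq> cfun.span (insert v B)" by (intro cfun.span_mono) blast
  have span_sub: "cfun.subspace (cfun.span (insert v B))" by (rule cfun.subspace_span)
  have "w \<in> cfun.span (insert v B)"
    unfolding w_def using p(1) sub cfun.span_base[of v "insert v B"] span_sub unfolding cfun_subspace_iff by blast
  then have "(\<lambda>\<tau>. 1 * q \<tau> + t * w \<tau>) \<in> cfun.span (insert v B)"
    using q(1) sub span_sub unfolding cfun_subspace_iff by blast
  then have g_span: "g \<in> cfun.span (insert v B)" by (simp add: g_def)
  have lin: "petersson k G (\<lambda>\<tau>. f \<tau> - g \<tau>) h = petersson k G (\<lambda>\<tau>. f \<tau> - q \<tau>) h - t * petersson k G w h"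
    if "h \<in> cusp_forms k G" for h
    using petersson_lincomb_left[OF fq wm that, of 1 "- t"] by (simp add: g_def algebra_simps)
  have "petersson k G (\<lambda>\<tau>. f \<tau> - g \<tau>) h = 0" if h: "h \<in> cfun.span (insert v B)" for h
  proof -
    obtain c where c: "h - fun_scale c v \<in> cfun.span B" using h unfolding cfun.span_insert by blast
    define b where "b = (\<lambda>\<tau>. 1 * (h - fun_scale c v) \<tau> + c * p \<tau>)"
    have b: "b \<in> cfun.span B"
      unfolding b_def using c p(1) cfun.subspace_span[of B] unfolding cfun_subspace_iff by blast
    have h_eq: "h = (\<lambda>\<tau>. 1 * b \<tau> + c * w \<tau>)"
      by (simp add: b_def w_def fun_scale_def fun_eq_iff algebra_simps)
    have bS: "b \<in> cusp_forms k G" using b spanS by blast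
    have fg: "(\<lambda>\<tau>. f \<tau> - g \<tau>) \<in> modular_forms k G"
      using modular_forms_lincomb(1)[OF fq wm, of 1 "- t"] by (simp add: g_def algebra_simps)
    have "petersson k G (\<lambda>\<tau>. f \<tau> - g \<tau>) b = 0"
      using lin[OF bS] q(2)[OF b] w_orth[OF b] by simp
    moreover have "petersson k G (\<lambda>\<tau>. f \<tau> - g \<tau>) w = 0"
      using lin[OF wS] tw by simp
    ultimately show ?thesis
      unfolding h_eq using petersson_lincomb_right[OF bS wS fg, of 1 c] by simp
  qed
  then show ?case using g_span by blast
qed

lemma subspace_eisenstein_space: "cfun.subspace (eisenstein_space k G)"
  unfolding cfun_subspace_iff
proof (intro conjI ballI allI)
  show "(\<lambda>_. 0) \<in> eisenstein_space k G" by (simp add: eisenstein_space_def petersson_alt)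
  fix f g a b assume "f \<in> eisenstein_space k G" "g \<in> eisenstein_space k G"
  then show "(\<lambda>\<tau>. a * f \<tau> + b * g \<tau>) \<in> eisenstein_space k G"
    by (simp add: eisenstein_space_def modular_forms_lincomb petersson_lincomb_left)
qed

lemma eisenstein_modular: "f \<in> eisenstein_space k G \<Longrightarrow> f \<in> modular_forms k G"
  by (simp add: eisenstein_space_def)

text \<open>Subtracting the orthogonal projection to the cusp forms leaves the values at the cusps unchanged.\<close>

lemma eisenstein_part:
  assumes f: "f \<in> modular_forms k G"
  obtains e where "e \<in> eisenstein_space k G" "\<And>A. A \<in> carrier SL2Z \<Longrightarrow> cusp_value k e A = cusp_value k f A"
proof -
  obtain B where B: "finite B" "B \<subseteq> cusp_forms k G" "cfun.span B = cusp_forms k G"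
    using finitely_generated_cusp_forms by blast
  obtain g where g: "g \<in> cusp_forms k G" "\<And>h. h \<in> cusp_forms k G \<Longrightarrow> petersson k G (\<lambda>\<tau>. f \<tau> - g \<tau>) h = 0"
    using orthogonal_projection[OF B(1,2) f] unfolding B(3) by blast
  note lc = modular_forms_lincomb[OF f cusp_forms_modular[OF g(1)], where a = 1 and b = "- 1"]
  show ?thesis
  proof
    show "(\<lambda>\<tau>. f \<tau> - g \<tau>) \<in> eisenstein_space k G"
      using lc(1) g(2) by (simp add: eisenstein_space_def)
    show "cusp_value k (\<lambda>\<tau>. f \<tau> - g \<tau>) A = cusp_value k f A" if "A \<in> carrier SL2Z" for A
      using lc(2)[OF that] g(1) that by (simp add: cusp_forms_iff)
  qed
qed

text \<open>Such a form is a cusp form that is orthogonal to itself.\<close>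

lemma eisenstein_eq_0:
  assumes "f \<in> eisenstein_space k G" "\<And>A. A \<in> carrier SL2Z \<Longrightarrow> cusp_value k f A = 0"
  shows "f = (\<lambda>_. 0)"
proof -
  have "f \<in> cusp_forms k G" using assms by (simp add: cusp_forms_iff eisenstein_space_def)
  moreover from this have "petersson k G f f = 0" using assms by (simp add: eisenstein_space_def)
  ultimately show ?thesis by (rule petersson_definite)
qed

end

section \<open>Dominated families of holomorphic functions\<close>

text \<open>The exponent \<open>3/2\<close> makes one summable function on pairs dominate the terms of all lattice
  sums below.\<close>

definition int_weight :: "int \<Rightarrow> real" where
  "int_weight n = max 1 \<bar>of_int n\<bar> powr (- 3 / 2)"

lemma int_weight_pos: "int_weight n > 0"
  by (simp add: int_weight_def)

lemma int_weight_summable: "int_weight summable_on UNIV"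
proof -
  have "summable (\<lambda>n. real n powr (- 3 / 2))" by (simp add: summable_real_powr_iff)
  moreover have ev: "eventually (\<lambda>n. max 1 \<bar>real n\<bar> powr (- 3 / 2) = real n powr (- 3 / 2)) sequentially"
    using eventually_gt_at_top[of 0] by eventually_elim auto
  ultimately have s: "summable (\<lambda>n. max 1 \<bar>real n\<bar> powr (- 3 / 2))"
    using summable_cong[OF ev] by simp
  have "(int_weight \<circ> int) summable_on UNIV"
    using s by (intro summable_nonneg_imp_summable_on) (auto simp: int_weight_def o_def)
  then have 1: "int_weight summable_on range int"
    by (subst summable_on_reindex) auto
  have "(int_weight \<circ> (\<lambda>n. - int (Suc n))) = (\<lambda>n. max 1 \<bar>real (Suc n)\<bar> powr (- 3 / 2))"
    by (auto simp: int_weight_def fun_eq_iff add.commute)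
  then have "(int_weight \<circ> (\<lambda>n. - int (Suc n))) summable_on UNIV"
    using s summable_Suc_iff[of "\<lambda>n. max 1 \<bar>real n\<bar> powr (- 3 / 2)"]
    by (simp only:) (intro summable_nonneg_imp_summable_on; simp)
  then have 2: "int_weight summable_on range (\<lambda>n. - int (Suc n))"
    by (subst summable_on_reindex) (auto simp: inj_on_def)
  have U: "(UNIV :: int set) = range int \<union> range (\<lambda>n. - int (Suc n))"
  proof -
    have "x \<in> range int \<union> range (\<lambda>n. - int (Suc n))" for x
      by (cases x) auto
    then show ?thesis by blast
  qed
  have "range int \<inter> range (\<lambda>n. - int (Suc n)) = {}" by auto
  then show ?thesis unfolding U by (intro summable_on_Un_disjoint 1 2)
qed

definition pair_weight :: "int \<times> int \<Rightarrow> real" where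
  "pair_weight = (\<lambda>(c, d). int_weight c * int_weight d)"

lemma pair_weight_nonneg: "pair_weight p \<ge> 0"
  using int_weight_pos by (auto simp: pair_weight_def split_beta intro!: mult_nonneg_nonneg less_imp_le)

lemma pair_weight_summable: "pair_weight summable_on X"
proof -
  obtain s where s: "(int_weight has_sum s) UNIV" using int_weight_summable by (auto simp: summable_on_def)
  have "pair_weight summable_on Sigma UNIV (\<lambda>_. UNIV)"
  proof (rule summable_on_SigmaI)
    show "((\<lambda>d. pair_weight (c, d)) has_sum int_weight c * s) UNIV" for c
      using has_sum_cmult_right[OF s, of "int_weight c"] by (simp add: pair_weight_def)
    show "(\<lambda>c. int_weight c * s) summable_on UNIV"
      using int_weight_summable by (rule summable_on_cmult_left)
  qed (rule pair_weight_nonneg)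
  then show ?thesis using summable_on_subset_banach by (metis UNIV_Times_UNIV subset_UNIV)
qed

lemma int_weight_ge:
  assumes "\<bar>of_int c\<bar> \<le> m" "1 \<le> m" shows "m powr (- 3 / 2) \<le> int_weight c"
  unfolding int_weight_def using assms by (intro powr_mono2') auto

lemma pair_weight_ge_cube:
  assumes "(c, d) \<noteq> (0, 0)"
  shows "1 / max \<bar>of_int c\<bar> \<bar>of_int d\<bar> ^ 3 \<le> pair_weight (c, d)"
proof -
  define m where "m = max \<bar>real_of_int c\<bar> \<bar>of_int d\<bar>"
  have m: "1 \<le> m" using assms by (auto simp: m_def le_max_iff_disj)
  have "1 / m ^ 3 = m powr (- 3 / 2) * m powr (- 3 / 2)"
    using m by (simp add: powr_add[symmetric] powr_minus_divide flip: powr_numeral)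
  also have "\<dots> \<le> int_weight c * int_weight d"
    by (intro mult_mono int_weight_ge m) (auto simp: m_def int_weight_def)
  finally show ?thesis by (simp add: m_def pair_weight_def)
qed

text \<open>Domination on vertical strips, rather than on compact sets only, allows termwise limits as the imaginary
  part tends to infinity.\<close>

locale dominated_family =
  fixes t :: "'i \<Rightarrow> complex \<Rightarrow> complex" and I :: "'i set"
  assumes hol: "\<And>i. i \<in> I \<Longrightarrow> t i holomorphic_on \<H>"
    and dominated: "\<And>a b. a \<ge> 0 \<Longrightarrow> b > 0 \<Longrightarrow>
      \<exists>M. M summable_on I \<and> (\<forall>i\<in>I. \<forall>\<tau>\<in>strip a b. norm (t i \<tau>) \<le> M i)"
begin

lemma summable_term: assumes "\<tau> \<in> \<H>" shows "(\<lambda>i. t i \<tau>) summable_on I"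
proof -
  have "\<tau> \<in> strip \<bar>Re \<tau>\<bar> (Im \<tau>)" "Im \<tau> > 0" using assms by (auto simp: strip_def in_H_iff)
  then obtain M where M: "M summable_on I" "\<And>i. i \<in> I \<Longrightarrow> norm (t i \<tau>) \<le> M i"
    using dominated[of "\<bar>Re \<tau>\<bar>" "Im \<tau>"] by auto
  have "(\<lambda>i. norm (t i \<tau>)) summable_on I"
    using M by (intro summable_on_comparison_test[OF M(1)]) auto
  then show ?thesis by (rule abs_summable_summable)
qed

lemma holomorphic_infsum: "(\<lambda>\<tau>. \<Sum>\<^sub>\<infinity>i\<in>I. t i \<tau>) holomorphic_on \<H>"
proof (rule holomorphic_onI)
  fix z assume z: "z \<in> \<H>"
  define r where "r = Im z / 2"
  have r: "r > 0" using z by (simp add: r_def in_H_iff)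
  have sub: "cball z r \<subseteq> strip (\<bar>Re z\<bar> + r) r"
  proof
    fix w assume "w \<in> cball z r"
    then have w: "norm (z - w) \<le> r" by (simp add: dist_norm)
    have "\<bar>Re (z - w)\<bar> \<le> r" "\<bar>Im (z - w)\<bar> \<le> r"
      using abs_Re_le_cmod[of "z - w"] abs_Im_le_cmod[of "z - w"] w by linarith+
    then have "\<bar>Re w\<bar> \<le> \<bar>Re z\<bar> + r" "Im w \<ge> Im z - r" 
      by simp_all
    then show "w \<in> strip (\<bar>Re z\<bar> + r) r" by (simp add: strip_def r_def)
  qed
  obtain M where M: "M summable_on I" "\<And>i \<tau>. i \<in> I \<Longrightarrow> \<tau> \<in> strip (\<bar>Re z\<bar> + r) r \<Longrightarrow> norm (t i \<tau>) \<le> M i"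
    using dominated[of "\<bar>Re z\<bar> + r" r] r by auto
  have ul: "uniform_limit (cball z r) (\<lambda>J \<tau>. \<Sum>i\<in>J. t i \<tau>) (\<lambda>\<tau>. \<Sum>\<^sub>\<infinity>i\<in>I. t i \<tau>) (finite_subsets_at_top I)"
    using M sub by (intro Weierstrass_m_test_general) auto
  have cH: "cball z r \<subseteq> \<H>" using sub strip_subset_H[OF r] by blast
  have "eventually (\<lambda>J. continuous_on (cball z r) (\<lambda>\<tau>. \<Sum>i\<in>J. t i \<tau>) \<and> (\<lambda>\<tau>. \<Sum>i\<in>J. t i \<tau>) holomorphic_on ball z r)
      (finite_subsets_at_top I)"
  proof (rule eventually_finite_subsets_at_top_weakI)
    fix J assume J: "finite J" "J \<subseteq> I"
    have "(\<lambda>\<tau>. \<Sum>i\<in>J. t i \<tau>) holomorphic_on \<H>" using J hol by (intro holomorphic_on_sum) auto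
    then show "continuous_on (cball z r) (\<lambda>\<tau>. \<Sum>i\<in>J. t i \<tau>) \<and> (\<lambda>\<tau>. \<Sum>i\<in>J. t i \<tau>) holomorphic_on ball z r"
      using cH ball_subset_cball[of z r]
      by (meson continuous_on_subset holomorphic_on_imp_continuous_on holomorphic_on_subset order_trans)
  qed
  then have "(\<lambda>\<tau>. \<Sum>\<^sub>\<infinity>i\<in>I. t i \<tau>) holomorphic_on ball z r"
    using holomorphic_uniform_limit[OF _ ul] by (metis finite_subsets_at_top_neq_bot)
  then show "(\<lambda>\<tau>. \<Sum>\<^sub>\<infinity>i\<in>I. t i \<tau>) field_differentiable at z within \<H>"
    using r by (intro field_differentiable_at_within[OF holomorphic_on_imp_differentiable_at]) auto
qed

lemma tendsto_infsum_strip: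
  assumes L: "\<And>i. i \<in> I \<Longrightarrow> (t i \<longlongrightarrow> L i) at_ioo" and a: "a \<ge> 0"
  shows "((\<lambda>\<tau>. \<Sum>\<^sub>\<infinity>i\<in>I. t i \<tau>) \<longlongrightarrow> (\<Sum>\<^sub>\<infinity>i\<in>I. L i)) (inf at_ioo (principal (strip a 1)))"
proof -
  let ?F = "inf at_ioo (principal (strip a 1))"
  obtain M where M: "M summable_on I" "\<And>i \<tau>. i \<in> I \<Longrightarrow> \<tau> \<in> strip a 1 \<Longrightarrow> norm (t i \<tau>) \<le> M i"
    using dominated[of a 1] a by auto
  have L': "(t i \<longlongrightarrow> L i) ?F" if "i \<in> I" for i
    using L[OF that] by (rule tendsto_mono[rotated]) simp
  have nb: "?F \<noteq> bot"
  proof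
    assume "?F = bot"
    then have "eventually (\<lambda>_. False) ?F" by simp
    then obtain Y where "\<And>\<tau>. Im \<tau> \<ge> Y \<Longrightarrow> \<tau> \<notin> strip a 1"
      unfolding eventually_inf_principal eventually_at_ioo by auto
    from this[of "Complex 0 (max Y 1)"] show False using a by (simp add: strip_def)
  qed
  have evS: "eventually (\<lambda>\<tau>. \<tau> \<in> strip a 1) ?F" by (simp add: eventually_inf_principal)
  have normL: "norm (L i) \<le> M i" if "i \<in> I" for i
    by (rule tendsto_upperbound[OF tendsto_norm[OF L'[OF that]] _ nb])
      (use evS in eventually_elim, use M that in auto)
  have "(\<lambda>i. norm (L i)) summable_on I"
    using normL by (intro summable_on_comparison_test[OF M(1)]) auto
  then have "(L has_sum (\<Sum>\<^sub>\<infinity>i\<in>I. L i)) I" by (rule has_sum_infsum[OF abs_summable_summable])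
  then have sL: "((\<lambda>J. \<Sum>i\<in>J. L i) \<longlongrightarrow> (\<Sum>\<^sub>\<infinity>i\<in>I. L i)) (finite_subsets_at_top I)"
    by (simp add: has_sum_def)
  have ul: "uniform_limit (strip a 1) (\<lambda>J \<tau>. \<Sum>i\<in>J. t i \<tau>) (\<lambda>\<tau>. \<Sum>\<^sub>\<infinity>i\<in>I. t i \<tau>) (finite_subsets_at_top I)"
    using M by (intro Weierstrass_m_test_general) auto
  show ?thesis
  proof (rule swap_uniform_limit'[OF _ sL ul evS])
    show "\<forall>\<^sub>F J in finite_subsets_at_top I. ((\<lambda>\<tau>. \<Sum>i\<in>J. t i \<tau>) \<longlongrightarrow> (\<Sum>i\<in>J. L i)) ?F"
    proof (rule eventually_finite_subsets_at_top_weakI)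
      fix J assume "finite J" "J \<subseteq> I"
      then show "((\<lambda>\<tau>. \<Sum>i\<in>J. t i \<tau>) \<longlongrightarrow> (\<Sum>i\<in>J. L i)) ?F"
        by (intro tendsto_sum) (use L' in blast)
    qed
  qed simp
qed

end

text \<open>Termwise limits of lattice sums are confined to a strip; periodicity lifts this restriction.\<close>

lemma periodic_tendsto_at_ioo:
  fixes f :: "complex \<Rightarrow> complex"
  assumes N: "N \<ge> 1" and per: "\<And>\<tau> n. \<tau> \<in> \<H> \<Longrightarrow> f (\<tau> + of_nat N * of_int n) = f \<tau>"
    and lim: "(f \<longlongrightarrow> L) (inf at_ioo (principal (strip (real N) 1)))"
  shows "(f \<longlongrightarrow> L) at_ioo"
proof (rule tendstoI)
  fix e :: real assume "e > 0"
  with lim have "eventually (\<lambda>\<tau>. dist (f \<tau>) L < e) (inf at_ioo (principal (strip (real N) 1)))"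
    by (rule tendstoD)
  then obtain Y where Y: "\<And>\<tau>. Im \<tau> \<ge> Y \<Longrightarrow> \<tau> \<in> strip (real N) 1 \<Longrightarrow> dist (f \<tau>) L < e"
    unfolding eventually_inf_principal eventually_at_ioo by auto
  have "dist (f \<tau>) L < e" if "Im \<tau> \<ge> max Y 1" for \<tau>
  proof -
    obtain n :: int where "0 \<le> Re \<tau> + real N * of_int n" "Re \<tau> + real N * of_int n \<le> real N"
      using exists_period_reduction[OF N] by blast
    then have "dist (f (\<tau> + of_nat N * of_int n)) L < e"
      using that by (intro Y) (auto simp: strip_def)
    then show ?thesis using per[of \<tau> n] that by (simp add: in_H_iff)
  qed
  then show "eventually (\<lambda>\<tau>. dist (f \<tau>) L < e) at_ioo" unfolding eventually_at_ioo by blast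
qed

section \<open>Eisenstein series of weight at least three\<close>

definition lin :: "int \<times> int \<Rightarrow> complex \<Rightarrow> complex" where
  "lin = (\<lambda>(c, d) \<tau>. of_int c * \<tau> + of_int d)"

definition row_mult :: "int \<times> int \<Rightarrow> int ^ 2 ^ 2 \<Rightarrow> int \<times> int" where
  "row_mult = (\<lambda>(c, d) A. (c * A$1$1 + d * A$2$1, c * A$1$2 + d * A$2$2))"

lemma lin_pair: "lin (c, d) \<tau> = of_int c * \<tau> + of_int d"
  by (simp add: lin_def)

lemma lin_nonzero: "\<tau> \<in> \<H> \<Longrightarrow> p \<noteq> (0, 0) \<Longrightarrow> lin p \<tau> \<noteq> 0"
  using linear_form_nonzero by (cases p) (simp add: lin_pair)

lemma lin_holomorphic [holomorphic_intros]: "lin p holomorphic_on X"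
  unfolding lin_def by (cases p) (auto intro!: holomorphic_intros)

lemma row_mult_mult: "row_mult (row_mult p A) B = row_mult p (A ** B)"
  by (cases p) (simp add: row_mult_def algebra_simps)

lemma row_mult_one [simp]: "row_mult p (mat 1) = p"
  by (cases p) (simp add: row_mult_def)

lemma row_mult_inv:
  assumes "A \<in> carrier SL2Z"
  shows "row_mult (row_mult p A) (SL2Z_inv A) = p" "row_mult (row_mult p (SL2Z_inv A)) A = p"
  using SL2Z_inv_cancel[OF assms] by (simp_all add: row_mult_mult)

lemma row_mult_zero [simp]: "row_mult (0, 0) A = (0, 0)"
  by (simp add: row_mult_def)

lemma row_mult_eq_zero_iff [simp]:
  assumes "A \<in> carrier SL2Z" shows "row_mult p A = (0, 0) \<longleftrightarrow> p = (0, 0)"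
  by (metis row_mult_inv(1)[OF assms] row_mult_zero)

lemma inj_row_mult: "A \<in> carrier SL2Z \<Longrightarrow> inj_on (\<lambda>p. row_mult p A) X"
  by (rule inj_on_inverseI[of _ "\<lambda>p. row_mult p (SL2Z_inv A)"]) (rule row_mult_inv)

lemma lin_moebius:
  assumes "A \<in> carrier SL2Z" "\<tau> \<in> \<H>"
  shows "lin p (moebius A \<tau>) = lin (row_mult p A) \<tau> / aut_factor A \<tau>"
  using aut_factor_nonzero[OF assms]
  by (cases p) (simp add: lin_def row_mult_def moebius_def field_simps, simp add: aut_factor_def field_simps)

lemma filterlim_norm_lin:
  assumes "c \<noteq> 0" shows "filterlim (\<lambda>\<tau>. norm (lin (c, d) \<tau>)) at_top at_ioo"
proof (rule filterlim_at_top_mono)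
  show "filterlim Im at_top at_ioo" by (rule filterlim_filtercomap)
  have "Im \<tau> \<le> norm (lin (c, d) \<tau>)" if "Im \<tau> \<ge> 0" for \<tau>
  proof -
    have "1 * Im \<tau> \<le> \<bar>of_int c\<bar> * Im \<tau>" using assms that by (intro mult_right_mono) auto
    also have "\<dots> = \<bar>Im (lin (c, d) \<tau>)\<bar>" using that by (simp add: lin_pair abs_mult)
    also have "\<dots> \<le> norm (lin (c, d) \<tau>)" by (rule abs_Im_le_cmod)
    finally show ?thesis by simp
  qed
  then show "eventually (\<lambda>\<tau>. Im \<tau> \<le> norm (lin (c, d) \<tau>)) at_ioo"
    unfolding eventually_at_ioo by blast
qed

lemma tendsto_inverse_lin_power:
  assumes "k > 0"
  shows "((\<lambda>\<tau>. 1 / lin (c, d) \<tau> ^ k) \<longlongrightarrow> (if c = 0 then 1 / of_int d ^ k else 0)) at_ioo"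
proof (cases "c = 0")
  case False
  have "((\<lambda>\<tau>. norm (1 / lin (c, d) \<tau> ^ k)) \<longlongrightarrow> 0) at_ioo"
    unfolding norm_divide norm_power norm_one
    by (intro tendsto_divide_0[OF tendsto_const] filterlim_at_top_imp_at_infinity
      filterlim_pow_at_top assms filterlim_norm_lin False)
  then show ?thesis using False tendsto_norm_zero_cancel by simp
qed (simp add: lin_pair)

lemma strip_lin_lower_bound:
  assumes "b > 0" "a \<ge> 0"
  obtains \<delta> where "\<delta> > 0"
    "\<And>\<tau> c d. \<tau> \<in> strip a b \<Longrightarrow> \<delta> * max \<bar>of_int c\<bar> \<bar>of_int d\<bar> \<le> norm (lin (c, d) \<tau>)"
  using linear_form_lower_bound[OF assms] unfolding lin_pair by blast

lemma dominated_lin_power: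
  assumes "k \<ge> 3" "(0, 0) \<notin> X"
  shows "dominated_family (\<lambda>p \<tau>. 1 / lin p \<tau> ^ k) X"
proof
  fix p assume "p \<in> X"
  then have "p \<noteq> (0, 0)" using assms by auto
  then show "(\<lambda>\<tau>. 1 / lin p \<tau> ^ k) holomorphic_on \<H>"
    by (intro holomorphic_intros) (auto simp: lin_nonzero)
next
  fix a b :: real assume "a \<ge> 0" "b > 0"
  then obtain \<delta> where \<delta>: "\<delta> > 0"
    and low: "\<And>\<tau> c d. \<tau> \<in> strip a b \<Longrightarrow> \<delta> * max \<bar>of_int c\<bar> \<bar>of_int d\<bar> \<le> norm (lin (c, d) \<tau>)"
    using strip_lin_lower_bound by blast
  show "\<exists>M. M summable_on X \<and> (\<forall>p\<in>X. \<forall>\<tau>\<in>strip a b. norm (1 / lin p \<tau> ^ k) \<le> M p)"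
  proof (intro exI conjI ballI)
    show "(\<lambda>p. (1 / \<delta> ^ k) * pair_weight p) summable_on X"
      by (intro summable_on_cmult_right pair_weight_summable)
    fix p \<tau> assume p: "p \<in> X" and \<tau>: "\<tau> \<in> strip a b"
    obtain c d where cd: "p = (c, d)" by (cases p)
    have nz: "(c, d) \<noteq> (0, 0)" using p assms cd by auto
    define m where "m = max \<bar>real_of_int c\<bar> \<bar>of_int d\<bar>"
    have m: "1 \<le> m" using nz by (auto simp: m_def le_max_iff_disj)
    have "\<delta> * m \<le> norm (lin p \<tau>)" using low[OF \<tau>] by (simp add: m_def cd)
    then have "(\<delta> * m) ^ k \<le> norm (lin p \<tau>) ^ k" using \<delta> m by (intro power_mono) auto
    moreover have "0 < (\<delta> * m) ^ k" using \<delta> m by simp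
    ultimately have "norm (1 / lin p \<tau> ^ k) \<le> 1 / (\<delta> * m) ^ k"
      unfolding norm_divide norm_power norm_one by (intro divide_left_mono mult_pos_pos) linarith+
    also have "\<dots> = (1 / \<delta> ^ k) * (1 / m ^ k)" by (simp add: power_mult_distrib)
    also have "\<dots> \<le> (1 / \<delta> ^ k) * (1 / m ^ 3)"
      using m \<delta> assms(1) by (intro mult_left_mono divide_left_mono power_increasing) auto
    also have "\<dots> \<le> (1 / \<delta> ^ k) * pair_weight p"
      using pair_weight_ge_cube[OF nz] \<delta> by (intro mult_left_mono) (auto simp: m_def cd)
    finally show "norm (1 / lin p \<tau> ^ k) \<le> (1 / \<delta> ^ k) * pair_weight p" .
  qed
qed

definition eis :: "nat \<Rightarrow> (int \<times> int) set \<Rightarrow> complex \<Rightarrow> complex" where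
  "eis k X \<tau> = (if \<tau> \<in> \<H> then \<Sum>\<^sub>\<infinity>p\<in>X. 1 / lin p \<tau> ^ k else 0)"

lemma slash_eis:
  assumes A: "A \<in> carrier SL2Z" and \<tau>: "\<tau> \<in> \<H>"
  shows "slash k (eis k X) A \<tau> = eis k ((\<lambda>p. row_mult p A) ` X) \<tau>"
proof -
  have "slash k (eis k X) A \<tau> = (\<Sum>\<^sub>\<infinity>p\<in>X. 1 / lin p (moebius A \<tau>) ^ k) * (1 / aut_factor A \<tau> ^ k)"
    using assms by (simp add: slash_def eis_def)
  also have "\<dots> = (\<Sum>\<^sub>\<infinity>p\<in>X. 1 / lin p (moebius A \<tau>) ^ k * (1 / aut_factor A \<tau> ^ k))"
    using aut_factor_nonzero[OF assms] by (intro infsum_cmult_left'[symmetric])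
  also have "\<dots> = (\<Sum>\<^sub>\<infinity>p\<in>X. 1 / lin (row_mult p A) \<tau> ^ k)"
    using aut_factor_nonzero[OF assms]
    by (intro infsum_cong) (simp add: lin_moebius[OF assms] power_divide)
  also have "\<dots> = (\<Sum>\<^sub>\<infinity>p\<in>(\<lambda>p. row_mult p A) ` X. 1 / lin p \<tau> ^ k)"
    by (subst infsum_reindex[OF inj_row_mult[OF A]]) (simp add: o_def)
  finally show ?thesis using \<tau> by (simp add: eis_def)
qed

definition bottom_row :: "int ^ 2 ^ 2 \<Rightarrow> int \<times> int" where
  "bottom_row A = (A$2$1, A$2$2)"

lemma row_mult_bottom_row: "row_mult (bottom_row A) B = bottom_row (A ** B)"
  by (simp add: row_mult_def bottom_row_def)

lemma bottom_row_nonzero: "A \<in> carrier SL2Z \<Longrightarrow> bottom_row A \<noteq> (0, 0)"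
  by (auto simp: bottom_row_def SL2Z_iff)

lemma bottom_row_eq_unit_iff:
  assumes "A \<in> carrier SL2Z"
  shows "bottom_row A = (0, 1) \<longleftrightarrow> (\<exists>n. A = transl n)"
    and "bottom_row A = (0, - 1) \<longleftrightarrow> (\<exists>n. A = - transl n)"
proof -
  have "A = transl (A$1$2)" if "bottom_row A = (0, 1)"
    using that assms by (simp add: bottom_row_def SL2Z_iff mat2_eq_iff)
  then show "bottom_row A = (0, 1) \<longleftrightarrow> (\<exists>n. A = transl n)" by (auto simp: bottom_row_def)
  have "A = - transl (- A$1$2)" if "bottom_row A = (0, - 1)"
    using that assms by (auto simp: bottom_row_def SL2Z_iff mat2_eq_iff)
  then show "bottom_row A = (0, - 1) \<longleftrightarrow> (\<exists>n. A = - transl n)" by (auto simp: bottom_row_def)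
qed

lemma infsum_eis_limits:
  assumes X: "X \<subseteq> bottom_row ` carrier SL2Z"
  shows "(\<Sum>\<^sub>\<infinity>p\<in>X. if fst p = 0 then 1 / of_int (snd p) ^ k else 0) =
    ((if (0, 1) \<in> X then 1 else 0) + (if (0, - 1) \<in> X then (- 1) ^ k else 0) :: complex)"
proof -
  let ?L = "\<lambda>p::int\<times>int. (if fst p = 0 then 1 / of_int (snd p) ^ k else 0) :: complex"
  have "?L p = 0" if "p \<in> X - X \<inter> {(0, 1), (0, - 1)}" for p
  proof -
    have "p \<in> bottom_row ` carrier SL2Z" using that by (intro subsetD[OF X]) simp
    then obtain A where A: "A \<in> carrier SL2Z" "p = bottom_row A" by (elim imageE)
    have "fst p \<noteq> 0"
    proof
      assume "fst p = 0"
      then have "A$2$1 = 0" "A$1$1 * A$2$2 = 1" using A by (auto simp: bottom_row_def SL2Z_iff)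
      then show False using that A by (auto simp: bottom_row_def zmult_eq_1_iff)
    qed
    then show ?thesis by simp
  qed
  then have "(\<Sum>\<^sub>\<infinity>p\<in>X. ?L p) = (\<Sum>\<^sub>\<infinity>p\<in>X \<inter> {(0, 1), (0, - 1)}. ?L p)"
    by (intro infsum_cong_neutral) auto
  also have "\<dots> = (\<Sum>p\<in>X \<inter> {(0, 1), (0, - 1)}. ?L p)" by (intro infsum_finite) auto
  also have "\<dots> = (\<Sum>p\<in>{(0, 1), (0, - 1)}. if p \<in> X then ?L p else 0)"
    by (subst Int_commute, subst sum.inter_restrict) auto
  also have "\<dots> = (if (0, 1) \<in> X then 1 else 0) + (if (0, - 1) \<in> X then (- 1) ^ k else 0)"
    by (cases "even k") auto
  finally show ?thesis .
qed

context congruence_group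
begin

text \<open>The orbit under \<open>G\<close> of the bottom row of \<open>D\<close>. Its series belongs to the cusp of the inverse of \<open>D\<close>.\<close>

definition eis_rows :: "int ^ 2 ^ 2 \<Rightarrow> (int \<times> int) set" where
  "eis_rows D = (\<lambda>C. bottom_row (D ** C)) ` G"

lemma eis_rows_mult: "(\<lambda>p. row_mult p A) ` eis_rows D = (\<lambda>C. bottom_row (D ** C ** A)) ` G"
  by (simp add: eis_rows_def image_image row_mult_bottom_row)

lemma eis_rows_invariant:
  assumes "A \<in> G" shows "(\<lambda>p. row_mult p A) ` eis_rows D = eis_rows D"
proof (intro equalityI subsetI)
  fix x assume "x \<in> (\<lambda>p. row_mult p A) ` eis_rows D"
  then obtain C where "C \<in> G" "x = bottom_row (D ** (C ** A))"
    by (auto simp: eis_rows_mult matrix_mul_assoc)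
  then show "x \<in> eis_rows D" using assms by (auto simp: eis_rows_def)
next
  fix x assume "x \<in> eis_rows D"
  then obtain C where C: "C \<in> G" "x = bottom_row (D ** C)" by (auto simp: eis_rows_def)
  then have "x = bottom_row (D ** (C ** SL2Z_inv A) ** A)"
    using assms by (simp add: matrix_mul_assoc SL2Z_inv_cancel_right)
  moreover have "C ** SL2Z_inv A \<in> G" using C assms by auto
  ultimately show "x \<in> (\<lambda>p. row_mult p A) ` eis_rows D" unfolding eis_rows_mult by blast
qed

text \<open>Letting the imaginary part tend to infinity in each summand leaves only the rows \<open>(0, 1)\<close> and
  \<open>(0, -1)\<close>, and these occur only at the cusp that the series belongs to.\<close>

lemma eis_modular:
  assumes k: "k \<ge> 3" and D: "D \<in> carrier SL2Z"
  shows "eis k (eis_rows D) \<in> modular_forms k G"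
    and "A \<in> carrier SL2Z \<Longrightarrow> cusp_value k (eis k (eis_rows D)) A =
      (if \<exists>C\<in>G. \<exists>n. D ** C ** A = transl n then 1 else 0) +
      (if \<exists>C\<in>G. \<exists>n. D ** C ** A = - transl n then (- 1) ^ k else 0)"
proof -
  let ?f = "eis k (eis_rows D)"
  have inv: "\<forall>A\<in>G. \<forall>\<tau>\<in>\<H>. slash k ?f A \<tau> = ?f \<tau>"
    by (simp add: slash_eis eis_rows_invariant)
  have hol: "eis k X holomorphic_on \<H>" if "(0, 0) \<notin> X" for X
  proof -
    interpret dominated_family "\<lambda>p \<tau>. 1 / lin p \<tau> ^ k" X by (rule dominated_lin_power[OF k that])
    show ?thesis by (rule holomorphic_transform[OF holomorphic_infsum]) (simp add: eis_def)
  qed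
  have lim: "(slash k ?f A \<longlongrightarrow> (if \<exists>C\<in>G. \<exists>n. D ** C ** A = transl n then 1 else 0) +
      (if \<exists>C\<in>G. \<exists>n. D ** C ** A = - transl n then (- 1) ^ k else 0)) at_ioo"
    if A: "A \<in> carrier SL2Z" for A
  proof -
    define X where "X = (\<lambda>p. row_mult p A) ` eis_rows D"
    have X: "X \<subseteq> bottom_row ` carrier SL2Z" unfolding X_def eis_rows_mult using A D by auto
    have X0: "(0, 0) \<notin> X"
    proof
      assume "(0, 0) \<in> X"
      then have "(0, 0) \<in> bottom_row ` carrier SL2Z" by (rule subsetD[OF X])
      then show False using bottom_row_nonzero by (metis imageE)
    qed
    interpret dominated_family "\<lambda>p \<tau>. 1 / lin p \<tau> ^ k" X by (rule dominated_lin_power[OF k X0])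
    have "((\<lambda>\<tau>. \<Sum>\<^sub>\<infinity>p\<in>X. 1 / lin p \<tau> ^ k) \<longlongrightarrow>
        (\<Sum>\<^sub>\<infinity>p\<in>X. if fst p = 0 then 1 / of_int (snd p) ^ k else 0)) (inf at_ioo (principal (strip (real level) 1)))"
    proof (rule tendsto_infsum_strip)
      show "((\<lambda>\<tau>. 1 / lin p \<tau> ^ k) \<longlongrightarrow> (if fst p = 0 then 1 / of_int (snd p) ^ k else 0)) at_ioo" for p
        using tendsto_inverse_lin_power[of k "fst p" "snd p"] k by simp
    qed simp
    also have "(\<Sum>\<^sub>\<infinity>p\<in>X. if fst p = 0 then 1 / of_int (snd p) ^ k else 0) =
      ((if (0, 1) \<in> X then 1 else 0) + (if (0, - 1) \<in> X then (- 1) ^ k else 0) :: complex)"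
      by (rule infsum_eis_limits[OF X])
    also have "(0, 1) \<in> X \<longleftrightarrow> (\<exists>C\<in>G. \<exists>n. D ** C ** A = transl n)"
    proof -
      have "(0, 1) \<in> X \<longleftrightarrow> (\<exists>C\<in>G. bottom_row (D ** C ** A) = (0, 1))"
        unfolding X_def eis_rows_mult by (auto simp: image_iff eq_commute)
      also have "\<dots> \<longleftrightarrow> (\<exists>C\<in>G. \<exists>n. D ** C ** A = transl n)"
        using A D by (intro bex_cong refl bottom_row_eq_unit_iff(1)) auto
      finally show ?thesis .
    qed
    also have "(0, - 1) \<in> X \<longleftrightarrow> (\<exists>C\<in>G. \<exists>n. D ** C ** A = - transl n)"
    proof -
      have "(0, - 1) \<in> X \<longleftrightarrow> (\<exists>C\<in>G. bottom_row (D ** C ** A) = (0, - 1))"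
        unfolding X_def eis_rows_mult by (auto simp: image_iff eq_commute)
      also have "\<dots> \<longleftrightarrow> (\<exists>C\<in>G. \<exists>n. D ** C ** A = - transl n)"
        using A D by (intro bex_cong refl bottom_row_eq_unit_iff(2)) auto
      finally show ?thesis .
    qed
    finally have *: "((\<lambda>\<tau>. \<Sum>\<^sub>\<infinity>p\<in>X. 1 / lin p \<tau> ^ k) \<longlongrightarrow> (if \<exists>C\<in>G. \<exists>n. D ** C ** A = transl n then 1 else 0) +
      (if \<exists>C\<in>G. \<exists>n. D ** C ** A = - transl n then (- 1) ^ k else 0)) (inf at_ioo (principal (strip (real level) 1)))" .
    show ?thesis
    proof (rule periodic_tendsto_at_ioo[OF level(1)])
      show "slash k ?f A (\<tau> + of_nat level * of_int n) = slash k ?f A \<tau>" if "\<tau> \<in> \<H>" for \<tau> n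
        using level_dvd_transl_invariant[OF inv A that, of "int level * n"] by simp
      show "(slash k ?f A \<longlongrightarrow> (if \<exists>C\<in>G. \<exists>n. D ** C ** A = transl n then 1 else 0) +
          (if \<exists>C\<in>G. \<exists>n. D ** C ** A = - transl n then (- 1) ^ k else 0)) (inf at_ioo (principal (strip (real level) 1)))"
      proof (rule Lim_transform_eventually[OF *])
        have "(\<Sum>\<^sub>\<infinity>p\<in>X. 1 / lin p \<tau> ^ k) = slash k ?f A \<tau>" if "\<tau> \<in> \<H>" for \<tau>
          using slash_eis[OF A that, of k "eis_rows D"] that by (simp add: X_def eis_def)
        then show "\<forall>\<^sub>F \<tau> in inf at_ioo (principal (strip (real level) 1)). (\<Sum>\<^sub>\<infinity>p\<in>X. 1 / lin p \<tau> ^ k) = slash k ?f A \<tau>"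
          using strip_subset_H[of 1] by (auto simp: eventually_inf_principal subset_iff)
      qed
    qed
  qed
  have "(0, 0) \<notin> eis_rows D"
    unfolding eis_rows_def using bottom_row_nonzero[OF SL2Z_closed[OF D in_carrier]] by (metis (no_types, lifting) imageE)
  then have "?f holomorphic_on \<H>" by (rule hol)
  moreover have "\<forall>A\<in>carrier SL2Z. \<exists>L. (slash k ?f A \<longlongrightarrow> L) at_ioo" using lim by blast
  ultimately show "?f \<in> modular_forms k G"
    unfolding modular_forms_iff using inv by (simp add: eis_def)
  show "A \<in> carrier SL2Z \<Longrightarrow> cusp_value k (eis k (eis_rows D)) A =
      (if \<exists>C\<in>G. \<exists>n. D ** C ** A = transl n then 1 else 0) +
      (if \<exists>C\<in>G. \<exists>n. D ** C ** A = - transl n then (- 1) ^ k else 0)"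
    by (rule cusp_value_eqI[OF lim])
qed

end

section \<open>Values of the Weierstrass function at torsion points\<close>

definition shift :: "int \<Rightarrow> int \<times> int \<Rightarrow> int \<times> int \<Rightarrow> int \<times> int" where
  "shift N v w = (fst v + N * fst w, snd v + N * snd w)"

lemma shift_sel [simp]: "fst (shift N v w) = fst v + N * fst w" "snd (shift N v w) = snd v + N * snd w"
  by (simp_all add: shift_def)

text \<open>The pair \<open>v\<close> stands for the torsion point \<open>(fst v * \<tau> + snd v) / N\<close> modulo the lattice.\<close>

definition torsion_zero :: "int \<Rightarrow> int \<times> int \<Rightarrow> bool" where
  "torsion_zero N v \<longleftrightarrow> N dvd fst v \<and> N dvd snd v"

lemma torsion_zero_shift [simp]: "torsion_zero N (shift N v w) \<longleftrightarrow> torsion_zero N v"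
  by (simp add: torsion_zero_def dvd_add_left_iff)

lemma shift_nonzero: "\<not> torsion_zero N v \<Longrightarrow> shift N v w \<noteq> (0, 0)"
proof
  assume "\<not> torsion_zero N v" "shift N v w = (0, 0)"
  then have "fst v = N * (- fst w)" "snd v = N * (- snd w)" by (simp_all add: shift_def algebra_simps)
  with \<open>\<not> torsion_zero N v\<close> show False unfolding torsion_zero_def by (metis dvd_triv_left)
qed

lemma shift_shift: "shift N (shift N v u) w = shift N v (u + w)"
  by (simp add: shift_def algebra_simps)

lemma inj_shift: "N \<noteq> 0 \<Longrightarrow> inj_on (shift N v) X"
  by (auto simp: inj_on_def shift_def prod_eq_iff)

lemma row_mult_shift: "row_mult (shift N v w) A = shift N (row_mult v A) (row_mult w A)"
  by (cases v; cases w) (simp add: row_mult_def shift_def algebra_simps)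

lemma torsion_zero_row_mult:
  assumes "A \<in> carrier SL2Z" shows "torsion_zero N (row_mult v A) \<longleftrightarrow> torsion_zero N v"
proof -
  have *: "torsion_zero N (row_mult v A)" if "torsion_zero N v" for v A
    using that by (cases v) (auto simp: torsion_zero_def row_mult_def)
  show ?thesis using *[of v A] *[of "row_mult v A" "SL2Z_inv A"] row_mult_inv[OF assms] by auto
qed

text \<open>Up to the factor \<open>N\<^sup>2\<close>, the sum of these terms over \<open>w\<close> is the Weierstrass function of the lattice
  \<open>\<int>\<tau> + \<int>\<close> at the \<open>N\<close>-torsion point with coordinates \<open>v\<close>.\<close>

definition wp_term :: "int \<Rightarrow> int \<times> int \<Rightarrow> int \<times> int \<Rightarrow> complex \<Rightarrow> complex" where
  "wp_term N v w \<tau> = 1 / lin (shift N v w) \<tau> ^ 2 - (if w = (0, 0) then 0 else 1 / lin (shift N (0, 0) w) \<tau> ^ 2)"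

definition wp :: "int \<Rightarrow> int \<times> int \<Rightarrow> complex \<Rightarrow> complex" where
  "wp N v \<tau> = (if \<tau> \<in> \<H> then \<Sum>\<^sub>\<infinity>w. wp_term N v w \<tau> else 0)"

text \<open>The modular group permutes the lattice, so it acts on the torsion points.\<close>

lemma slash_wp:
  assumes A: "A \<in> carrier SL2Z" and \<tau>: "\<tau> \<in> \<H>"
  shows "slash 2 (wp N v) A \<tau> = wp N (row_mult v A) \<tau>"
proof -
  note nz = aut_factor_nonzero[OF A \<tau>]
  have term_eq: "wp_term N v w (moebius A \<tau>) * (1 / aut_factor A \<tau> ^ 2) = wp_term N (row_mult v A) (row_mult w A) \<tau>" for w
  proof -
    have "1 / lin p (moebius A \<tau>) ^ 2 * (1 / aut_factor A \<tau> ^ 2) = 1 / lin (row_mult p A) \<tau> ^ 2" for p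
      using nz by (simp add: lin_moebius[OF A \<tau>] power_divide)
    then show ?thesis
      unfolding wp_term_def left_diff_distrib
      using row_mult_eq_zero_iff[OF A, of w] by (simp add: row_mult_shift)
  qed
  have "slash 2 (wp N v) A \<tau> = (\<Sum>\<^sub>\<infinity>w. wp_term N v w (moebius A \<tau>)) * (1 / aut_factor A \<tau> ^ 2)"
    using assms by (simp add: slash_def wp_def)
  also have "\<dots> = (\<Sum>\<^sub>\<infinity>w. wp_term N v w (moebius A \<tau>) * (1 / aut_factor A \<tau> ^ 2))"
    using nz by (intro infsum_cmult_left'[symmetric])
  also have "\<dots> = (\<Sum>\<^sub>\<infinity>w. wp_term N (row_mult v A) (row_mult w A) \<tau>)"
    by (simp only: term_eq)
  also have "\<dots> = (\<Sum>\<^sub>\<infinity>w. wp_term N (row_mult v A) w \<tau>)"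
  proof (rule infsum_reindex_bij_betw)
    show "bij_betw (\<lambda>w. row_mult w A) UNIV UNIV"
      by (rule bij_betwI[of _ _ _ "\<lambda>w. row_mult w (SL2Z_inv A)"]) (use A in \<open>auto simp: row_mult_inv\<close>)
  qed
  finally show ?thesis using \<tau> by (simp add: wp_def)
qed

text \<open>Representatives of the nonzero \<open>N\<close>-torsion points.\<close>

definition residues :: "int \<Rightarrow> (int \<times> int) set" where
  "residues N = {0..<N} \<times> {0..<N} - {(0, 0)}"

lemma finite_residues [simp]: "finite (residues N)"
  by (simp add: residues_def)

lemma residues_not_zero: "v \<in> residues N \<Longrightarrow> \<not> torsion_zero N v"
  by (auto simp: residues_def torsion_zero_def) (metis order_le_less zdvd_not_zless)+

lemma reduced_shift_ge:
  fixes N x n :: int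
  assumes "0 \<le> x" "x < N" shows "\<bar>n\<bar> \<le> \<bar>x + N * n\<bar>"
proof (cases "n \<ge> 0")
  case True
  have "1 * n \<le> N * n" using True assms by (intro mult_right_mono) auto
  then show ?thesis using True assms by simp
next
  case False
  have "(N - 1) * 1 \<le> (N - 1) * (- n)" using False assms by (intro mult_left_mono) auto
  then show ?thesis using False assms by (simp add: algebra_simps)
qed

text \<open>For \<open>w\<close> off the axis the difference of the two fractions gains the factor
  \<open>lin v \<tau> / lin w \<tau>\<close>, which is of order \<open>1 / fst w\<close> uniformly in the strip although \<open>lin v \<tau>\<close> is
  unbounded there.\<close>

lemma wp_term_bound_off_axis:
  fixes c d :: int
  assumes N: "N \<ge> 1" and v: "v \<in> residues N" and c: "c \<noteq> 0" and ab: "a \<ge> 0" "b > 0"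
    and \<delta>: "\<delta> > 0" and low: "\<And>c d. \<delta> * max \<bar>of_int c\<bar> \<bar>of_int d\<bar> \<le> norm (lin (c, d) \<tau>)"
    and \<tau>: "\<tau> \<in> strip a b"
  shows "norm (wp_term N v (c, d) \<tau>) \<le>
    (2 * (1 + (1 + a) / b) / \<delta>\<^sup>2) * (1 / (\<bar>of_int c\<bar> * (max \<bar>of_int c\<bar> \<bar>of_int d\<bar>)\<^sup>2))"
proof -
  define m where "m = max \<bar>real_of_int c\<bar> \<bar>of_int d\<bar>"
  define K where "K = 1 + (1 + a) / b"
  define P where "P = lin (shift N v (c, d)) \<tau>"
  define Q where "Q = lin (shift N (0, 0) (c, d)) \<tau>"
  have m: "m \<ge> 1" using c by (auto simp: m_def le_max_iff_disj)
  have K: "K > 0" using ab by (simp add: K_def add_pos_nonneg)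
  have y: "Im \<tau> \<ge> b" "\<bar>Re \<tau>\<bar> \<le> a" using \<tau> by (auto simp: strip_def)
  have y0: "Im \<tau> > 0" using y ab by simp
  have vb: "0 \<le> fst v" "fst v < N" "0 \<le> snd v" "snd v < N" using v by (auto simp: residues_def)
  have "m \<le> max \<bar>of_int (fst v + N * c)\<bar> \<bar>of_int (snd v + N * d)\<bar>"
    unfolding m_def using reduced_shift_ge[OF vb(1,2), of c] reduced_shift_ge[OF vb(3,4), of d]
    by (intro max.mono) (simp_all only: of_int_abs[symmetric] of_int_le_iff)
  then have "\<delta> * m \<le> \<delta> * max \<bar>of_int (fst v + N * c)\<bar> \<bar>of_int (snd v + N * d)\<bar>"
    using \<delta> by (intro mult_left_mono) auto
  also have "\<dots> \<le> norm P" unfolding P_def shift_def fst_conv snd_conv by (rule low)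
  finally have P: "\<delta> * m \<le> norm P" .
  have "m \<le> max \<bar>of_int (N * c)\<bar> \<bar>of_int (N * d)\<bar>"
    unfolding m_def using reduced_shift_ge[of 0 N c] reduced_shift_ge[of 0 N d] N
    by (intro max.mono) (simp_all only: of_int_abs[symmetric] of_int_le_iff, simp_all)
  then have "\<delta> * m \<le> \<delta> * max \<bar>of_int (N * c)\<bar> \<bar>of_int (N * d)\<bar>"
    using \<delta> by (intro mult_left_mono) auto
  also have "\<dots> \<le> norm Q" using low[of "N * c" "N * d"] by (simp add: Q_def shift_def)
  finally have Q: "\<delta> * m \<le> norm Q" .
  have pos: "\<delta> * m > 0" using \<delta> m by simp
  have Ppos: "norm P > 0" and Qpos: "norm Q > 0" using P Q pos by linarith+
  define V where "V = lin v \<tau>"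
  have PV: "P = V + Q" by (cases v) (simp add: P_def Q_def V_def lin_def shift_def algebra_simps)
  have "\<bar>Im Q\<bar> \<le> norm Q" by (rule abs_Im_le_cmod)
  then have Q': "of_int N * \<bar>of_int c\<bar> * Im \<tau> \<le> norm Q"
    using y0 N by (simp add: Q_def lin_def shift_def abs_mult)
  have "V = of_int (fst v) * \<tau> + of_int (snd v)" by (simp add: V_def lin_def split_beta)
  then have "norm V \<le> norm (of_int (fst v) * \<tau>) + norm (of_int (snd v) :: complex)"
    by (simp only: norm_triangle_ineq)
  also have "\<dots> \<le> of_int N * norm \<tau> + of_int N * 1"
    using vb by (auto simp: norm_mult intro!: add_mono mult_right_mono)
  also have "norm \<tau> \<le> a + Im \<tau>"
    using cmod_le[of \<tau>] y y0 by simp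
  also have "of_int N * (a + Im \<tau>) + of_int N * 1 = of_int N * (1 + a + Im \<tau>)" by (simp add: algebra_simps)
  also have "1 + a + Im \<tau> \<le> K * Im \<tau>"
  proof -
    have "(1 + a) * 1 \<le> (1 + a) * (Im \<tau> / b)" using y ab by (intro mult_left_mono) auto
    then show ?thesis by (simp add: K_def algebra_simps add_divide_distrib)
  qed
  finally have V: "norm V \<le> of_int N * (K * Im \<tau>)" using N by (simp add: mult_left_mono)
  have VQ: "norm V / norm Q \<le> K / \<bar>of_int c\<bar>"
  proof -
    have "norm V * \<bar>of_int c\<bar> \<le> of_int N * (K * Im \<tau>) * \<bar>of_int c\<bar>" using V by (intro mult_right_mono) auto
    also have "\<dots> = K * (of_int N * \<bar>of_int c\<bar> * Im \<tau>)" by simp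
    also have "\<dots> \<le> K * norm Q" using Q' K by (intro mult_left_mono) auto
    finally show ?thesis using Qpos c by (simp add: divide_simps)
  qed
  have Pnz: "P \<noteq> 0" and Qnz: "Q \<noteq> 0" using Ppos Qpos by auto
  have "wp_term N v (c, d) \<tau> = 1 / P\<^sup>2 - 1 / Q\<^sup>2"
    using c by (simp add: wp_term_def P_def Q_def)
  also have "\<dots> = - (V / Q) * (1 / (P * Q) + 1 / P\<^sup>2)"
    unfolding PV using Qnz Pnz[unfolded PV] by (simp add: divide_simps) (simp add: power2_eq_square algebra_simps)
  finally have "norm (wp_term N v (c, d) \<tau>) = (norm V / norm Q) * norm (1 / (P * Q) + 1 / P\<^sup>2)"
    by (simp add: norm_mult norm_divide)
  also have "\<dots> \<le> (K / \<bar>of_int c\<bar>) * (2 / (\<delta> * m)\<^sup>2)"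
  proof (intro mult_mono VQ)
    have "norm (1 / (P * Q) + 1 / P\<^sup>2) \<le> norm (1 / (P * Q)) + norm (1 / P\<^sup>2)" by (rule norm_triangle_ineq)
    also have "\<dots> = 1 / (norm P * norm Q) + 1 / (norm P * norm P)"
      by (simp add: norm_divide norm_mult norm_power power2_eq_square)
    also have "\<dots> \<le> 1 / (\<delta> * m)\<^sup>2 + 1 / (\<delta> * m)\<^sup>2"
    proof -
      have "1 / (x * z) \<le> 1 / (e * e)" if "e > 0" "e \<le> x" "e \<le> z" for e x z :: real
        by (intro divide_left_mono mult_mono mult_pos_pos) (use that in auto)
      then show ?thesis unfolding power2_eq_square using P Q pos by (intro add_mono) auto
    qed
    finally show "norm (1 / (P * Q) + 1 / P\<^sup>2) \<le> 2 / (\<delta> * m)\<^sup>2" by simp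
  qed (use K in auto)
  also have "\<dots> = (2 * K / \<delta>\<^sup>2) * (1 / (\<bar>of_int c\<bar> * m\<^sup>2))" by (simp add: power_mult_distrib mult_ac)
  finally show ?thesis by (simp add: K_def m_def)
qed

lemma pair_weight_ge_off_axis:
  assumes "c \<noteq> 0"
  shows "1 / (\<bar>of_int c\<bar> * (max \<bar>of_int c\<bar> \<bar>of_int d\<bar>)\<^sup>2) \<le> pair_weight (c, d)"
proof (cases "\<bar>d\<bar> \<le> \<bar>c\<bar>")
  case True
  then have "max \<bar>of_int c\<bar> \<bar>of_int d\<bar> = \<bar>real_of_int c\<bar>"
    by (intro max_absorb1) (simp only: of_int_abs[symmetric] of_int_le_iff)
  then show ?thesis
    using pair_weight_ge_cube[of c d] assms by (simp add: power2_eq_square power3_eq_cube)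
next
  case False
  define x where "x = \<bar>real_of_int c\<bar>"
  define z where "z = \<bar>real_of_int d\<bar>"
  have x: "x \<ge> 1" using assms by (simp add: x_def)
  have xz: "x \<le> z" unfolding x_def z_def using False by (simp only: of_int_abs[symmetric] of_int_le_iff)
  \<comment> \<open>Half a power is moved from the smaller to the larger of the two numbers.\<close>
  have "1 / (x * z\<^sup>2) = x powr (- 1) * z powr (- 2)"
    using x xz by (simp add: powr_minus_divide powr_numeral)
  also have "\<dots> = x powr (- 3/2) * x powr (1/2) * z powr (- 2)"
    by (simp add: powr_add[symmetric])
  also have "\<dots> \<le> x powr (- 3/2) * z powr (1/2) * z powr (- 2)"
    using x xz by (intro mult_right_mono mult_left_mono powr_mono2) auto
  also have "\<dots> = x powr (- 3/2) * z powr (- 3/2)"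
    by (simp add: powr_add[symmetric])
  also have "\<dots> = pair_weight (c, d)"
    using x xz by (simp add: pair_weight_def int_weight_def x_def[symmetric] z_def[symmetric])
  finally show ?thesis using xz by (simp add: x_def z_def max_def)
qed

lemma int_weight_ge_square: "d \<noteq> 0 \<Longrightarrow> 1 / (of_int d)\<^sup>2 \<le> pair_weight (0, d)"
proof -
  assume "d \<noteq> 0"
  then have d: "1 \<le> \<bar>real_of_int d\<bar>" by simp
  have "1 / (of_int d)\<^sup>2 = \<bar>real_of_int d\<bar> powr (- 2)"
    using d by (simp add: powr_minus_divide powr_numeral)
  also have "\<dots> \<le> \<bar>real_of_int d\<bar> powr (- 3/2)" using d by (intro powr_mono) auto
  also have "\<dots> = pair_weight (0, d)" using d by (simp add: pair_weight_def int_weight_def)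
  finally show ?thesis .
qed

text \<open>Off the axis \<open>fst w = 0\<close> the cancellation between the two fractions is needed; on the axis each of them is
  an inverse square, and these are summable over one variable.\<close>

lemma dominated_wp:
  assumes N: "N \<ge> 1" and v: "v \<in> residues N"
  shows "dominated_family (wp_term N v) UNIV"
proof
  fix w
  have "shift N (0, 0) w \<noteq> (0, 0)" if "w \<noteq> (0, 0)"
    using that N by (cases w) (auto simp: shift_def)
  then show "wp_term N v w holomorphic_on \<H>"
    unfolding wp_term_def[abs_def] using shift_nonzero[OF residues_not_zero[OF v], of w]
    by (cases "w = (0, 0)") (auto intro!: holomorphic_intros simp: lin_nonzero)
next
  fix a b :: real assume ab: "a \<ge> 0" "b > 0"
  then obtain \<delta> where \<delta>: "\<delta> > 0"
    and low: "\<And>\<tau> c d. \<tau> \<in> strip a b \<Longrightarrow> \<delta> * max \<bar>of_int c\<bar> \<bar>of_int d\<bar> \<le> norm (lin (c, d) \<tau>)"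
    using strip_lin_lower_bound by blast
  define K where "K = 1 + (1 + a) / b"
  have K: "K \<ge> 1" using ab by (simp add: K_def)
  have vb: "0 \<le> fst v" "fst v < N" "0 \<le> snd v" "snd v < N" using v by (auto simp: residues_def)
  have inv_sq: "norm (1 / lin (x, y) \<tau> ^ 2) \<le> (1 / \<delta>\<^sup>2) * (1 / m\<^sup>2)"
    if "\<tau> \<in> strip a b" "m \<le> max \<bar>of_int x\<bar> \<bar>of_int y\<bar>" "m \<ge> 1" for \<tau> x y m
  proof -
    have "\<delta> * m \<le> norm (lin (x, y) \<tau>)"
      using low[OF that(1), of x y] mult_left_mono[OF that(2), of \<delta>] \<delta> by linarith
    moreover have "\<delta> * m > 0" using \<delta> that by simp
    ultimately have "1 / (norm (lin (x, y) \<tau>))\<^sup>2 \<le> 1 / (\<delta> * m)\<^sup>2"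
      by (intro divide_left_mono power_mono mult_pos_pos) auto
    then show ?thesis by (simp add: norm_divide norm_power power_mult_distrib)
  qed
  show "\<exists>M. M summable_on UNIV \<and> (\<forall>w\<in>UNIV. \<forall>\<tau>\<in>strip a b. norm (wp_term N v w \<tau>) \<le> M w)"
  proof (intro exI conjI ballI)
    show "(\<lambda>w. (2 * K / \<delta>\<^sup>2) * pair_weight w) summable_on UNIV"
      by (intro summable_on_cmult_right pair_weight_summable)
    fix w :: "int \<times> int" and \<tau> assume \<tau>: "\<tau> \<in> strip a b"
    obtain c d where w: "w = (c, d)" by (cases w)
    consider (off) "c \<noteq> 0" | (axis) "c = 0" "d \<noteq> 0" | (zero) "w = (0, 0)" using w by blast
    then show "norm (wp_term N v w \<tau>) \<le> (2 * K / \<delta>\<^sup>2) * pair_weight w"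
    proof cases
      case off
      have "norm (wp_term N v w \<tau>) \<le> (2 * K / \<delta>\<^sup>2) * (1 / (\<bar>of_int c\<bar> * (max \<bar>of_int c\<bar> \<bar>of_int d\<bar>)\<^sup>2))"
        unfolding w K_def by (rule wp_term_bound_off_axis[OF N v off ab \<delta> low[OF \<tau>] \<tau>])
      also have "\<dots> \<le> (2 * K / \<delta>\<^sup>2) * pair_weight w"
        unfolding w using K pair_weight_ge_off_axis[OF off, of d] by (intro mult_left_mono) auto
      finally show ?thesis .
    next
      case axis
      let ?m = "\<bar>real_of_int d\<bar>"
      have m: "?m \<ge> 1" using axis by simp
      have sq: "?m\<^sup>2 = (of_int d)\<^sup>2" by simp
      have 1: "norm (1 / lin (shift N v w) \<tau> ^ 2) \<le> (1 / \<delta>\<^sup>2) * (1 / ?m\<^sup>2)"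
        unfolding shift_def
        using reduced_shift_ge[OF vb(3,4), of d] m
        by (intro inv_sq[OF \<tau>]) (simp_all only: w fst_conv snd_conv of_int_abs[symmetric] of_int_le_iff le_max_iff_disj simp_thms)
      have 2: "norm (1 / lin (shift N (0, 0) w) \<tau> ^ 2) \<le> (1 / \<delta>\<^sup>2) * (1 / ?m\<^sup>2)"
      proof -
        have "\<bar>d\<bar> \<le> \<bar>N * d\<bar>" using reduced_shift_ge[of 0 N d] N by simp
        then have "?m \<le> \<bar>of_int (N * d)\<bar>" by (simp only: of_int_abs[symmetric] of_int_le_iff)
        then have "?m \<le> max \<bar>of_int (N * c)\<bar> \<bar>of_int (N * d)\<bar>" by (rule order_trans) simp
        from inv_sq[OF \<tau> this m] show ?thesis by (simp add: shift_def w)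
      qed
      have "norm (wp_term N v w \<tau>) \<le> norm (1 / lin (shift N v w) \<tau> ^ 2) + norm (1 / lin (shift N (0, 0) w) \<tau> ^ 2)"
        using axis w by (simp add: wp_term_def norm_triangle_ineq4)
      also have "\<dots> \<le> 1 * ((2 / \<delta>\<^sup>2) * (1 / (of_int d)\<^sup>2))" using 1 2 unfolding sq by simp
      also have "\<dots> \<le> K * ((2 / \<delta>\<^sup>2) * (1 / (of_int d)\<^sup>2))" using K by (intro mult_right_mono) auto
      also have "\<dots> = (2 * K / \<delta>\<^sup>2) * (1 / (of_int d)\<^sup>2)" by simp
      also have "\<dots> \<le> (2 * K / \<delta>\<^sup>2) * pair_weight w"
        using int_weight_ge_square[OF axis(2)] K w axis by (intro mult_left_mono) auto
      finally show ?thesis .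
    next
      case zero
      have "v \<noteq> (0, 0)" using v by (auto simp: residues_def)
      then have "norm (1 / lin (fst v, snd v) \<tau> ^ 2) \<le> (1 / \<delta>\<^sup>2) * (1 / 1\<^sup>2)"
        using vb by (intro inv_sq[OF \<tau>]) (auto simp: le_max_iff_disj prod_eq_iff)
      then have "norm (wp_term N v w \<tau>) \<le> 1 / \<delta>\<^sup>2"
        by (simp add: wp_term_def zero shift_def)
      also have "\<dots> \<le> 2 * K / \<delta>\<^sup>2" using K by (intro divide_right_mono) auto
      also have "\<dots> = (2 * K / \<delta>\<^sup>2) * pair_weight w" by (simp add: zero pair_weight_def int_weight_def)
      finally show ?thesis .
    qed
  qed
qed

subsection \<open>Periodicity in the torsion point\<close>

lemma infsum_telescope_int:
  fixes f :: "int \<Rightarrow> complex"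
  assumes s: "(\<lambda>n. f (n + 1) - f n) summable_on UNIV"
    and "(\<lambda>n. f (int n)) \<longlonglongrightarrow> 0" "(\<lambda>n. f (- int n)) \<longlonglongrightarrow> 0"
  shows "(\<Sum>\<^sub>\<infinity>n. f (n + 1) - f n) = 0"
proof -
  let ?g = "\<lambda>n. f (n + 1) - f n"
  have "filterlim (\<lambda>n. {- int n..<int n}) (finite_subsets_at_top UNIV) sequentially"
    unfolding filterlim_finite_subsets_at_top
  proof (intro allI impI)
    fix X :: "int set" assume X: "finite X \<and> X \<subseteq> UNIV"
    obtain B where B: "\<And>x. x \<in> X \<Longrightarrow> \<bar>x\<bar> \<le> B"
      using X by (metis finite_imageI imageI Max_ge)
    have "X \<subseteq> {- int n..<int n}" if "n \<ge> nat B + 1" for n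
    proof
      fix x assume "x \<in> X"
      then have "\<bar>x\<bar> \<le> B" by (rule B)
      then show "x \<in> {- int n..<int n}" using that by auto
    qed
    then show "\<forall>\<^sub>F n in sequentially. finite {- int n..<int n} \<and> X \<subseteq> {- int n..<int n} \<and> {- int n..<int n} \<subseteq> UNIV"
      unfolding eventually_sequentially by auto
  qed
  moreover have "(sum ?g \<longlongrightarrow> infsum ?g UNIV) (finite_subsets_at_top UNIV)"
    using has_sum_infsum[OF s] by (simp add: has_sum_def)
  ultimately have "(\<lambda>n. sum ?g {- int n..<int n}) \<longlonglongrightarrow> infsum ?g UNIV"
    by (rule filterlim_compose[rotated])
  moreover have "sum ?g {- int n..<int n} = f (int n) - f (- int n)" for n
  proof (induction n)
    case (Suc n)
    have "{- int (Suc n)..<int (Suc n)} = insert (- 1 - int n) (insert (int n) {- int n..<int n})" by auto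
    then show ?case using Suc by (simp add: add.commute)
  qed simp
  moreover have "(\<lambda>n. f (int n) - f (- int n)) \<longlonglongrightarrow> 0 - 0" by (intro tendsto_intros assms)
  ultimately show ?thesis by (simp add: LIMSEQ_unique)
qed

text \<open>Two inverse squares at a fixed distance differ by a quantity of the size of an inverse cube.\<close>

lemma lin_diff_summable:
  assumes N: "N \<ge> 1" and v: "\<not> torsion_zero N v" and \<tau>: "\<tau> \<in> \<H>"
  shows "(\<lambda>w. 1 / lin (shift N v (w + e)) \<tau> ^ 2 - 1 / lin (shift N v w) \<tau> ^ 2) summable_on UNIV"
proof -
  interpret cubes: dominated_family "\<lambda>p \<tau>. 1 / lin p \<tau> ^ 3" "- {(0, 0)}"
    by (rule dominated_lin_power) auto
  have "(\<lambda>p. 1 / lin p \<tau> ^ 3) summable_on - {(0, 0)}" by (rule cubes.summable_term[OF \<tau>])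
  then have abs3: "(\<lambda>p. norm (1 / lin p \<tau> ^ 3)) summable_on - {(0, 0)}"
    by (simp only: summable_on_iff_abs_summable_on_complex)
  have cube: "(\<lambda>w. norm (1 / lin (shift N u w) \<tau> ^ 3)) summable_on UNIV" if "\<not> torsion_zero N u" for u
  proof -
    have "(\<lambda>p. norm (1 / lin p \<tau> ^ 3)) summable_on range (shift N u)"
      using shift_nonzero[OF that] by (intro summable_on_subset_banach[OF abs3]) force
    then show ?thesis using inj_shift[of N u UNIV] N by (simp add: summable_on_reindex o_def)
  qed
  define E where "E = lin (shift N (0, 0) e) \<tau>"
  have vv: "shift N v (w + e) = shift N (shift N v e) w" for w by (simp add: shift_shift add.commute)
  let ?P = "\<lambda>w. lin (shift N v w) \<tau>" and ?R = "\<lambda>w. lin (shift N v (w + e)) \<tau>"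
  have RP: "?R w = ?P w + E" for w
    by (simp add: E_def lin_def shift_def algebra_simps)
  have nz: "?P w \<noteq> 0" "?R w \<noteq> 0" for w
    using shift_nonzero[OF v] \<tau> by (simp_all add: lin_nonzero)
  define C where "C w = norm E * 2 * (norm (1 / ?P w ^ 3) + norm (1 / ?R w ^ 3))" for w
  have "C summable_on UNIV"
    unfolding C_def using cube[OF v] cube[of "shift N v e"] v
    by (intro summable_on_cmult_right summable_on_add) (simp_all add: vv)
  moreover have "norm (1 / ?R w ^ 2 - 1 / ?P w ^ 2) \<le> C w" for w
  proof -
    define x where "x = 1 / norm (?P w)"
    define y where "y = 1 / norm (?R w)"
    have xy: "x \<ge> 0" "y \<ge> 0" by (simp_all add: x_def y_def)
    have "1 / ?R w ^ 2 - 1 / ?P w ^ 2 = - E * (1 / (?R w * ?P w ^ 2) + 1 / (?R w ^ 2 * ?P w))"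
      unfolding RP using nz[of w] unfolding RP by (simp add: divide_simps) (simp add: power2_eq_square algebra_simps)
    then have "norm (1 / ?R w ^ 2 - 1 / ?P w ^ 2) \<le> norm E * (norm (1 / (?R w * ?P w ^ 2)) + norm (1 / (?R w ^ 2 * ?P w)))"
      by (simp only: norm_mult norm_minus_cancel) (intro mult_left_mono norm_triangle_ineq norm_ge_zero)
    also have "\<dots> = norm E * (y * x\<^sup>2 + y\<^sup>2 * x)"
      by (simp add: norm_divide norm_mult norm_power x_def y_def power_divide)
    also have "\<dots> \<le> norm E * (2 * (x ^ 3 + y ^ 3))"
    proof (intro mult_left_mono norm_ge_zero)
      have "0 \<le> (x + y) * (x - y)\<^sup>2" using xy by simp
      also have "(x + y) * (x - y)\<^sup>2 = x ^ 3 + y ^ 3 - (y * x\<^sup>2 + y\<^sup>2 * x)"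
        by (simp add: power2_eq_square power3_eq_cube algebra_simps)
      finally have "y * x\<^sup>2 + y\<^sup>2 * x \<le> x ^ 3 + y ^ 3" by simp
      moreover have "x ^ 3 \<ge> 0" "y ^ 3 \<ge> 0" using xy by simp_all
      then have "x ^ 3 + y ^ 3 \<le> 2 * (x ^ 3 + y ^ 3)" by simp
      ultimately show "y * x\<^sup>2 + y\<^sup>2 * x \<le> 2 * (x ^ 3 + y ^ 3)" by (rule order_trans)
    qed
    also have "\<dots> = C w" by (simp add: C_def x_def y_def norm_divide norm_power power_divide)
    finally show ?thesis .
  qed
  ultimately have "(\<lambda>w. norm (1 / ?R w ^ 2 - 1 / ?P w ^ 2)) summable_on UNIV"
    by (rule summable_on_comparison_test) (rule norm_ge_zero)
  then show ?thesis by (rule abs_summable_summable)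
qed

lemma inverse_square_tendsto_0:
  fixes N x :: int
  assumes "N \<ge> 1" "\<delta> > 0" and le: "\<And>n. \<delta> * \<bar>of_int (x + N * s n)\<bar> \<le> norm (g n :: complex)"
    and s: "filterlim (\<lambda>n. \<bar>real_of_int (s n)\<bar>) at_top sequentially"
  shows "(\<lambda>n. 1 / g n ^ 2) \<longlonglongrightarrow> 0"
proof -
  have "filterlim (\<lambda>n. norm (g n)) at_top sequentially"
  proof (rule filterlim_at_top_mono)
    show "filterlim (\<lambda>n. - (\<delta> * \<bar>of_int x\<bar>) + \<delta> * \<bar>real_of_int (s n)\<bar>) at_top sequentially"
      using assms(2) by (intro filterlim_tendsto_add_at_top[OF tendsto_const] filterlim_tendsto_pos_mult_at_top[OF tendsto_const] s)
    show "eventually (\<lambda>n. - (\<delta> * \<bar>of_int x\<bar>) + \<delta> * \<bar>real_of_int (s n)\<bar> \<le> norm (g n)) sequentially"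
    proof (intro always_eventually allI)
      fix n
      have "1 * \<bar>real_of_int (s n)\<bar> \<le> of_int N * \<bar>real_of_int (s n)\<bar>" using assms(1) by (intro mult_right_mono) auto
      also have "\<dots> = \<bar>of_int (N * s n)\<bar>" using assms(1) by (simp add: abs_mult)
      also have "\<dots> \<le> \<bar>of_int x\<bar> + \<bar>of_int (x + N * s n)\<bar>" by simp
      finally have "\<delta> * \<bar>real_of_int (s n)\<bar> \<le> \<delta> * (\<bar>of_int x\<bar> + \<bar>of_int (x + N * s n)\<bar>)"
        using assms(2) by (intro mult_left_mono) auto
      also have "\<dots> \<le> \<delta> * \<bar>of_int x\<bar> + norm (g n)" using le[of n] by (simp add: distrib_left)
      finally show "- (\<delta> * \<bar>of_int x\<bar>) + \<delta> * \<bar>real_of_int (s n)\<bar> \<le> norm (g n)" by simp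
    qed
  qed
  then have "(\<lambda>n. norm (1 / g n ^ 2)) \<longlonglongrightarrow> 0"
    unfolding norm_divide norm_power norm_one
    by (intro tendsto_divide_0[OF tendsto_const] filterlim_at_top_imp_at_infinity filterlim_pow_at_top) auto
  then show ?thesis by (rule tendsto_norm_zero_cancel)
qed

lemma infsum_lin_diff:
  assumes N: "N \<ge> 1" and v: "\<not> torsion_zero N v" and \<tau>: "\<tau> \<in> \<H>" and e: "e = (1, 0) \<or> e = (0, 1)"
  shows "(\<Sum>\<^sub>\<infinity>w. 1 / lin (shift N v (w + e)) \<tau> ^ 2 - 1 / lin (shift N v w) \<tau> ^ 2) = 0"
proof -
  have st: "\<tau> \<in> strip \<bar>Re \<tau>\<bar> (Im \<tau>)" "Im \<tau> > 0" using \<tau> by (auto simp: strip_def in_H_iff)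
  obtain \<delta> where \<delta>: "\<delta> > 0" and "\<And>\<tau>' c d. \<tau>' \<in> strip \<bar>Re \<tau>\<bar> (Im \<tau>) \<Longrightarrow>
      \<delta> * max \<bar>of_int c\<bar> \<bar>of_int d\<bar> \<le> norm (lin (c, d) \<tau>')"
    using strip_lin_lower_bound[OF st(2) abs_ge_zero] by blast
  note low = this(2)[OF st(1)]
  have low1: "\<delta> * \<bar>of_int c\<bar> \<le> norm (lin (c, d) \<tau>)" and low2: "\<delta> * \<bar>of_int d\<bar> \<le> norm (lin (c, d) \<tau>)" for c d
    using \<delta> by (auto intro!: order_trans[OF mult_left_mono low[of c d]])
  define T where "T m n = 1 / lin (shift N v (m, n)) \<tau> ^ 2" for m n
  have lims: "filterlim (\<lambda>n. \<bar>real_of_int (int n)\<bar>) at_top sequentially"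
    "filterlim (\<lambda>n. \<bar>real_of_int (- int n)\<bar>) at_top sequentially"
    by (simp_all add: filterlim_real_sequentially)
  have T1: "(\<lambda>m. T (int m) n) \<longlonglongrightarrow> 0" "(\<lambda>m. T (- int m) n) \<longlonglongrightarrow> 0" for n
    unfolding T_def shift_def fst_conv snd_conv
    by (rule inverse_square_tendsto_0[OF N \<delta> low1], rule lims)+
  have T2: "(\<lambda>n. T m (int n)) \<longlonglongrightarrow> 0" "(\<lambda>n. T m (- int n)) \<longlonglongrightarrow> 0" for m
    unfolding T_def shift_def fst_conv snd_conv
    by (rule inverse_square_tendsto_0[OF N \<delta> low2], rule lims)+
  let ?D = "\<lambda>w. 1 / lin (shift N v (w + e)) \<tau> ^ 2 - 1 / lin (shift N v w) \<tau> ^ 2"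
  have "?D summable_on UNIV" by (rule lin_diff_summable[OF N v \<tau>])
  then have s: "?D summable_on Sigma UNIV (\<lambda>_. UNIV)" by simp
  have s': "(\<lambda>(x, y). ?D (y, x)) summable_on UNIV \<times> UNIV"
    using s summable_on_swap[of ?D UNIV UNIV] by (simp add: prod.swap_def split_beta o_def)
  from e show ?thesis
  proof
    assume e: "e = (0, 1)"
    have D: "?D (m, n) = T m (n + 1) - T m n" for m n by (simp add: T_def e)
    have inner: "(\<Sum>\<^sub>\<infinity>n. ?D (m, n)) = 0" for m
    proof -
      have "?D = (\<lambda>(m, n). T m (n + 1) - T m n)" by (auto simp: fun_eq_iff T_def e)
      then have "(\<lambda>n. T m (n + 1) - T m n) summable_on UNIV"
        using summable_on_SigmaD1[of "\<lambda>m n. T m (n + 1) - T m n" UNIV "\<lambda>_. UNIV" m] s by simp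
      then show ?thesis unfolding D by (intro infsum_telescope_int T2)
    qed
    have "(\<Sum>\<^sub>\<infinity>w. ?D w) = (\<Sum>\<^sub>\<infinity>m. \<Sum>\<^sub>\<infinity>n. ?D (m, n))"
      using infsum_Sigma_banach[OF s] by simp
    then show ?thesis by (simp only: inner infsum_0_simp)
  next
    assume e: "e = (1, 0)"
    have D: "?D (m, n) = T (m + 1) n - T m n" for m n by (simp add: T_def e)
    have inner: "(\<Sum>\<^sub>\<infinity>m. ?D (m, n)) = 0" for n
    proof -
      have "(\<lambda>(x, y). ?D (y, x)) = (\<lambda>(n, m). T (m + 1) n - T m n)"
        by (auto simp: fun_eq_iff T_def e)
      then have "(\<lambda>m. T (m + 1) n - T m n) summable_on UNIV"
        using summable_on_SigmaD1[of "\<lambda>n m. T (m + 1) n - T m n" UNIV "\<lambda>_. UNIV" n] s' by simp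
      then show ?thesis unfolding D by (intro infsum_telescope_int T1)
    qed
    have "(\<Sum>\<^sub>\<infinity>w. ?D w) = (\<Sum>\<^sub>\<infinity>m. \<Sum>\<^sub>\<infinity>n. ?D (m, n))"
      using infsum_Sigma_banach[OF s] by simp
    also have "\<dots> = (\<Sum>\<^sub>\<infinity>n. \<Sum>\<^sub>\<infinity>m. ?D (m, n))"
    proof (rule infsum_swap_banach)
      have "(\<lambda>(m, n). ?D (m, n)) = ?D" by (auto simp: fun_eq_iff)
      then show "(\<lambda>(m, n). ?D (m, n)) summable_on UNIV \<times> UNIV" using s by (simp only:)
    qed
    finally show ?thesis by (simp only: inner infsum_0_simp)
  qed
qed

text \<open>Moving the torsion point by a lattice vector changes the sum by a convergent telescoping sum.\<close>

lemma wp_shift_unit: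
  assumes N: "N \<ge> 1" and v: "\<not> torsion_zero N v" and \<tau>: "\<tau> \<in> \<H>" and e: "e = (1, 0) \<or> e = (0, 1)"
  shows "(\<lambda>w. wp_term N (shift N v e) w \<tau>) summable_on UNIV \<longleftrightarrow> (\<lambda>w. wp_term N v w \<tau>) summable_on UNIV"
    and "(\<lambda>w. wp_term N v w \<tau>) summable_on UNIV \<Longrightarrow> wp N (shift N v e) \<tau> = wp N v \<tau>"
proof -
  let ?D = "\<lambda>w. 1 / lin (shift N v (w + e)) \<tau> ^ 2 - 1 / lin (shift N v w) \<tau> ^ 2"
  have D: "?D summable_on UNIV" "infsum ?D UNIV = 0"
    using lin_diff_summable[OF N v \<tau>] infsum_lin_diff[OF N v \<tau> e] by auto
  have eq: "wp_term N (shift N v e) w \<tau> = wp_term N v w \<tau> + ?D w" for w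
    by (simp add: wp_term_def shift_shift add.commute)
  have eq': "wp_term N v w \<tau> = wp_term N (shift N v e) w \<tau> + - ?D w" for w
    by (simp add: eq)
  show "(\<lambda>w. wp_term N (shift N v e) w \<tau>) summable_on UNIV \<longleftrightarrow> (\<lambda>w. wp_term N v w \<tau>) summable_on UNIV"
  proof
    assume "(\<lambda>w. wp_term N v w \<tau>) summable_on UNIV"
    then show "(\<lambda>w. wp_term N (shift N v e) w \<tau>) summable_on UNIV"
      unfolding eq by (intro summable_on_add D)
  next
    assume "(\<lambda>w. wp_term N (shift N v e) w \<tau>) summable_on UNIV"
    then show "(\<lambda>w. wp_term N v w \<tau>) summable_on UNIV"
      unfolding eq'[abs_def] by (intro summable_on_add summable_on_uminus[THEN iffD2] D)
  qed
  show "wp N (shift N v e) \<tau> = wp N v \<tau>" if "(\<lambda>w. wp_term N v w \<tau>) summable_on UNIV"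
    using \<tau> infsum_add[OF that D(1)] D(2) by (simp add: wp_def eq)
qed

text \<open>Summability is known at the representatives and has to be carried along, one unit step at a time.\<close>

lemma wp_shift:
  assumes N: "N \<ge> 1" and v: "v \<in> residues N" and \<tau>: "\<tau> \<in> \<H>"
  shows "wp N (shift N v u) \<tau> = wp N v \<tau>"
proof -
  define Q where "Q u \<longleftrightarrow> (\<lambda>w. wp_term N (shift N v u) w \<tau>) summable_on UNIV \<and> wp N (shift N v u) \<tau> = wp N v \<tau>" for u
  interpret dominated_family "wp_term N v" UNIV by (rule dominated_wp[OF N v])
  have v0: "shift N v (0, 0) = v" by (simp add: shift_def)
  have Q0: "Q (0, 0)" unfolding Q_def v0 using summable_term[OF \<tau>] by simp
  have nz: "\<not> torsion_zero N (shift N v u)" for u using residues_not_zero[OF v] by simp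
  have step: "Q (u + e) \<longleftrightarrow> Q u" if "e = (1, 0) \<or> e = (0, 1)" for u e
    using wp_shift_unit[OF N nz \<tau> that, of u] by (auto simp: Q_def shift_shift)
  have line: "Q (x + n, y) \<longleftrightarrow> Q (x, y)" "Q (x, y + n) \<longleftrightarrow> Q (x, y)" for x y n
  proof -
    have 1: "Q (x + 1, y) \<longleftrightarrow> Q (x, y)" "Q (x, y + 1) \<longleftrightarrow> Q (x, y)" for x y
      using step[of "(1, 0)" "(x, y)"] step[of "(0, 1)" "(x, y)"] by simp_all
    show "Q (x + n, y) \<longleftrightarrow> Q (x, y)"
    proof (induction n rule: int_induct[where k = 0])
      case (step1 i) then show ?case using 1(1)[of "x + i" y] by (simp add: add.assoc)
    next
      case (step2 i) then show ?case using 1(1)[of "x + i - 1" y] by (simp add: algebra_simps)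
    qed simp
    show "Q (x, y + n) \<longleftrightarrow> Q (x, y)"
    proof (induction n rule: int_induct[where k = 0])
      case (step1 i) then show ?case using 1(2)[of x "y + i"] by (simp add: add.assoc)
    next
      case (step2 i) then show ?case using 1(2)[of x "y + i - 1"] by (simp add: algebra_simps)
    qed simp
  qed
  have "Q (fst u, snd u)" using line(1)[of 0 "fst u" "snd u"] line(2)[of 0 0 "snd u"] Q0 by simp
  then show ?thesis by (simp add: Q_def)
qed

section \<open>Forms of weight two with prescribed values at the cusps\<close>

subsection \<open>Inverse squares in a residue class\<close>

text \<open>As \<open>1 / 0 = 0\<close>, the sum for \<open>b = 0\<close> extends over the nonzero multiples of \<open>N\<close>.\<close>

definition class_sum :: "int \<Rightarrow> int \<Rightarrow> real" where
  "class_sum N b = (\<Sum>\<^sub>\<infinity>d\<in>{d. d mod N = b}. 1 / (of_int d)\<^sup>2)"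

lemma has_sum_inverse_squares: "((\<lambda>d::int. 1 / (of_int d)\<^sup>2 :: real) has_sum (pi\<^sup>2 / 3)) UNIV"
proof -
  let ?g = "\<lambda>d::int. 1 / (of_int d)\<^sup>2 :: real"
  have n: "((\<lambda>n. 1 / (real n + 1)\<^sup>2) has_sum (pi\<^sup>2 / 6)) UNIV"
  proof (rule sums_nonneg_imp_has_sum)
    show "(\<lambda>n. 1 / (real n + 1)\<^sup>2) sums (pi\<^sup>2 / 6)"
      using inverse_squares_sums by (simp add: add.commute)
  qed simp
  have "((?g \<circ> (\<lambda>n. int n + 1)) has_sum (pi\<^sup>2 / 6)) UNIV"
    using n by (simp add: o_def)
  then have 1: "(?g has_sum (pi\<^sup>2 / 6)) (range (\<lambda>n. int n + 1))"
    by (subst has_sum_reindex) (auto simp: inj_on_def)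
  have "((?g \<circ> (\<lambda>n. - (int n + 1))) has_sum (pi\<^sup>2 / 6)) UNIV"
  proof -
    have "(?g \<circ> (\<lambda>n. - (int n + 1))) = (\<lambda>n. 1 / (real n + 1)\<^sup>2)"
    proof
      fix n :: nat
      have "(of_int (- (int n + 1)) :: real)\<^sup>2 = (real n + 1)\<^sup>2"
        by (simp only: of_int_minus power2_minus) simp
      then show "(?g \<circ> (\<lambda>n. - (int n + 1))) n = 1 / (real n + 1)\<^sup>2" by simp
    qed
    then show ?thesis using n by simp
  qed
  then have 2: "(?g has_sum (pi\<^sup>2 / 6)) (range (\<lambda>n. - (int n + 1)))"
    by (subst has_sum_reindex) (auto simp: inj_on_def)
  have "(?g has_sum (pi\<^sup>2 / 6 + pi\<^sup>2 / 6)) (range (\<lambda>n. int n + 1) \<union> range (\<lambda>n. - (int n + 1)))"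
    by (rule has_sum_Un_disjoint[OF 1 2]) auto
  moreover have "range (\<lambda>n. int n + 1) \<union> range (\<lambda>n. - (int n + 1)) = UNIV - {0}"
  proof -
    have "x \<in> range (\<lambda>n. int n + 1) \<union> range (\<lambda>n. - (int n + 1))" if "x \<noteq> 0" for x :: int
    proof (cases "x > 0")
      case True
      then show ?thesis by (intro UnI1 image_eqI[of _ _ "nat (x - 1)"]) auto
    next
      case False
      then show ?thesis using that by (intro UnI2 image_eqI[of _ _ "nat (- x - 1)"]) auto
    qed
    then show ?thesis by auto
  qed
  ultimately have "(?g has_sum (pi\<^sup>2 / 3)) (UNIV - {0})" by simp
  then show ?thesis
    by (rule has_sum_cong_neutral[THEN iffD1, rotated -1]) auto
qed

lemma inverse_squares_summable: "(\<lambda>d::int. 1 / (of_int d)\<^sup>2 :: real) summable_on X"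
  using has_sum_inverse_squares summable_on_subset_banach summable_on_def by blast

lemma class_sum_nonneg: "class_sum N b \<ge> 0"
  unfolding class_sum_def by (rule infsum_nonneg) simp

lemma class_sum_one_ge:
  assumes "N \<ge> 2" shows "class_sum N 1 \<ge> 1"
proof -
  have "(\<Sum>d\<in>{1::int}. 1 / (of_int d)\<^sup>2) \<le> class_sum N 1"
    unfolding class_sum_def using assms
    by (intro finite_sum_le_infsum inverse_squares_summable) auto
  then show ?thesis by simp
qed

lemma class_sum_reflect:
  assumes "0 < b" "b < N" shows "class_sum N (N - b) = class_sum N b"
  unfolding class_sum_def
proof (rule infsum_reindex_bij_witness[of _ uminus uminus])
  have neg: "(- d) mod N = c mod N" if "d mod N = (N - c) mod N" for c d
  proof -
    have "N dvd d - (N - c)" using that unfolding mod_eq_dvd_iff .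
    then have "N dvd - (d - (N - c)) - N" by (intro dvd_diff) (simp_all only: dvd_minus_iff dvd_refl)
    moreover have "- (d - (N - c)) - N = - d - c" by simp
    ultimately show ?thesis unfolding mod_eq_dvd_iff by (simp only:)
  qed
  have "N - (N - b) = b" by simp
  moreover have "(N - b) mod N = N - b" "b mod N = b"
    by (rule mod_pos_pos_trivial, use assms in auto)+
  ultimately have e: "N - (N - b) = b" "(N - b) mod N = N - b" "b mod N = b" by blast+
  show "- d \<in> {d. d mod N = b}" if "d \<in> {d. d mod N = N - b}" for d
    using neg[of d b] that by (simp only: e mem_Collect_eq)
  show "- d \<in> {d. d mod N = N - b}" if "d \<in> {d. d mod N = b}" for d
    using neg[of d "N - b"] that by (simp only: e mem_Collect_eq)
qed auto

text \<open>The inverse squares of all nonzero integers sum to \<open>\<pi>\<^sup>2 / 3\<close>.\<close>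

lemma sum_class_sum_less:
  assumes "N \<ge> 1" shows "(\<Sum>b\<in>{1..N - 1}. class_sum N b) < 4"
proof -
  let ?g = "\<lambda>d::int. 1 / (of_int d)\<^sup>2 :: real"
  have "(\<Sum>b\<in>{1..N - 1}. class_sum N b) = infsum ?g (\<Union>b\<in>{1..N - 1}. {d. d mod N = b})"
    unfolding class_sum_def by (intro sum_infsum inverse_squares_summable) auto
  also have "\<dots> \<le> infsum ?g UNIV"
    by (intro infsum_mono2 inverse_squares_summable) auto
  also have "\<dots> = pi\<^sup>2 / 3" by (rule infsumI[OF has_sum_inverse_squares])
  also have "\<dots> < 4"
  proof -
    have "pi \<le> 3.2" using pi_approx(2) by simp
    then have "pi\<^sup>2 \<le> 3.2\<^sup>2" by (intro power_mono) auto
    then show ?thesis by (simp add: power2_eq_square)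
  qed
  finally show ?thesis .
qed

lemma has_sum_class_sum:
  assumes "0 \<le> b" "b < N"
  shows "((\<lambda>n. 1 / (of_int (b + N * n))\<^sup>2 :: complex) has_sum of_real (class_sum N b)) UNIV"
proof -
  have "bij_betw (\<lambda>n. b + N * n) UNIV {d. d mod N = b}"
  proof (rule bij_betwI[of _ _ _ "\<lambda>d. d div N"])
    show "(\<lambda>n. b + N * n) \<in> UNIV \<rightarrow> {d. d mod N = b}" using assms by simp
    show "(b + N * n) div N = n" for n using assms by simp
    show "b + N * (d div N) = d" if "d \<in> {d. d mod N = b}" for d
      using that by (metis (mono_tags) mem_Collect_eq mod_mult_div_eq)
  qed auto
  moreover have "((\<lambda>d. of_real (1 / (of_int d)\<^sup>2) :: complex) has_sum of_real (class_sum N b)) {d. d mod N = b}"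
    unfolding class_sum_def by (intro has_sum_of_real has_sum_infsum inverse_squares_summable)
  ultimately have "((\<lambda>n. of_real (1 / (of_int (b + N * n))\<^sup>2) :: complex) has_sum of_real (class_sum N b)) UNIV"
    by (subst has_sum_reindex_bij_betw)
  then show ?thesis by simp
qed

subsection \<open>Inverting the matrix of class sums\<close>

definition smul :: "int \<Rightarrow> int \<times> int \<Rightarrow> int \<times> int" where
  "smul b v = (b * fst v, b * snd v)"

text \<open>On functions that are invariant under \<open>-1\<close>, the classes of \<open>b = 1\<close> and \<open>b = N - 1\<close> together contribute
  a multiple \<open>2 * class_sum N 1 \<ge> 2\<close> of the identity to the operator
  \<open>\<mu> \<mapsto> (\<lambda>v. \<Sum>b. class_sum N b * \<mu> (b v))\<close>. As all class sums add up to less than \<open>4\<close>, the other classes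
  are a perturbation of norm less than \<open>2\<close>. So the operator is inverted by a Neumann series, whose
  terms inherit the invariance of the right-hand side under the relation \<open>R\<close>.\<close>

lemma solve_class_sum_equation:
  fixes \<Phi> :: "int \<times> int \<Rightarrow> complex"
  assumes N: "N \<ge> 3" and bounded: "\<And>v. norm (\<Phi> v) \<le> C"
    and R_scale: "\<And>b v w. R v w \<Longrightarrow> R (smul b v) (smul b w)"
    and R_neg: "\<And>v. R v (smul (N - 1) v)"
    and \<Phi>: "\<And>v w. R v w \<Longrightarrow> \<Phi> v = \<Phi> w"
  obtains \<mu> where "\<And>v w. R v w \<Longrightarrow> \<mu> v = \<mu> w"
    "\<And>v. (\<Sum>b\<in>{1..N - 1}. of_real (class_sum N b) * \<mu> (smul b v)) = \<Phi> v"
proof -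
  define z where "z b = class_sum N b" for b
  define B where "B = {2..N - 2}"
  define s where "s = (\<Sum>b\<in>B. z b)"
  define K :: "(int \<times> int \<Rightarrow> complex) \<Rightarrow> int \<times> int \<Rightarrow> complex" where
    "K \<mu> v = - (\<Sum>b\<in>B. of_real (z b) * \<mu> (smul b v)) / of_real (2 * z 1)" for \<mu> v
  define T where "T n = (K ^^ n) (\<lambda>v. \<Phi> v / of_real (2 * z 1))" for n
  define \<theta> where "\<theta> = s / (2 * z 1)"
  have split: "{1..N - 1} = insert 1 (insert (N - 1) B)" using N by (auto simp: B_def)
  have notin: "1 \<notin> insert (N - 1) B" "N - 1 \<notin> B" using N by (auto simp: B_def)
  have z1: "z 1 \<ge> 1" using class_sum_one_ge[of N] N by (simp add: z_def)
  have zN: "z (N - 1) = z 1" using class_sum_reflect[of 1 N] N by (simp add: z_def)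
  have z0: "z b \<ge> 0" for b by (simp add: z_def class_sum_nonneg)
  have "(\<Sum>b\<in>{1..N - 1}. z b) = z 1 + (z (N - 1) + s)"
    unfolding split s_def using notin by (simp add: B_def)
  then have "s < 2 * z 1" using sum_class_sum_less[of N] N z1 zN by (simp add: z_def[symmetric])
  moreover have "s \<ge> 0" using z0 by (simp add: s_def sum_nonneg)
  ultimately have \<theta>: "0 \<le> \<theta>" "\<theta> < 1" using z1 by (auto simp: \<theta>_def)
  have T_bound: "norm (T n v) \<le> C / (2 * z 1) * \<theta> ^ n" for n v
  proof (induction n arbitrary: v)
    case 0
    have "norm (\<Phi> v) / (2 * z 1) \<le> C / (2 * z 1)" using bounded z1 by (intro divide_right_mono) auto
    then show ?case using z1 by (simp add: T_def norm_divide norm_mult)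
  next
    case (Suc n)
    have "norm (T (Suc n) v) = norm (\<Sum>b\<in>B. of_real (z b) * T n (smul b v)) / (2 * z 1)"
      using z1 by (simp add: T_def K_def norm_divide norm_mult)
    also have "\<dots> \<le> (\<Sum>b\<in>B. z b * (C / (2 * z 1) * \<theta> ^ n)) / (2 * z 1)"
    proof (rule divide_right_mono)
      show "norm (\<Sum>b\<in>B. of_real (z b) * T n (smul b v)) \<le> (\<Sum>b\<in>B. z b * (C / (2 * z 1) * \<theta> ^ n))"
      proof (rule sum_norm_le)
        fix b
        have "norm (of_real (z b) * T n (smul b v)) = z b * norm (T n (smul b v))"
          using z0 by (simp add: norm_mult)
        also have "\<dots> \<le> z b * (C / (2 * z 1) * \<theta> ^ n)" by (rule mult_left_mono[OF Suc.IH z0])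
        finally show "norm (of_real (z b) * T n (smul b v)) \<le> z b * (C / (2 * z 1) * \<theta> ^ n)" .
      qed
    qed (use z1 in auto)
    also have "\<dots> = \<theta> * (C / (2 * z 1) * \<theta> ^ n)"
      unfolding sum_distrib_right[symmetric] s_def[symmetric] by (simp add: \<theta>_def)
    finally show ?case by (simp add: mult_ac)
  qed
  have T_summable: "summable (\<lambda>n. T n v)" for v
    by (rule summable_comparison_test'[of "\<lambda>n. C / (2 * z 1) * \<theta> ^ n" 0])
      (use \<theta> T_bound in \<open>auto intro!: summable_mult summable_geometric\<close>)
  have T_inv: "T n v = T n w" if "R v w" for n v w
    using that
  proof (induction n arbitrary: v w)
    case 0
    then show ?case using \<Phi> by (simp add: T_def)
  next
    case (Suc n)
    have "T n (smul b v) = T n (smul b w)" for b using Suc R_scale by blast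
    then show ?case by (simp add: T_def K_def)
  qed
  define \<mu> where "\<mu> v = (\<Sum>n. T n v)" for v
  have \<mu>_inv: "\<mu> v = \<mu> w" if "R v w" for v w
    using T_inv[OF that] by (simp add: \<mu>_def)
  have "(\<Sum>n. T (Suc n) v) = K \<mu> v" for v
  proof -
    have "(\<lambda>n. T n w) sums \<mu> w" for w
      unfolding \<mu>_def by (rule summable_sums[OF T_summable])
    then have "(\<lambda>n. \<Sum>b\<in>B. of_real (z b) * T n (smul b v)) sums (\<Sum>b\<in>B. of_real (z b) * \<mu> (smul b v))"
      by (intro sums_sum sums_mult)
    then have "(\<lambda>n. - (\<Sum>b\<in>B. of_real (z b) * T n (smul b v)) / of_real (2 * z 1)) sums K \<mu> v"
      unfolding K_def by (intro sums_divide sums_minus)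
    moreover have "T (Suc n) v = - (\<Sum>b\<in>B. of_real (z b) * T n (smul b v)) / of_real (2 * z 1)" for n
      by (simp add: T_def K_def)
    ultimately show ?thesis by (simp add: sums_unique[symmetric])
  qed
  then have "K \<mu> v = \<mu> v - T 0 v" for v
    using suminf_split_head[OF T_summable, of v] by (simp add: \<mu>_def)
  then have fixed: "of_real (2 * z 1) * \<mu> v + (\<Sum>b\<in>B. of_real (z b) * \<mu> (smul b v)) = \<Phi> v" for v
    using z1 by (simp add: K_def T_def field_simps)
  show ?thesis
  proof
    show "(\<Sum>b\<in>{1..N - 1}. of_real (class_sum N b) * \<mu> (smul b v)) = \<Phi> v" for v
    proof -
      have "(\<Sum>b\<in>{1..N - 1}. of_real (z b) * \<mu> (smul b v)) =
          of_real (z 1) * \<mu> (smul 1 v) + (of_real (z (N - 1)) * \<mu> (smul (N - 1) v) + (\<Sum>b\<in>B. of_real (z b) * \<mu> (smul b v)))"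
        unfolding split using notin by (simp add: B_def)
      also have "\<mu> (smul (N - 1) v) = \<mu> v" using \<mu>_inv[OF R_neg] by simp
      also have "smul 1 v = v" by (simp add: smul_def)
      finally show ?thesis using fixed[of v] zN by (simp add: z_def algebra_simps)
    qed
  qed (rule \<mu>_inv)
qed

subsection \<open>Combinations of torsion values\<close>

definition red :: "int \<Rightarrow> int \<times> int \<Rightarrow> int \<times> int" where
  "red N v = (fst v mod N, snd v mod N)"

lemma shift_red: "shift N (red N v) (fst v div N, snd v div N) = v"
  by (simp add: shift_def red_def)

lemma red_shift [simp]: "red N (shift N v w) = red N v"
  by (simp add: red_def shift_def)

lemma red_in_residues:
  assumes "N \<ge> 1" "\<not> torsion_zero N v" shows "red N v \<in> residues N"
  using assms by (auto simp: residues_def red_def torsion_zero_def dvd_eq_mod_eq_0)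

lemma red_residue: "v \<in> residues N \<Longrightarrow> red N v = v"
  by (auto simp: residues_def red_def)

lemma red_row_mult_red: "red N (row_mult (red N v) A) = red N (row_mult v A)"
  by (metis red_shift row_mult_shift shift_red)

lemma wp_red:
  assumes "N \<ge> 1" "\<not> torsion_zero N v" "\<tau> \<in> \<H>"
  shows "wp N v \<tau> = wp N (red N v) \<tau>"
  using wp_shift[OF assms(1) red_in_residues[OF assms(1,2)] assms(3)] by (metis shift_red)

lemma sum_residues_row_mult:
  fixes h :: "int \<times> int \<Rightarrow> 'b :: comm_monoid_add"
  assumes N: "N \<ge> 1" and A: "A \<in> carrier SL2Z"
  shows "(\<Sum>v\<in>residues N. h (red N (row_mult v A))) = (\<Sum>v\<in>residues N. h v)"
proof (rule sum.reindex_bij_witness[of _ "\<lambda>u. red N (row_mult u (SL2Z_inv A))" "\<lambda>v. red N (row_mult v A)"])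
  fix v assume v: "v \<in> residues N"
  show "red N (row_mult (red N (row_mult v A)) (SL2Z_inv A)) = v"
    using red_residue[OF v] row_mult_inv(1)[OF A] by (simp add: red_row_mult_red)
  show "red N (row_mult (red N (row_mult v (SL2Z_inv A))) A) = v"
    using red_residue[OF v] row_mult_inv(2)[OF A] by (simp add: red_row_mult_red)
  show "red N (row_mult v A) \<in> residues N" "red N (row_mult v (SL2Z_inv A)) \<in> residues N"
    using residues_not_zero[OF v] A N by (auto intro!: red_in_residues simp: torsion_zero_row_mult)
qed simp

lemma has_sum_on_axis:
  assumes "(g has_sum s) (UNIV :: int set)"
  shows "((\<lambda>w::int\<times>int. if fst w = 0 then g (snd w) else 0) has_sum s) UNIV"
proof -
  have "((\<lambda>w::int\<times>int. g (snd w)) has_sum s) (range (Pair 0))"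
    using assms by (subst has_sum_reindex) (auto simp: inj_on_def o_def)
  then show ?thesis
    by (rule has_sum_cong_neutral[THEN iffD1, rotated -1]) (auto simp: image_iff)
qed

text \<open>Only the terms in which the coefficient of \<open>\<tau>\<close> is zero survive.\<close>

lemma wp_tendsto:
  assumes N: "N \<ge> 1" and v: "v \<in> residues N"
  shows "(wp N v \<longlongrightarrow> (if fst v = 0 then of_real (class_sum N (snd v)) else 0) - of_real (class_sum N 0)) at_ioo"
    (is "(_ \<longlongrightarrow> ?L) _")
proof -
  have vb: "0 \<le> fst v" "fst v < N" "0 \<le> snd v" "snd v < N" using v by (auto simp: residues_def)
  interpret dominated_family "wp_term N v" UNIV by (rule dominated_wp[OF N v])
  define X :: "int \<times> int \<Rightarrow> complex" where
    "X w = (if fst w = 0 then if fst v = 0 then 1 / (of_int (snd v + N * snd w))\<^sup>2 else 0 else 0)" for w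
  define Y :: "int \<times> int \<Rightarrow> complex" where
    "Y w = (if fst w = 0 then - (1 / (of_int (0 + N * snd w))\<^sup>2) else 0)" for w
  have term_lim: "(wp_term N v w \<longlongrightarrow> X w + Y w) at_ioo" for w
  proof -
    have zero: "fst v + N * fst w = 0 \<longleftrightarrow> fst v = 0 \<and> fst w = 0"
      using reduced_shift_ge[OF vb(1,2), of "fst w"] N by auto
    have "((\<lambda>\<tau>. 1 / lin (shift N v w) \<tau> ^ 2) \<longlongrightarrow> X w) at_ioo"
      using tendsto_inverse_lin_power[of 2 "fst v + N * fst w" "snd v + N * snd w"]
      by (auto simp: X_def shift_def zero)
    moreover have "((\<lambda>\<tau>. if w = (0, 0) then 0 else 1 / lin (shift N (0, 0) w) \<tau> ^ 2) \<longlongrightarrow> - Y w) at_ioo"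
    proof (cases "w = (0, 0)")
      case False
      then show ?thesis
        using tendsto_inverse_lin_power[of 2 "N * fst w" "N * snd w"] N
        by (auto simp: Y_def shift_def)
    qed (simp add: Y_def)
    ultimately have "((\<lambda>\<tau>. 1 / lin (shift N v w) \<tau> ^ 2 - (if w = (0, 0) then 0 else 1 / lin (shift N (0, 0) w) \<tau> ^ 2))
        \<longlongrightarrow> X w - - Y w) at_ioo" by (rule tendsto_diff)
    then show ?thesis by (simp add: wp_term_def[abs_def])
  qed
  have "(X has_sum (if fst v = 0 then of_real (class_sum N (snd v)) else 0)) UNIV"
  proof (cases "fst v = 0")
    case True
    then have "X = (\<lambda>w. if fst w = 0 then 1 / (of_int (snd v + N * snd w))\<^sup>2 else 0)"
      by (auto simp: X_def fun_eq_iff)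
    then show ?thesis
      using has_sum_on_axis[OF has_sum_class_sum[OF vb(3,4)]] True by simp
  next
    case False
    then have "X = (\<lambda>_. 0)" by (auto simp: X_def fun_eq_iff)
    then show ?thesis using False by simp
  qed
  moreover have "(Y has_sum - of_real (class_sum N 0)) UNIV"
    unfolding Y_def[abs_def] using N
    by (intro has_sum_on_axis[where g = "\<lambda>n. - (1 / (of_int (0 + N * n))\<^sup>2)"] has_sum_uminusI has_sum_class_sum) auto
  ultimately have "((\<lambda>w. X w + Y w) has_sum ?L) UNIV" using has_sum_add by fastforce
  then have L: "(\<Sum>\<^sub>\<infinity>w. X w + Y w) = ?L" by (rule infsumI)
  have "((\<lambda>\<tau>. \<Sum>\<^sub>\<infinity>w. wp_term N v w \<tau>) \<longlongrightarrow> ?L) (inf at_ioo (principal (strip (real (nat N)) 1)))"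
    using tendsto_infsum_strip[OF term_lim, of "real (nat N)"] unfolding L by simp
  then have "(wp N v \<longlongrightarrow> ?L) (inf at_ioo (principal (strip (real (nat N)) 1)))"
    by (rule Lim_transform_eventually)
      (use strip_subset_H[of 1] in \<open>auto simp: eventually_inf_principal wp_def subset_iff\<close>)
  then show ?thesis
  proof (rule periodic_tendsto_at_ioo[rotated 2])
    show "wp N v (\<tau> + of_nat (nat N) * of_int n) = wp N v \<tau>" if \<tau>: "\<tau> \<in> \<H>" for \<tau> n
    proof -
      have "wp N v (\<tau> + of_nat (nat N) * of_int n) = slash 2 (wp N v) (transl (N * n)) \<tau>"
        using N by (simp add: slash_transl)
      also have "\<dots> = wp N (row_mult v (transl (N * n))) \<tau>" using \<tau> by (intro slash_wp) auto
      also have "row_mult v (transl (N * n)) = shift N v (0, fst v * n)"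
        by (cases v) (simp add: row_mult_def shift_def)
      also have "wp N \<dots> \<tau> = wp N v \<tau>" by (rule wp_shift[OF N v \<tau>])
      finally show ?thesis .
    qed
  qed (use N in auto)
qed

definition wp_comb :: "int \<Rightarrow> (int \<times> int \<Rightarrow> complex) \<Rightarrow> complex \<Rightarrow> complex" where
  "wp_comb N \<mu> \<tau> = (\<Sum>v\<in>residues N. \<mu> v * wp N v \<tau>)"

lemma slash_wp_comb:
  assumes N: "N \<ge> 1" and periodic: "\<And>v w. \<mu> (shift N v w) = \<mu> v"
    and A: "A \<in> carrier SL2Z" and \<tau>: "\<tau> \<in> \<H>"
  shows "slash 2 (wp_comb N \<mu>) A \<tau> = wp_comb N (\<lambda>u. \<mu> (row_mult u (SL2Z_inv A))) \<tau>"
proof -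
  have \<mu>_red: "\<mu> (row_mult (red N u) B) = \<mu> (row_mult u B)" for u B
    by (metis periodic row_mult_shift shift_red)
  have "slash 2 (wp_comb N \<mu>) A \<tau> = (\<Sum>v\<in>residues N. \<mu> v * slash 2 (wp N v) A \<tau>)"
    unfolding wp_comb_def[abs_def] slash_sum slash_cmult ..
  also have "\<dots> = (\<Sum>v\<in>residues N. (\<lambda>u. \<mu> (row_mult u (SL2Z_inv A)) * wp N u \<tau>) (red N (row_mult v A)))"
  proof (rule sum.cong[OF refl])
    fix v assume v: "v \<in> residues N"
    have "slash 2 (wp N v) A \<tau> = wp N (red N (row_mult v A)) \<tau>"
      using residues_not_zero[OF v] A N \<tau> by (simp add: slash_wp wp_red torsion_zero_row_mult)
    then show "\<mu> v * slash 2 (wp N v) A \<tau> = (\<lambda>u. \<mu> (row_mult u (SL2Z_inv A)) * wp N u \<tau>) (red N (row_mult v A))"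
      using A by (simp add: \<mu>_red row_mult_inv)
  qed
  also have "\<dots> = wp_comb N (\<lambda>u. \<mu> (row_mult u (SL2Z_inv A))) \<tau>"
    unfolding wp_comb_def by (rule sum_residues_row_mult[OF N A])
  finally show ?thesis .
qed

lemma wp_comb_tendsto:
  assumes N: "N \<ge> 1"
  shows "(wp_comb N \<mu> \<longlongrightarrow> (\<Sum>b\<in>{1..N - 1}. of_real (class_sum N b) * \<mu> (0, b)) -
    of_real (class_sum N 0) * (\<Sum>v\<in>residues N. \<mu> v)) at_ioo"
proof -
  let ?L = "\<lambda>v. (if fst v = 0 then of_real (class_sum N (snd v)) else 0) - of_real (class_sum N 0) :: complex"
  have "(wp_comb N \<mu> \<longlongrightarrow> (\<Sum>v\<in>residues N. \<mu> v * ?L v)) at_ioo"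
    unfolding wp_comb_def[abs_def] using wp_tendsto[OF N] by (intro tendsto_sum tendsto_mult tendsto_const)
  also have "(\<Sum>v\<in>residues N. \<mu> v * ?L v) =
      (\<Sum>v\<in>residues N. if fst v = 0 then of_real (class_sum N (snd v)) * \<mu> v else 0) -
      of_real (class_sum N 0) * (\<Sum>v\<in>residues N. \<mu> v)"
    unfolding sum_distrib_left sum_subtractf[symmetric]
    by (intro sum.cong refl) (simp add: algebra_simps)
  also have "(\<Sum>v\<in>residues N. if fst v = 0 then of_real (class_sum N (snd v)) * \<mu> v else 0) =
      (\<Sum>b\<in>{1..N - 1}. of_real (class_sum N b) * \<mu> (0, b))"
  proof -
    have "(\<Sum>v\<in>residues N. if fst v = 0 then of_real (class_sum N (snd v)) * \<mu> v else 0) =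
        (\<Sum>v\<in>{v \<in> residues N. fst v = 0}. of_real (class_sum N (snd v)) * \<mu> v)"
      by (rule sum.inter_filter[symmetric]) simp
    also have "{v \<in> residues N. fst v = 0} = Pair 0 ` {1..N - 1}"
      by (auto simp: residues_def image_iff)
    also have "(\<Sum>v\<in>Pair 0 ` {1..N - 1}. of_real (class_sum N (snd v)) * \<mu> v) =
        (\<Sum>b\<in>{1..N - 1}. of_real (class_sum N b) * \<mu> (0, b))"
      by (subst sum.reindex) (auto simp: inj_on_def)
    finally show ?thesis .
  qed
  finally show ?thesis .
qed

lemma row_mult_axis: "row_mult (0, b) A = smul b (bottom_row A)"
  by (simp add: row_mult_def smul_def bottom_row_def)

context congruence_group
begin

text \<open>Pairs are identified under \<open>G\<close>, under sign and modulo \<open>N\<close>. On the bottom rows of inverses of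
  matrices in the modular group, the classes are the cusps if \<open>N\<close> is a multiple of the level.\<close>

definition row_equiv :: "int \<Rightarrow> int \<times> int \<Rightarrow> int \<times> int \<Rightarrow> bool" where
  "row_equiv N v w \<longleftrightarrow> (\<exists>C\<in>G. \<exists>\<epsilon>\<in>{1, - 1}. \<exists>u. w = shift N (smul \<epsilon> (row_mult v C)) u)"

lemma row_equiv_mult: "C \<in> G \<Longrightarrow> row_equiv N v (row_mult v C)"
  unfolding row_equiv_def by (intro bexI[of _ C] bexI[of _ 1] exI[of _ "(0, 0)"]) (auto simp: shift_def smul_def)

lemma row_equiv_shift: "row_equiv N v (shift N v u)"
  unfolding row_equiv_def by (intro bexI[of _ "mat 1"] bexI[of _ 1] exI[of _ u]) (auto simp: shift_def smul_def)

lemma row_equiv_neg: "row_equiv N v (smul (N - 1) v)"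
  unfolding row_equiv_def
  by (intro bexI[of _ "mat 1"] bexI[of _ "- 1"] exI[of _ v]) (auto simp: shift_def smul_def algebra_simps)

lemma row_equiv_scale:
  assumes "row_equiv N v w" shows "row_equiv N (smul b v) (smul b w)"
proof -
  obtain C \<epsilon> u where *: "C \<in> G" "\<epsilon> \<in> {1, - 1}" "w = shift N (smul \<epsilon> (row_mult v C)) u"
    using assms unfolding row_equiv_def by blast
  then have "smul b w = shift N (smul \<epsilon> (row_mult (smul b v) C)) (smul b u)"
    by (cases v) (simp add: shift_def smul_def row_mult_def algebra_simps)
  then show ?thesis using * unfolding row_equiv_def by blast
qed

lemma row_equiv_sym:
  assumes "row_equiv N v w" shows "row_equiv N w v"
proof -
  obtain C \<epsilon> u where *: "C \<in> G" "\<epsilon> \<in> {1, - 1}" "w = shift N (smul \<epsilon> (row_mult v C)) u"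
    using assms unfolding row_equiv_def by blast
  let ?D = "SL2Z_inv C"
  have lin: "row_mult (shift N (smul \<epsilon> p) u) ?D = shift N (smul \<epsilon> (row_mult p ?D)) (row_mult u ?D)" for p
    by (cases p; cases u) (simp add: shift_def smul_def row_mult_def algebra_simps)
  have "row_mult w ?D = shift N (smul \<epsilon> v) (row_mult u ?D)"
    unfolding *(3) lin using * by (simp add: row_mult_inv)
  then have "v = shift N (smul \<epsilon> (row_mult w ?D)) (smul (- \<epsilon>) (row_mult u ?D))"
    using *(2) by (cases v) (auto simp: shift_def smul_def algebra_simps)
  then show ?thesis using * unfolding row_equiv_def by blast
qed

lemma row_equiv_trans:
  assumes "row_equiv N v w" "row_equiv N w x" shows "row_equiv N v x"
proof -
  obtain C \<epsilon> u where 1: "C \<in> G" "\<epsilon> \<in> {1, - 1}" "w = shift N (smul \<epsilon> (row_mult v C)) u"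
    using assms(1) unfolding row_equiv_def by blast
  obtain C' \<epsilon>' u' where 2: "C' \<in> G" "\<epsilon>' \<in> {1, - 1}" "x = shift N (smul \<epsilon>' (row_mult w C')) u'"
    using assms(2) unfolding row_equiv_def by blast
  have lin: "row_mult (shift N (smul \<epsilon> p) u) C' = shift N (smul \<epsilon> (row_mult p C')) (row_mult u C')" for p
    by (cases p; cases u) (simp add: shift_def smul_def row_mult_def algebra_simps)
  have "row_mult w C' = shift N (smul \<epsilon> (row_mult v (C ** C'))) (row_mult u C')"
    unfolding 1(3) lin by (simp add: row_mult_mult)
  then have "x = shift N (smul (\<epsilon>' * \<epsilon>) (row_mult v (C ** C'))) (smul \<epsilon>' (row_mult u C') + u')"
    using 2(3) by (simp add: shift_def smul_def algebra_simps)
  moreover have "C ** C' \<in> G" "\<epsilon>' * \<epsilon> \<in> {1, - 1}" using 1 2 by auto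
  ultimately show ?thesis unfolding row_equiv_def by blast
qed

text \<open>The combination of torsion values with coefficients \<open>\<mu>\<close> has at \<open>A\<close> the value
  \<open>\<Sum>b. class_sum N b * \<mu> (b v)\<close> with \<open>v\<close> the bottom row of the inverse of \<open>A\<close>, up to a constant
  that does not depend on \<open>A\<close>. So \<open>\<mu>\<close> is found by inverting the class sums; its invariance under
  \<open>row_equiv\<close> makes the combination invariant under \<open>G\<close>.\<close>

lemma weight_two_form:
  assumes N: "N \<ge> 3" "int level dvd N"
    and bounded: "\<And>v. norm (\<Phi> v) \<le> C" and \<Phi>: "\<And>v w. row_equiv N v w \<Longrightarrow> \<Phi> v = (\<Phi> w :: complex)"
  obtains f K where "f \<in> modular_forms 2 G"
    "\<And>A. A \<in> carrier SL2Z \<Longrightarrow> cusp_value 2 f A = \<Phi> (bottom_row (SL2Z_inv A)) + K"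
proof -
  have N1: "N \<ge> 1" using N by simp
  obtain \<mu> where \<mu>: "\<And>v w. row_equiv N v w \<Longrightarrow> \<mu> v = \<mu> w"
    and eq: "\<And>v. (\<Sum>b\<in>{1..N - 1}. of_real (class_sum N b) * \<mu> (smul b v)) = \<Phi> v"
    using solve_class_sum_equation[where R = "row_equiv N" and \<Phi> = \<Phi>, OF N(1) bounded row_equiv_scale row_equiv_neg \<Phi>]
    by blast
  have periodic: "\<mu> (shift N v w) = \<mu> v" for v w
    using \<mu>[OF row_equiv_shift] by simp
  have inv: "\<forall>A\<in>G. \<forall>\<tau>\<in>\<H>. slash 2 (wp_comb N \<mu>) A \<tau> = wp_comb N \<mu> \<tau>"
  proof (intro ballI)
    fix A \<tau> assume A: "A \<in> G" and \<tau>: "\<tau> \<in> \<H>"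
    have "\<mu> (row_mult u (SL2Z_inv A)) = \<mu> u" for u
      using \<mu>[OF row_equiv_mult[OF inv_in[OF A]]] by simp
    then show "slash 2 (wp_comb N \<mu>) A \<tau> = wp_comb N \<mu> \<tau>"
      using slash_wp_comb[of N \<mu> A \<tau>] N1 periodic A \<tau> by simp
  qed
  define K where "K = - of_real (class_sum N 0) * (\<Sum>v\<in>residues N. \<mu> v)"
  have lim: "(slash 2 (wp_comb N \<mu>) A \<longlongrightarrow> \<Phi> (bottom_row (SL2Z_inv A)) + K) at_ioo" if A: "A \<in> carrier SL2Z" for A
  proof -
    let ?\<mu> = "\<lambda>u. \<mu> (row_mult u (SL2Z_inv A))"
    have "(\<Sum>v\<in>residues N. ?\<mu> v) = (\<Sum>v\<in>residues N. \<mu> (red N (row_mult v (SL2Z_inv A))))"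
      by (metis periodic shift_red)
    also have "\<dots> = (\<Sum>v\<in>residues N. \<mu> v)" using A by (intro sum_residues_row_mult N1) simp
    finally have "(wp_comb N ?\<mu> \<longlongrightarrow> \<Phi> (bottom_row (SL2Z_inv A)) + K) at_ioo"
      using wp_comb_tendsto[OF N1, of ?\<mu>] by (simp add: row_mult_axis eq K_def)
    then show ?thesis
      by (rule Lim_transform_eventually)
        (use eventually_in_H_at_ioo in eventually_elim, simp add: slash_wp_comb[OF N1 periodic A])
  qed
  have "wp_comb N \<mu> holomorphic_on \<H>"
  proof -
    have "wp N v holomorphic_on \<H>" if "v \<in> residues N" for v
    proof -
      interpret dominated_family "wp_term N v" UNIV by (rule dominated_wp[OF N1 that])
      show ?thesis by (rule holomorphic_transform[OF holomorphic_infsum]) (simp add: wp_def)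
    qed
    then show ?thesis unfolding wp_comb_def[abs_def] by (intro holomorphic_intros)
  qed
  moreover have "wp_comb N \<mu> \<tau> = 0" if "\<tau> \<notin> \<H>" for \<tau> using that by (simp add: wp_comb_def wp_def)
  moreover have "\<forall>A\<in>carrier SL2Z. \<exists>L. (slash 2 (wp_comb N \<mu>) A \<longlongrightarrow> L) at_ioo" using lim by blast
  ultimately have "wp_comb N \<mu> \<in> modular_forms 2 G"
    unfolding modular_forms_iff using inv by blast
  then show ?thesis using that cusp_value_eqI[OF lim] by blast
qed

end

section \<open>The residue relation in weight two\<close>

text \<open>A primitive \<open>F\<close> of a weight two form of level one is invariant under \<open>S\<close>: the difference
  \<open>F (S \<tau>) - F \<tau>\<close> has derivative zero and vanishes at the fixed point \<open>\<i>\<close>. The translation \<open>T\<close> and \<open>S\<close>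
  agree at the corner \<open>\<rho>\<close> of the fundamental domain, so the constant \<open>F (\<tau> + 1) - F \<tau>\<close> is zero as
  well; but it is also the limit of the form at infinity.\<close>

lemma weight_two_level_one_limit:
  assumes hol: "f holomorphic_on \<H>" and inv: "\<And>A \<tau>. A \<in> carrier SL2Z \<Longrightarrow> \<tau> \<in> \<H> \<Longrightarrow> slash 2 f A \<tau> = f \<tau>"
    and lim: "(f \<longlongrightarrow> L) at_ioo"
  shows "L = 0"
proof -
  obtain F where F: "\<And>\<tau>. \<tau> \<in> \<H> \<Longrightarrow> (F has_field_derivative f \<tau>) (at \<tau> within \<H>)"
    using holomorphic_convex_primitive'[OF convex_H open_H hol] by blast
  have F': "(F has_field_derivative f \<tau>) (at \<tau>)" if "\<tau> \<in> \<H>" for \<tau>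
    using F[OF that] that by (simp add: at_within_open[OF _ open_H])
  have cocycle: "F (moebius A \<tau>) - F \<tau> = F (moebius A \<sigma>) - F \<sigma>"
    if A: "A \<in> carrier SL2Z" and H: "\<tau> \<in> \<H>" "\<sigma> \<in> \<H>" for A \<tau> \<sigma>
  proof -
    have der: "((\<lambda>\<tau>. F (moebius A \<tau>) - F \<tau>) has_field_derivative 0) (at z within \<H>)" if z: "z \<in> \<H>" for z
    proof -
      have "((\<lambda>\<tau>. F (moebius A \<tau>)) has_field_derivative f (moebius A z) * (1 / (aut_factor A z)\<^sup>2)) (at z)"
        using A z by (intro DERIV_chain2[OF F' moebius_deriv]) auto
      then have "((\<lambda>\<tau>. F (moebius A \<tau>) - F \<tau>) has_field_derivative
          f (moebius A z) * (1 / (aut_factor A z)\<^sup>2) - f z) (at z)"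
        by (intro DERIV_diff F' z)
      moreover have "f (moebius A z) * (1 / (aut_factor A z)\<^sup>2) - f z = 0"
        using inv[OF A z] by (simp add: slash_def)
      ultimately show ?thesis by (metis has_field_derivative_at_within)
    qed
    from has_field_derivative_zero_constant[OF convex_H der]
    obtain c where "\<forall>z\<in>\<H>. F (moebius A z) - F z = c" by auto
    then show ?thesis using H by simp
  qed
  have "F (moebius S_mat \<i>) - F \<i> = 0"
    by (simp add: moebius_S_mat)
  then have S: "F (moebius S_mat \<tau>) = F \<tau>" if "\<tau> \<in> \<H>" for \<tau>
    using cocycle[OF S_mat_in that, of \<i>] by (simp add: in_H_iff)
  define \<rho> where "\<rho> = Complex (- 1 / 2) (sqrt 3 / 2)"
  have \<rho>H: "\<rho> \<in> \<H>" by (simp add: \<rho>_def in_H_iff)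
  have "\<rho> * (\<rho> + 1) = - 1"
    by (simp add: \<rho>_def complex_eq_iff)
  moreover have "\<rho> \<noteq> 0" using \<rho>H by (auto simp: in_H_iff)
  ultimately have "- 1 / \<rho> = \<rho> + 1" by (metis nonzero_mult_div_cancel_left)
  then have "moebius S_mat \<rho> = moebius (transl 1) \<rho>" by (simp add: moebius_S_mat)
  then have "F (moebius (transl 1) \<rho>) - F \<rho> = 0" using S[OF \<rho>H] by simp
  then have T: "F (\<tau> + 1) = F \<tau>" if "\<tau> \<in> \<H>" for \<tau>
    using cocycle[OF transl_in_SL2Z that \<rho>H, of 1] by simp
  show "L = 0"
  proof (rule ccontr)
    assume "L \<noteq> 0"
    then have "eventually (\<lambda>\<tau>. dist (f \<tau>) L < norm L / 2) at_ioo"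
      using tendstoD[OF lim, of "norm L / 2"] by simp
    then obtain Y where Y: "\<And>\<tau>. Im \<tau> \<ge> Y \<Longrightarrow> dist (f \<tau>) L < norm L / 2"
      unfolding eventually_at_ioo by blast
    define X where "X = {\<tau>. Im \<tau> \<ge> max Y 1}"
    have XH: "X \<subseteq> \<H>" by (auto simp: X_def in_H_iff)
    have "convex X" unfolding X_def by (rule convex_halfspace_Im_ge)
    define \<sigma> where "\<sigma> = Complex 0 (max Y 1)"
    \<comment> \<open>Over one period \<open>F \<tau> - L \<tau>\<close> changes by \<open>- L\<close>, although its derivative is smaller than \<open>L\<close> in norm.\<close>
    have "norm ((F (\<sigma> + 1) - L * (\<sigma> + 1)) - (F \<sigma> - L * \<sigma>)) \<le> norm L / 2 * norm ((\<sigma> + 1) - \<sigma>)"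
    proof (rule field_differentiable_bound[OF \<open>convex X\<close>])
      fix z assume z: "z \<in> X"
      then have "((\<lambda>\<tau>. F \<tau> - L * \<tau>) has_field_derivative f z - L * 1) (at z)"
        using XH by (intro DERIV_diff F' DERIV_cmult DERIV_ident) auto
      then show "((\<lambda>\<tau>. F \<tau> - L * \<tau>) has_field_derivative f z - L) (at z within X)"
        by (simp add: has_field_derivative_at_within)
      show "norm (f z - L) \<le> norm L / 2" using Y[of z] z by (simp add: X_def dist_norm)
    qed (simp_all add: X_def \<sigma>_def)
    moreover have "F (\<sigma> + 1) = F \<sigma>" by (rule T) (simp add: \<sigma>_def in_H_iff)
    ultimately have "norm L \<le> norm L / 2" by (simp add: algebra_simps)
    then show False using \<open>L \<noteq> 0\<close> by simp
  qed
qed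

context congruence_group
begin

text \<open>The sum of the slashed forms over the cosets has level one.\<close>

lemma sum_cusp_values_weight_two:
  assumes f: "f \<in> modular_forms 2 G"
  shows "(\<Sum>c\<in>cosets. cusp_value 2 f (coset_rep c)) = 0"
proof -
  define g where "g \<tau> = (\<Sum>c\<in>cosets. slash 2 f (coset_rep c) \<tau>)" for \<tau>
  show ?thesis
  proof (rule weight_two_level_one_limit[of g])
    show "g holomorphic_on \<H>"
      unfolding g_def using coset_rep modular_formsD(1)[OF f]
      by (intro holomorphic_on_sum slash_holomorphic) auto
    show "(g \<longlongrightarrow> (\<Sum>c\<in>cosets. cusp_value 2 f (coset_rep c))) at_ioo"
      unfolding g_def using coset_rep by (intro tendsto_sum modular_formsD(4)[OF f]) auto
    fix A \<tau> assume A: "A \<in> carrier SL2Z" and \<tau>: "\<tau> \<in> \<H>"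
    have "slash 2 g A \<tau> = (\<Sum>c\<in>cosets. slash 2 (slash 2 f (coset_rep c)) A \<tau>)"
      unfolding g_def[abs_def] slash_sum by simp
    also have "\<dots> = (\<Sum>c\<in>cosets. slash 2 f (coset_rep c ** A) \<tau>)"
      using coset_rep A \<tau> by (intro sum.cong refl slash_mult[symmetric]) auto
    also have "\<dots> = (\<Sum>c\<in>cosets. slash 2 f (coset_rep c) \<tau>)"
    proof (rule sum_cosets_translate[OF A])
      fix C B assume C: "C \<in> G" and B: "B \<in> carrier SL2Z"
      show "slash 2 f (C ** B) \<tau> = slash 2 f B \<tau>"
        using slash_mult[OF in_carrier[OF C] B \<tau>]
          slash_cong[where A = B and \<tau> = \<tau>, OF modular_formsD(3)[OF f C] B \<tau>] by simp
    qed
    finally show "slash 2 g A \<tau> = g \<tau>" by (simp add: g_def)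
  qed
qed

section \<open>Cusps as classes of matrices\<close>

(* From here on the action enters through its composition law and the stabilizer of infinity only. *)
declare proj_act.simps [simp del]

definition cusp_of :: "int ^ 2 ^ 2 \<Rightarrow> rat option set" where
  "cusp_of A = {proj_act C (proj_act A None) | C. C \<in> G}"

lemma cusps_eq: "cusps G = cusp_of ` carrier SL2Z"
proof (intro equalityI subsetI)
  fix c assume "c \<in> cusps G"
  then obtain x where x: "c = {proj_act A x | A. A \<in> G}" by (auto simp: cusps_def)
  obtain A where "A \<in> carrier SL2Z" "proj_act A None = x" by (rule proj_act_None_surj)
  then show "c \<in> cusp_of ` carrier SL2Z" by (intro image_eqI[of _ _ A]) (auto simp: cusp_of_def x)
qed (auto simp: cusps_def cusp_of_def)

lemma cusp_of_eq_iff: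
  assumes A: "A \<in> carrier SL2Z" and B: "B \<in> carrier SL2Z"
  shows "cusp_of A = cusp_of B \<longleftrightarrow> (\<exists>C\<in>G. \<exists>n. A = C ** B ** transl n \<or> A = - (C ** B ** transl n))"
proof
  assume "cusp_of A = cusp_of B"
  moreover have "proj_act A None \<in> cusp_of A"
    unfolding cusp_of_def using one_in by (intro CollectI exI[of _ "mat 1"]) simp
  ultimately obtain C where C: "C \<in> G" "proj_act A None = proj_act C (proj_act B None)"
    by (auto simp: cusp_of_def)
  let ?M = "SL2Z_inv (C ** B) ** A"
  have "proj_act ?M None = None"
  proof -
    have "proj_act ?M None = proj_act (SL2Z_inv (C ** B)) (proj_act (C ** B) None)"
      using C A B by (simp add: proj_act_mult)
    then show ?thesis using C B by (simp add: proj_act_inverse)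
  qed
  then obtain n where "?M = transl n \<or> ?M = - transl n"
    using proj_act_None_eq_iff[of ?M] A B C by auto
  then have "(C ** B) ** ?M = (C ** B) ** transl n \<or> (C ** B) ** ?M = (C ** B) ** (- transl n)" by metis
  then show "\<exists>C\<in>G. \<exists>n. A = C ** B ** transl n \<or> A = - (C ** B ** transl n)"
    using C A B by (intro bexI[of _ C] exI[of _ n]) (simp_all add: SL2Z_inv_cancel_left uminus_mat_mult)
next
  assume "\<exists>C\<in>G. \<exists>n. A = C ** B ** transl n \<or> A = - (C ** B ** transl n)"
  then obtain C n where C: "C \<in> G" and "A = C ** (B ** transl n) \<or> A = C ** (B ** - transl n)"
    by (auto simp: uminus_mat_mult matrix_mul_assoc)
  then obtain P where P: "P = transl n \<or> P = - transl n" and AP: "A = C ** (B ** P)" by blast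
  have PS: "P \<in> carrier SL2Z" "proj_act P None = None" using P by (auto simp: proj_act_None_eq_iff)
  have x: "proj_act A None = proj_act C (proj_act B None)"
    using C B PS by (simp add: AP proj_act_mult)
  show "cusp_of A = cusp_of B"
  proof (intro equalityI subsetI)
    fix y assume "y \<in> cusp_of A"
    then obtain D where D: "D \<in> G" "y = proj_act D (proj_act C (proj_act B None))" by (auto simp: cusp_of_def x)
    then have "y = proj_act (D ** C) (proj_act B None)" using C by (simp add: proj_act_mult)
    then show "y \<in> cusp_of B" using C D unfolding cusp_of_def by blast
  next
    fix y assume "y \<in> cusp_of B"
    then obtain D where D: "D \<in> G" "y = proj_act D (proj_act B None)" by (auto simp: cusp_of_def)
    then have "y = proj_act (D ** SL2Z_inv C) (proj_act A None)" using C by (simp add: proj_act_mult x proj_act_inverse)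
    then show "y \<in> cusp_of A" using C D unfolding cusp_of_def by blast
  qed
qed

lemma cusp_of_mult_left: "C \<in> G \<Longrightarrow> A \<in> carrier SL2Z \<Longrightarrow> cusp_of (C ** A) = cusp_of A"
  by (subst cusp_of_eq_iff) (auto intro!: bexI[of _ C] exI[of _ 0])

lemma finite_cusps: "finite (cusps G)"
proof -
  have "cusps G = (\<lambda>c. cusp_of (coset_rep c)) ` cosets"
  proof (intro equalityI subsetI)
    fix x assume "x \<in> cusps G"
    then obtain A where A: "A \<in> carrier SL2Z" "x = cusp_of A" by (auto simp: cusps_eq)
    obtain C where "C \<in> G" "coset_rep (coset A) = C ** A" using coset_rep_of_coset[OF A(1)] .
    then show "x \<in> (\<lambda>c. cusp_of (coset_rep c)) ` cosets"
      using A by (intro image_eqI[of _ _ "coset A"]) (auto simp: cusp_of_mult_left cosets_def)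
  qed (use coset_rep in \<open>auto simp: cusps_eq\<close>)
  then show ?thesis using finite_cosets by simp
qed

definition cusp_rep :: "rat option set \<Rightarrow> int ^ 2 ^ 2" where
  "cusp_rep c = (SOME A. A \<in> carrier SL2Z \<and> cusp_of A = c)"

lemma cusp_rep:
  assumes "c \<in> cusps G" shows "cusp_rep c \<in> carrier SL2Z" "cusp_of (cusp_rep c) = c"
proof -
  have "\<exists>A. A \<in> carrier SL2Z \<and> cusp_of A = c" using assms by (auto simp: cusps_eq)
  from someI_ex[OF this] show "cusp_rep c \<in> carrier SL2Z" "cusp_of (cusp_rep c) = c"
    unfolding cusp_rep_def by auto
qed

lemma cusp_value_same_cusp:
  assumes f: "f \<in> modular_forms k G" and AB: "A \<in> carrier SL2Z" "B \<in> carrier SL2Z" "cusp_of A = cusp_of B"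
  shows "cusp_value k f A = cusp_value k f B \<or> cusp_value k f A = (- 1) ^ k * cusp_value k f B"
proof -
  obtain C n where C: "C \<in> G" "A = C ** B ** transl n \<or> A = - (C ** B ** transl n)"
    using AB cusp_of_eq_iff by blast
  have "cusp_value k f (C ** B ** transl n) = cusp_value k f B"
    using C AB f by (simp add: cusp_value_transl cusp_value_left_invariant)
  then show ?thesis using C AB f by (auto simp: cusp_value_uminus)
qed

lemma cusp_value_even:
  assumes "f \<in> modular_forms k G" "A \<in> carrier SL2Z" "B \<in> carrier SL2Z" "cusp_of A = cusp_of B" "even k"
  shows "cusp_value k f A = cusp_value k f B"
  using cusp_value_same_cusp[OF assms(1-4)] assms(5) by auto

lemma cusp_value_zero_same_cusp:
  assumes "f \<in> modular_forms k G" "A \<in> carrier SL2Z" "B \<in> carrier SL2Z" "cusp_of A = cusp_of B"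
    "cusp_value k f B = 0"
  shows "cusp_value k f A = 0"
  using cusp_value_same_cusp[OF assms(1-4)] assms(5) by auto

subsection \<open>Regularity\<close>

text \<open>This property makes forms of odd weight vanish at the cusp. If \<open>-1\<close> lies in \<open>G\<close>, every \<open>A\<close> has it; otherwise it
  means that the cusp of \<open>A\<close> is irregular.\<close>

definition irregular :: "int ^ 2 ^ 2 \<Rightarrow> bool" where
  "irregular A \<longleftrightarrow> (\<exists>C\<in>G. \<exists>n. SL2Z_inv A ** C ** A = - transl n)"

lemma irregular_cusp_value:
  assumes f: "f \<in> modular_forms k G" and A: "A \<in> carrier SL2Z" and k: "odd k" and irr: "irregular A"
  shows "cusp_value k f A = 0"
proof -
  obtain C n where C: "C \<in> G" "SL2Z_inv A ** C ** A = - transl n" using irr by (auto simp: irregular_def)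
  have "A ** (SL2Z_inv A ** C ** A) = A ** (- transl n)" by (simp only: C)
  then have "C ** A = - (A ** transl n)"
    using A by (simp add: uminus_mat_mult SL2Z_inv_cancel_left flip: matrix_mul_assoc)
  then have "cusp_value k f A = cusp_value k f (- (A ** transl n))"
    using cusp_value_left_invariant[OF f C(1) A] by simp
  also have "\<dots> = - cusp_value k f A"
    using A f k by (simp add: cusp_value_uminus cusp_value_transl)
  finally show ?thesis by simp
qed

lemma conj_stabilizer:
  assumes A: "A \<in> carrier SL2Z"
  shows "{inv\<^bsub>SL2Z\<^esub> A \<otimes>\<^bsub>SL2Z\<^esub> B \<otimes>\<^bsub>SL2Z\<^esub> A | B. B \<in> cusp_stabilizer G (proj_act A None)} =
    {M. (\<exists>C\<in>G. SL2Z_inv A ** C ** A = M) \<and> (\<exists>n. M = transl n \<or> M = - transl n)}"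
proof -
  have "C \<in> cusp_stabilizer G (proj_act A None) \<longleftrightarrow>
      (\<exists>n. SL2Z_inv A ** C ** A = transl n \<or> SL2Z_inv A ** C ** A = - transl n)" if C: "C \<in> G" for C
  proof -
    have "proj_act C (proj_act A None) = proj_act A None \<longleftrightarrow> proj_act (SL2Z_inv A ** C ** A) None = None"
    proof -
      have "proj_act (SL2Z_inv A ** C ** A) None = proj_act (SL2Z_inv A) (proj_act C (proj_act A None))"
        using A C by (simp add: proj_act_mult)
      then show ?thesis using proj_act_inverse[OF A] by metis
    qed
    then show ?thesis using A C proj_act_None_eq_iff[of "SL2Z_inv A ** C ** A"] by (simp add: cusp_stabilizer_def)
  qed
  then show ?thesis using A by (auto simp: inv_SL2Z cusp_stabilizer_def)
qed

lemma transl_eq_iff: "transl m = transl n \<longleftrightarrow> m = n" "transl m \<noteq> - transl n"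
  by (auto simp: mat2_eq_iff)

lemma generate_transl: "generate SL2Z {transl h} = range (\<lambda>n. transl (n * h))"
  using SL2Z.generate_pow[OF transl_in_SL2Z, of h] by (auto simp: transl_int_pow)

text \<open>The stabilizer of the cusp, moved to infinity, consists of translations only. It is nontrivial, as it
  contains a translation by the level, so it is generated by its smallest positive translation.\<close>

lemma regular_if_not_irregular:
  assumes A: "A \<in> carrier SL2Z" and reg: "\<not> irregular A"
  shows "regular_cusp_point G (proj_act A None)"
proof -
  define H where "H = {n. \<exists>C\<in>G. SL2Z_inv A ** C ** A = transl n}"
  have add: "m + n \<in> H" if "m \<in> H" "n \<in> H" for m n
  proof -
    obtain C D where "C \<in> G" "SL2Z_inv A ** C ** A = transl m" "D \<in> G" "SL2Z_inv A ** D ** A = transl n"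
      using \<open>m \<in> H\<close> \<open>n \<in> H\<close> by (auto simp: H_def)
    then have "SL2Z_inv A ** (C ** D) ** A = transl (m + n)"
      using A by (metis SL2Z_inv_cancel_left(2) matrix_mul_assoc transl_mult)
    moreover have "C ** D \<in> G" using \<open>C \<in> G\<close> \<open>D \<in> G\<close> by (rule mult_in)
    ultimately show ?thesis unfolding H_def by blast
  qed
  have neg: "- m \<in> H" if mH: "m \<in> H" for m
  proof -
    obtain C where "C \<in> G" "SL2Z_inv A ** C ** A = transl m" using mH by (auto simp: H_def)
    then have "SL2Z_inv A ** SL2Z_inv C ** A = transl (- m)"
      by (metis SL2Z_inv_inv SL2Z_inv_mult SL2Z_inv_transl matrix_mul_assoc)
    then show ?thesis using inv_in[OF \<open>C \<in> G\<close>] unfolding H_def by blast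
  qed
  have zero: "0 \<in> H"
    unfolding H_def using A by (intro CollectI bexI[of _ "mat 1"]) (auto simp: SL2Z_inv_cancel)
  have levelH: "int level \<in> H"
  proof -
    have "SL2Z_inv A ** (A ** transl (int level) ** SL2Z_inv A) ** A = transl (int level)"
      using A by (simp add: SL2Z_inv_cancel_left SL2Z_inv_cancel_right matrix_mul_assoc SL2Z_inv_cancel)
    then show ?thesis unfolding H_def using conj_transl_in_G[OF A dvd_refl] by blast
  qed
  define h where "h = (LEAST n. n \<ge> 1 \<and> int n \<in> H)"
  have h: "h \<ge> 1" "int h \<in> H"
    unfolding h_def using LeastI[of "\<lambda>n. n \<ge> 1 \<and> int n \<in> H" level] level(1) levelH by auto
  have mult: "n * int h \<in> H" for n
  proof (induction n rule: int_induct[where k = 0])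
    case (step1 i) then show ?case using add[OF step1(2) h(2)] by (simp add: algebra_simps)
  next
    case (step2 i) then show ?case using add[OF step2(2) neg[OF h(2)]] by (simp add: algebra_simps)
  qed (use zero in simp)
  have H: "H = range (\<lambda>n. n * int h)"
  proof (intro equalityI subsetI)
    fix n assume n: "n \<in> H"
    have "n + - (n div int h) * int h \<in> H" using add[OF n mult] .
    then have r: "n mod int h \<in> H" by (simp add: minus_div_mult_eq_mod)
    have "n mod int h = 0"
    proof (rule ccontr)
      assume "n mod int h \<noteq> 0"
      moreover have "0 \<le> n mod int h" using h by simp
      ultimately have pos: "0 < n mod int h" by linarith
      then have "nat (n mod int h) \<ge> 1 \<and> int (nat (n mod int h)) \<in> H"
        using r by (simp add: Suc_le_eq)
      then have "h \<le> nat (n mod int h)" unfolding h_def by (rule Least_le)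
      moreover have "nat (n mod int h) < h" using h pos by (simp add: nat_less_iff)
      ultimately show False by simp
    qed
    then show "n \<in> range (\<lambda>n. n * int h)" by (auto simp: mod_eq_0_iff_dvd dvd_def mult.commute)
  qed (use mult in auto)
  have "{inv\<^bsub>SL2Z\<^esub> A \<otimes>\<^bsub>SL2Z\<^esub> B \<otimes>\<^bsub>SL2Z\<^esub> A | B. B \<in> cusp_stabilizer G (proj_act A None)} = transl ` H"
    unfolding conj_stabilizer[OF A] H_def using reg by (auto simp: irregular_def)
  also have "\<dots> = generate SL2Z {T_mat [^]\<^bsub>SL2Z\<^esub> h}"
    unfolding T_mat_pow generate_transl H by (simp add: image_image)
  finally show ?thesis
    unfolding regular_cusp_point_def using A h by auto
qed

text \<open>The regular stabilizers without \<open>-1\<close> consist of translations. The definition of regularity may refer to another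
  point of the cusp and another matrix than \<open>A\<close>; both are related to \<open>A\<close> by an element of \<open>G\<close>, a
  translation and a sign, and conjugation by these preserves negatives of translations.\<close>

lemma not_irregular_if_regular:
  assumes A: "A \<in> carrier SL2Z" and x: "x \<in> cusp_of A" and reg: "regular_cusp_point G x"
    and one: "- mat 1 \<notin> G"
  shows "\<not> irregular A"
proof
  assume "irregular A"
  then obtain C n where C: "C \<in> G" "SL2Z_inv A ** C ** A = - transl n" by (auto simp: irregular_def)
  obtain B h where B: "B \<in> carrier SL2Z" "proj_act B None = x"
    and gen: "{inv\<^bsub>SL2Z\<^esub> B \<otimes>\<^bsub>SL2Z\<^esub> M \<otimes>\<^bsub>SL2Z\<^esub> B | M. M \<in> cusp_stabilizer G x}
       \<in> {generate SL2Z {- mat 1, T_mat [^]\<^bsub>SL2Z\<^esub> (h::nat)}, generate SL2Z {T_mat [^]\<^bsub>SL2Z\<^esub> h}}"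
    using reg unfolding regular_cusp_point_def by blast
  define S where "S = {M. (\<exists>C\<in>G. SL2Z_inv B ** C ** B = M) \<and> (\<exists>n. M = transl n \<or> M = - transl n)}"
  have S: "S \<in> {generate SL2Z {- mat 1, T_mat [^]\<^bsub>SL2Z\<^esub> h}, generate SL2Z {T_mat [^]\<^bsub>SL2Z\<^esub> h}}"
    using gen conj_stabilizer[OF B(1)] by (simp add: S_def B(2))
  have "- mat 1 \<notin> S"
  proof
    assume "- mat 1 \<in> S"
    then obtain D where D: "D \<in> G" "SL2Z_inv B ** D ** B = - mat 1" by (auto simp: S_def)
    have "B ** (SL2Z_inv B ** D ** B) ** SL2Z_inv B = B ** (- mat 1) ** SL2Z_inv B" by (simp only: D)
    then have "D = - mat 1"
      using B(1) by (simp add: uminus_mat_mult SL2Z_inv_cancel SL2Z_inv_cancel_left matrix_mul_assoc SL2Z_inv_cancel_right)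
    then show False using D one by simp
  qed
  moreover have "- mat 1 \<in> generate SL2Z {- mat 1, T_mat [^]\<^bsub>SL2Z\<^esub> h}" by (rule generate.incl) simp
  ultimately have Sgen: "S = range (\<lambda>n. transl (n * int h))"
    using S by (auto simp: T_mat_pow generate_transl)
  have "cusp_of B = cusp_of A"
  proof -
    obtain D where D: "D \<in> G" "x = proj_act D (proj_act A None)" using x by (auto simp: cusp_of_def)
    then have "proj_act B None = proj_act (D ** A) None" using A B by (simp add: proj_act_mult)
    then have "cusp_of B = cusp_of (D ** A)" by (simp add: cusp_of_def)
    then show ?thesis using D A by (simp add: cusp_of_mult_left)
  qed
  then obtain D m where D: "D \<in> G" and AD: "A = D ** B ** transl m \<or> A = - (D ** B ** transl m)"
    using cusp_of_eq_iff[OF A B(1)] by auto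
  from AD have "SL2Z_inv A ** C ** A = SL2Z_inv (D ** B ** transl m) ** C ** (D ** B ** transl m)"
  proof
    assume "A = - (D ** B ** transl m)"
    moreover have "SL2Z_inv (- X) = - SL2Z_inv X" for X by (simp add: mat2_eq_iff)
    ultimately show ?thesis by (simp add: uminus_mat_mult)
  qed simp
  also have "\<dots> = transl (- m) ** (SL2Z_inv B ** (SL2Z_inv D ** C ** D) ** B) ** transl m"
    by (simp add: SL2Z_inv_mult matrix_mul_assoc)
  finally have "transl m ** (- transl n) ** transl (- m) =
      transl m ** (transl (- m) ** (SL2Z_inv B ** (SL2Z_inv D ** C ** D) ** B) ** transl m) ** transl (- m)"
    by (simp only: C)
  also have "transl m ** (transl (- m) ** Y ** transl m) ** transl (- m) = Y" for Y
  proof -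
    have "transl m ** (transl (- m) ** Y ** transl m) ** transl (- m) =
        (transl m ** transl (- m)) ** Y ** (transl m ** transl (- m))"
      by (simp only: matrix_mul_assoc)
    then show ?thesis by (simp add: transl_mult)
  qed
  also have "transl m ** (- transl n) ** transl (- m) = - transl n"
    by (simp add: uminus_mat_mult transl_mult)
  finally have "SL2Z_inv B ** (SL2Z_inv D ** C ** D) ** B = - transl n" by (rule sym)
  moreover have "SL2Z_inv D ** C ** D \<in> G" using C D by blast
  ultimately have "- transl n \<in> S" unfolding S_def by blast
  then show False unfolding Sgen using transl_eq_iff(2) by (metis imageE)
qed

lemma cusp_of_regular_iff:
  assumes "A \<in> carrier SL2Z" "- mat 1 \<notin> G"
  shows "cusp_of A \<in> regular_cusps G \<longleftrightarrow> \<not> irregular A"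
proof
  assume "cusp_of A \<in> regular_cusps G"
  then show "\<not> irregular A" using not_irregular_if_regular[OF assms(1) _ _ assms(2)] by (auto simp: regular_cusps_def)
next
  assume "\<not> irregular A"
  then have "regular_cusp_point G (proj_act A None)" by (rule regular_if_not_irregular[OF assms(1)])
  moreover have "proj_act A None \<in> cusp_of A"
    unfolding cusp_of_def using one_in by (intro CollectI exI[of _ "mat 1"]) simp
  ultimately show "cusp_of A \<in> regular_cusps G"
    using assms(1) by (auto simp: regular_cusps_def cusps_eq)
qed

section \<open>Values of the constructed forms\<close>

lemma eis_values:
  assumes k: "k \<ge> 3" and A: "A \<in> carrier SL2Z" and B: "B \<in> carrier SL2Z"
  shows "cusp_of B \<noteq> cusp_of A \<Longrightarrow> cusp_value k (eis k (eis_rows (SL2Z_inv A))) B = 0"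
    and "cusp_value k (eis k (eis_rows (SL2Z_inv A))) A = 1 + (if irregular A then (- 1) ^ k else 0)"
proof -
  have "cusp_of B = cusp_of A" if "C \<in> G" "SL2Z_inv A ** C ** B = transl n \<or> SL2Z_inv A ** C ** B = - transl n" for C n
  proof -
    have "A ** (SL2Z_inv A ** C ** B) = A ** transl n \<or> A ** (SL2Z_inv A ** C ** B) = A ** (- transl n)"
      using that(2) by metis
    then have CB: "C ** B = A ** transl n \<or> C ** B = - (A ** transl n)"
      using A by (simp add: SL2Z_inv_cancel_left uminus_mat_mult flip: matrix_mul_assoc)
    then have "\<exists>D\<in>G. \<exists>n. C ** B = D ** A ** transl n \<or> C ** B = - (D ** A ** transl n)"
      by (intro bexI[of _ "mat 1"] exI[of _ n]) auto
    then have "cusp_of (C ** B) = cusp_of A"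
      using cusp_of_eq_iff[of "C ** B" A] A B that(1) by simp
    then show ?thesis using cusp_of_mult_left[OF that(1) B] by simp
  qed
  then show "cusp_of B \<noteq> cusp_of A \<Longrightarrow> cusp_value k (eis k (eis_rows (SL2Z_inv A))) B = 0"
    using eis_modular(2)[OF k SL2Z_inv_closed[OF A] B] by auto
  have "\<exists>C\<in>G. \<exists>n. SL2Z_inv A ** C ** A = transl n"
    using A by (intro bexI[of _ "mat 1"] exI[of _ 0]) (auto simp: SL2Z_inv_cancel)
  then show "cusp_value k (eis k (eis_rows (SL2Z_inv A))) A = 1 + (if irregular A then (- 1) ^ k else 0)"
    using eis_modular(2)[OF k SL2Z_inv_closed[OF A] A] by (simp add: irregular_def)
qed

text \<open>A matrix is determined by its bottom row up to a translation from the left. The same holds modulo the level,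
  where the remaining error is absorbed by \<open>G\<close>, which contains the principal congruence subgroup.\<close>

lemma cusp_of_eq_iff_row_equiv:
  assumes A: "A \<in> carrier SL2Z" and B: "B \<in> carrier SL2Z" and N: "int level dvd N"
  shows "cusp_of A = cusp_of B \<longleftrightarrow> row_equiv N (bottom_row (SL2Z_inv B)) (bottom_row (SL2Z_inv A))"
proof
  assume "cusp_of A = cusp_of B"
  then obtain C n where C: "C \<in> G" "A = C ** B ** transl n \<or> A = - (C ** B ** transl n)"
    using A B cusp_of_eq_iff by blast
  have neg: "SL2Z_inv (- X) = - SL2Z_inv X" for X by (simp add: mat2_eq_iff)
  have row: "bottom_row (SL2Z_inv (C ** B ** transl n)) = row_mult (bottom_row (SL2Z_inv B)) (SL2Z_inv C)"
    by (simp add: SL2Z_inv_mult row_mult_bottom_row) (simp add: bottom_row_def)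
  from C(2) have "bottom_row (SL2Z_inv A) = smul 1 (row_mult (bottom_row (SL2Z_inv B)) (SL2Z_inv C)) \<or>
      bottom_row (SL2Z_inv A) = smul (- 1) (row_mult (bottom_row (SL2Z_inv B)) (SL2Z_inv C))"
  proof
    assume "A = C ** B ** transl n"
    then show ?thesis using row by (simp add: smul_def)
  next
    assume "A = - (C ** B ** transl n)"
    then show ?thesis using row neg by (simp add: smul_def bottom_row_def prod_eq_iff)
  qed
  then obtain \<epsilon> where \<epsilon>: "\<epsilon> \<in> {1, - 1}"
    and "bottom_row (SL2Z_inv A) = smul \<epsilon> (row_mult (bottom_row (SL2Z_inv B)) (SL2Z_inv C))" by blast
  then have "bottom_row (SL2Z_inv A) = shift N (smul \<epsilon> (row_mult (bottom_row (SL2Z_inv B)) (SL2Z_inv C))) (0, 0)"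
    by (simp add: shift_def)
  then show "row_equiv N (bottom_row (SL2Z_inv B)) (bottom_row (SL2Z_inv A))"
    unfolding row_equiv_def using inv_in[OF C(1)] \<epsilon> by blast
next
  assume "row_equiv N (bottom_row (SL2Z_inv B)) (bottom_row (SL2Z_inv A))"
  then obtain C \<epsilon> u where C: "C \<in> G" and \<epsilon>: "\<epsilon> \<in> {1, - 1}"
    and eq: "bottom_row (SL2Z_inv A) = shift N (smul \<epsilon> (bottom_row (SL2Z_inv B ** C))) u"
    unfolding row_equiv_def row_mult_bottom_row by blast
  define X where "X = (if \<epsilon> = 1 then SL2Z_inv B ** C else - (SL2Z_inv B ** C))"
  have X: "X \<in> carrier SL2Z" using B C by (auto simp: X_def)
  have "bottom_row X = smul \<epsilon> (bottom_row (SL2Z_inv B ** C))"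
    using \<epsilon> by (auto simp: X_def bottom_row_def smul_def)
  with eq have "bottom_row (SL2Z_inv A) = shift N (bottom_row X) u" by simp
  then have "SL2Z_inv A $2$1 = X$2$1 + N * fst u" "SL2Z_inv A $2$2 = X$2$2 + N * snd u"
    by (simp_all add: bottom_row_def shift_def)
  then have cong: "int level dvd SL2Z_inv A $2$1 - X$2$1" "int level dvd SL2Z_inv A $2$2 - X$2$2"
    using N by simp_all
  define M where "M = SL2Z_inv A ** SL2Z_inv X"
  have M: "M \<in> carrier SL2Z" using A X by (simp add: M_def)
  have dX: "X$1$1 * X$2$2 = 1 + X$1$2 * X$2$1" using X by (simp add: SL2Z_iff)
  have "M$2$1 = (SL2Z_inv A $2$1 - X$2$1) * X$2$2 + (SL2Z_inv A $2$2 - X$2$2) * (- X$2$1)"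
    "M$2$2 - 1 = (SL2Z_inv A $2$1 - X$2$1) * (- X$1$2) + (SL2Z_inv A $2$2 - X$2$2) * X$1$1"
    unfolding M_def using dX by (simp_all add: algebra_simps)
  then have M2: "int level dvd M$2$1" "int level dvd M$2$2 - 1"
    using cong by (metis dvd_add dvd_mult2)+
  have dM: "M$1$1 * M$2$2 = 1 + M$1$2 * M$2$1" using M by (simp add: SL2Z_iff)
  \<comment> \<open>As the bottom row of \<open>M\<close> is \<open>(0, 1)\<close> modulo the level, removing the translation by the upper right
    entry leaves a matrix congruent to one.\<close>
  define t where "t = M$1$2"
  define E where "E = transl (- t) ** M"
  have E: "E \<in> carrier SL2Z" using M by (simp add: E_def)
  have "E$1$1 - 1 = (M$2$2 - 1) * (- M$1$1)"
    "E$1$2 = (M$2$2 - 1) * (- t)" "E$2$1 = M$2$1" "E$2$2 - 1 = M$2$2 - 1"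
    unfolding E_def t_def using dM by (simp_all add: algebra_simps)
  then have dE: "int level dvd E$1$1 - 1" "int level dvd E$1$2" "int level dvd E$2$1" "int level dvd E$2$2 - 1"
    using M2 by simp_all
  let ?D = "SL2Z_inv X ** E ** SL2Z_inv (SL2Z_inv X)"
  have D: "?D \<in> G" by (rule conj_congruent_in_G[OF SL2Z_inv_closed[OF X] E dE])
  have "SL2Z_inv A = M ** X" unfolding M_def using X by (simp add: SL2Z_inv_cancel_right)
  also have "M = transl t ** E"
    unfolding E_def using SL2Z_inv_cancel_left(2)[OF transl_in_SL2Z, of t M] by simp
  finally have "SL2Z_inv (SL2Z_inv A) = SL2Z_inv (transl t ** E ** X)" by simp
  then have "A = SL2Z_inv X ** SL2Z_inv E ** transl (- t)"
    by (simp add: SL2Z_inv_mult matrix_mul_assoc)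
  also have "SL2Z_inv X ** SL2Z_inv E = SL2Z_inv ?D ** SL2Z_inv X"
    using X by (simp add: SL2Z_inv_mult matrix_mul_assoc SL2Z_inv_cancel_right)
  finally have A_eq: "A = SL2Z_inv ?D ** SL2Z_inv X ** transl (- t)" .
  have neg: "SL2Z_inv (- Z) = - SL2Z_inv Z" for Z by (simp add: mat2_eq_iff)
  have "SL2Z_inv X = SL2Z_inv C ** B \<or> SL2Z_inv X = - (SL2Z_inv C ** B)"
    using \<epsilon> by (auto simp: X_def neg SL2Z_inv_mult)
  then have "A = (SL2Z_inv ?D ** SL2Z_inv C) ** B ** transl (- t) \<or> A = - ((SL2Z_inv ?D ** SL2Z_inv C) ** B ** transl (- t))"
    using A_eq by (auto simp: uminus_mat_mult matrix_mul_assoc)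
  moreover have "SL2Z_inv ?D ** SL2Z_inv C \<in> G" using D C by blast
  ultimately show "cusp_of A = cusp_of B" using cusp_of_eq_iff[OF A B] by blast
qed

text \<open>If \<open>K\<close> were zero, all values of the form would be \<open>0\<close> or \<open>1\<close>, with at least one \<open>1\<close>, and could not sum to
  zero over the cosets.\<close>

lemma weight_two_form_at_cusp:
  assumes c: "c \<in> cusps G"
  obtains f K where "f \<in> modular_forms 2 G"
    "\<forall>A\<in>carrier SL2Z. cusp_value 2 f A = (if cusp_of A = c then 1 else 0) + K" "K \<noteq> 0"
proof -
  \<comment> \<open>The factor \<open>3\<close> makes \<open>1\<close> and \<open>N - 1\<close> different residue classes.\<close>
  define N where "N = 3 * int level"
  have N: "N \<ge> 3" "int level dvd N" using level(1) by (auto simp: N_def)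
  let ?v = "bottom_row (SL2Z_inv (cusp_rep c))"
  define \<Phi> :: "int \<times> int \<Rightarrow> complex" where "\<Phi> w = (if row_equiv N ?v w then 1 else 0)" for w
  have bound: "norm (\<Phi> v) \<le> 1" for v by (simp add: \<Phi>_def)
  have inv: "\<Phi> v = \<Phi> w" if "row_equiv N v w" for v w
    using that row_equiv_trans row_equiv_sym unfolding \<Phi>_def by metis
  obtain f K where f: "f \<in> modular_forms 2 G"
    and val: "\<And>A. A \<in> carrier SL2Z \<Longrightarrow> cusp_value 2 f A = \<Phi> (bottom_row (SL2Z_inv A)) + K"
    using weight_two_form[where \<Phi> = \<Phi>, OF N bound inv] by blast
  have val': "cusp_value 2 f A = (if cusp_of A = c then 1 else 0) + K" if "A \<in> carrier SL2Z" for A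
    using val[OF that] cusp_of_eq_iff_row_equiv[OF that cusp_rep(1)[OF c] N(2)] cusp_rep(2)[OF c]
    by (simp add: \<Phi>_def)
  have "K \<noteq> 0"
  proof
    assume K: "K = 0"
    have "(\<Sum>x\<in>cosets. if cusp_of (coset_rep x) = c then 1 else 0 :: complex) = 0"
      using sum_cusp_values_weight_two[OF f] coset_rep(1) by (simp add: val' K)
    then have "of_nat (card {x \<in> cosets. cusp_of (coset_rep x) = c}) = (0 :: complex)"
      using finite_cosets by (simp add: sum.If_cases Int_def)
    then have "{x \<in> cosets. cusp_of (coset_rep x) = c} = {}" using finite_cosets by simp
    moreover have "coset (cusp_rep c) \<in> {x \<in> cosets. cusp_of (coset_rep x) = c}"
    proof -
      obtain C where "C \<in> G" "coset_rep (coset (cusp_rep c)) = C ** cusp_rep c"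
        using coset_rep_of_coset[OF cusp_rep(1)[OF c]] .
      then show ?thesis using cusp_rep[OF c] by (simp add: cusp_of_mult_left cosets_def)
    qed
    ultimately show False by blast
  qed
  with f val' show ?thesis using that by blast
qed

text \<open>The sum of the values over all cosets is zero and consists of copies of the value at \<open>c0\<close>.\<close>

lemma weight_two_vanishing:
  assumes f: "f \<in> modular_forms 2 G" and c0: "c0 \<in> cusps G"
    and van: "\<And>c. c \<in> cusps G - {c0} \<Longrightarrow> cusp_value 2 f (cusp_rep c) = 0" and A: "A \<in> carrier SL2Z"
  shows "cusp_value 2 f A = 0"
proof -
  define X where "X = {x \<in> cosets. cusp_of (coset_rep x) = c0}"
  have val: "cusp_value 2 f B = cusp_value 2 f (cusp_rep (cusp_of B))" if "B \<in> carrier SL2Z" for B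
    using cusp_value_even[OF f that] cusp_rep[of "cusp_of B"] that by (simp add: cusps_eq)
  have "(\<Sum>x\<in>cosets. cusp_value 2 f (coset_rep x)) =
      (\<Sum>x\<in>cosets. if cusp_of (coset_rep x) = c0 then cusp_value 2 f (cusp_rep c0) else 0)"
  proof (rule sum.cong[OF refl])
    fix x assume x: "x \<in> cosets"
    have "cusp_of (coset_rep x) \<in> cusps G" using coset_rep[OF x] by (simp add: cusps_eq)
    then show "cusp_value 2 f (coset_rep x) = (if cusp_of (coset_rep x) = c0 then cusp_value 2 f (cusp_rep c0) else 0)"
      using val[OF coset_rep(1)[OF x]] van by auto
  qed
  also have "\<dots> = of_nat (card X) * cusp_value 2 f (cusp_rep c0)"
    using finite_cosets by (simp add: sum.If_cases Int_def X_def)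
  finally have "of_nat (card X) * cusp_value 2 f (cusp_rep c0) = 0"
    using sum_cusp_values_weight_two[OF f] by simp
  moreover have "coset (cusp_rep c0) \<in> X"
  proof -
    obtain C where "C \<in> G" "coset_rep (coset (cusp_rep c0)) = C ** cusp_rep c0"
      using coset_rep_of_coset[OF cusp_rep(1)[OF c0]] .
    then show ?thesis using cusp_rep[OF c0] by (simp add: cusp_of_mult_left cosets_def X_def)
  qed
  then have "card X \<noteq> 0" using finite_cosets by (auto simp: X_def)
  ultimately have "cusp_value 2 f (cusp_rep c0) = 0" by simp
  then show ?thesis
    using val[OF A] van[of "cusp_of A"] A by (cases "cusp_of A = c0") (auto simp: cusps_eq)
qed

end

section \<open>The dimension of the space of Eisenstein series\<close>

text \<open>The combination of the \<open>e i\<close> with coefficients \<open>l i f\<close> differs from \<open>f\<close> by a common zero of the linear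
  forms, and applying \<open>l i\<close> to a linear relation isolates its \<open>i\<close>-th coefficient.\<close>

lemma dual_family_basis:
  fixes l :: "'i \<Rightarrow> (complex \<Rightarrow> complex) \<Rightarrow> complex"
  assumes I: "finite I" and V: "cfun.subspace V"
    and lin: "\<And>i f g a b. i \<in> I \<Longrightarrow> f \<in> V \<Longrightarrow> g \<in> V \<Longrightarrow> l i (\<lambda>\<tau>. a * f \<tau> + b * g \<tau>) = a * l i f + b * l i g"
    and sep: "\<And>f. f \<in> V \<Longrightarrow> (\<And>i. i \<in> I \<Longrightarrow> l i f = 0) \<Longrightarrow> f = (\<lambda>_. 0)"
    and e: "\<And>i. i \<in> I \<Longrightarrow> e i \<in> V" "\<And>i j. i \<in> I \<Longrightarrow> j \<in> I \<Longrightarrow> l i (e j) = (if i = j then 1 else 0)"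
  shows "(\<exists>B. finite B \<and> cfun.span B = V) \<and> cfun.dim V = card I"
proof -
  define comb where "comb J c = (\<lambda>\<tau>. \<Sum>j\<in>J. c j * e j \<tau>)" for J c
  have zeroV: "(\<lambda>_. 0) \<in> V" using V by (simp add: cfun_subspace_iff)
  have l0: "l i (\<lambda>_. 0) = 0" if "i \<in> I" for i
    using lin[OF that zeroV zeroV, of 0 0] by simp
  have comb: "comb J c \<in> V \<and> (\<forall>i\<in>I. l i (comb J c) = (if i \<in> J then c i else 0))" if "J \<subseteq> I" for J c
    using finite_subset[OF that I] that
  proof (induction J rule: finite_induct)
    case empty
    then show ?case using zeroV l0 by (simp add: comb_def)
  next
    case (insert j J)
    have eq: "comb (insert j J) c = (\<lambda>\<tau>. c j * e j \<tau> + 1 * comb J c \<tau>)"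
      using insert.hyps by (simp add: comb_def)
    have V1: "comb J c \<in> V" "e j \<in> V" using insert e by auto
    have "comb (insert j J) c \<in> V"
      unfolding eq using V V1 unfolding cfun_subspace_iff by blast
    moreover have "l i (comb (insert j J) c) = (if i \<in> insert j J then c i else 0)" if i: "i \<in> I" for i
      unfolding eq using insert i V1 e(2)[of i j] by (subst lin) auto
    ultimately show ?case by blast
  qed
  have span: "comb J c \<in> cfun.span (e ` I)" if "J \<subseteq> I" for J c
    using finite_subset[OF that I] that
  proof (induction J rule: finite_induct)
    case empty
    then show ?case using cfun.span_zero[of "e ` I"] by (simp add: comb_def zero_fun_def)
  next
    case (insert j J)
    have eq: "comb (insert j J) c = (\<lambda>\<tau>. c j * e j \<tau> + 1 * comb J c \<tau>)"
      using insert.hyps by (simp add: comb_def)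
    have "e j \<in> cfun.span (e ` I)" using insert.prems by (intro cfun.span_base) auto
    then show ?case
      unfolding eq using insert cfun.subspace_span[of "e ` I"] unfolding cfun_subspace_iff by blast
  qed
  have "V \<subseteq> cfun.span (e ` I)"
  proof
    fix f assume f: "f \<in> V"
    define r where "r = (\<lambda>\<tau>. 1 * f \<tau> + (- 1) * comb I (\<lambda>i. l i f) \<tau>)"
    have cV: "comb I (\<lambda>i. l i f) \<in> V" using comb[of I] by simp
    have "r \<in> V" unfolding r_def using V f cV unfolding cfun_subspace_iff by blast
    moreover have "l i r = 0" if "i \<in> I" for i
      unfolding r_def lin[OF that f cV] using comb[of I] that by simp
    ultimately have "r = (\<lambda>_. 0)" by (rule sep)
    then have f_eq: "f = comb I (\<lambda>i. l i f)" by (simp add: r_def fun_eq_iff)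
    have "comb I (\<lambda>i. l i f) \<in> cfun.span (e ` I)" by (rule span) simp
    then show "f \<in> cfun.span (e ` I)" by (rule ssubst[OF f_eq])
  qed
  moreover have "cfun.span (e ` I) \<subseteq> V" using e V by (intro cfun.span_minimal) auto
  ultimately have sp: "cfun.span (e ` I) = V" by blast
  have inj: "inj_on e I"
  proof (rule inj_onI)
    fix i j assume "i \<in> I" "j \<in> I" "e i = e j"
    then show "i = j" using e(2)[of i i] e(2)[of i j] by (auto split: if_splits)
  qed
  have "cfun.independent (e ` I)"
  proof (rule cfun.independent_if_scalars_zero)
    fix u x assume s: "(\<Sum>x\<in>e ` I. fun_scale (u x) x) = 0" and "x \<in> e ` I"
    then obtain i where i: "i \<in> I" "x = e i" by blast
    have fs: "(\<Sum>i\<in>J. fun_scale (u (e i)) (e i)) = comb J (\<lambda>i. u (e i))" for J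
      by (induction J rule: infinite_finite_induct) (auto simp: comb_def fun_scale_def fun_eq_iff)
    have "comb I (\<lambda>i. u (e i)) = (\<lambda>_. 0)"
      using s inj fs[of I] by (simp add: sum.reindex zero_fun_def)
    then have "u (e i) = 0" using comb[of I "\<lambda>i. u (e i)"] i l0[OF i(1)] by auto
    then show "u x = 0" using i by simp
  qed (use I in simp)
  then have "cfun.dim V = card (e ` I)"
    using sp by (intro cfun.dim_eq_card) (simp_all flip: sp add: cfun.span_span)
  then show ?thesis using sp I inj by (auto simp: card_image)
qed

context congruence_group
begin

text \<open>The values at the cusps can be prescribed on all modular forms, since the Eisenstein part of a form has the
  same values.\<close>

lemma eisenstein_dimension_criterion:
  assumes I: "I \<subseteq> cusps G"
    and dual: "\<And>c. c \<in> I \<Longrightarrow> \<exists>g\<in>modular_forms k G. \<forall>c'\<in>I. cusp_value k g (cusp_rep c') = (if c' = c then 1 else 0)"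
    and sep: "\<And>f A. f \<in> eisenstein_space k G \<Longrightarrow> (\<And>c. c \<in> I \<Longrightarrow> cusp_value k f (cusp_rep c) = 0) \<Longrightarrow>
      A \<in> carrier SL2Z \<Longrightarrow> cusp_value k f A = 0"
  shows "(\<exists>B. finite B \<and> cfun.span B = eisenstein_space k G) \<and> cfun.dim (eisenstein_space k G) = card I"
proof -
  have rep: "cusp_rep c \<in> carrier SL2Z" if "c \<in> I" for c using cusp_rep(1) I that by blast
  have "\<exists>e\<in>eisenstein_space k G. \<forall>c'\<in>I. cusp_value k e (cusp_rep c') = (if c' = c then 1 else 0)" if c: "c \<in> I" for c
  proof -
    obtain g where g: "g \<in> modular_forms k G" "\<forall>c'\<in>I. cusp_value k g (cusp_rep c') = (if c' = c then 1 else 0)"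
      using dual[OF c] by blast
    obtain e where "e \<in> eisenstein_space k G" "\<And>A. A \<in> carrier SL2Z \<Longrightarrow> cusp_value k e A = cusp_value k g A"
      using eisenstein_part[OF g(1)] by blast
    then show ?thesis using g(2) rep by (intro bexI[of _ e]) auto
  qed
  then obtain e where e: "\<And>c. c \<in> I \<Longrightarrow> e c \<in> eisenstein_space k G"
    "\<And>c c'. c \<in> I \<Longrightarrow> c' \<in> I \<Longrightarrow> cusp_value k (e c) (cusp_rep c') = (if c' = c then 1 else 0)" by metis
  show ?thesis
  proof (rule dual_family_basis[where e = e and l = "\<lambda>c f. cusp_value k f (cusp_rep c)"])
    show "finite I" using I finite_cusps finite_subset by blast
    show "f = (\<lambda>_. 0)" if "f \<in> eisenstein_space k G" "\<And>c. c \<in> I \<Longrightarrow> cusp_value k f (cusp_rep c) = 0" for f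
      using eisenstein_eq_0[OF that(1)] sep[OF that] by blast
    show "cusp_value k (\<lambda>\<tau>. a * f \<tau> + b * g \<tau>) (cusp_rep c) = a * cusp_value k f (cusp_rep c) + b * cusp_value k g (cusp_rep c)"
      if "c \<in> I" "f \<in> eisenstein_space k G" "g \<in> eisenstein_space k G" for c f g a b
      using that by (intro modular_forms_lincomb(2) eisenstein_modular rep)
  qed (use e subspace_eisenstein_space in auto)
qed

lemma scaled_eis_dual:
  assumes k: "k \<ge> 3" and I: "I \<subseteq> cusps G" and c: "c \<in> I"
    and nz: "cusp_value k (eis k (eis_rows (SL2Z_inv (cusp_rep c)))) (cusp_rep c) \<noteq> 0"
  shows "\<exists>g\<in>modular_forms k G. \<forall>c'\<in>I. cusp_value k g (cusp_rep c') = (if c' = c then 1 else 0)"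
proof -
  let ?A = "cusp_rep c"
  have A: "?A \<in> carrier SL2Z" "cusp_of ?A = c" using cusp_rep I c by auto
  define E where "E = eis k (eis_rows (SL2Z_inv ?A))"
  define a where "a = 1 / cusp_value k E ?A"
  have Em: "E \<in> modular_forms k G" unfolding E_def using A k by (intro eis_modular) auto
  note lc = modular_forms_lincomb[OF Em zero_modular, where a = a and b = 0]
  show ?thesis
  proof (intro bexI[OF _ lc(1)] ballI)
    fix c' assume c': "c' \<in> I"
    then have B: "cusp_rep c' \<in> carrier SL2Z" "cusp_of (cusp_rep c') = c'" using cusp_rep I by auto
    have "cusp_value k E (cusp_rep c') = 0" if "c' \<noteq> c"
      unfolding E_def using eis_values(1)[OF k A(1) B(1)] A B that by simp
    then show "cusp_value k (\<lambda>\<tau>. a * E \<tau> + 0 * 0) (cusp_rep c') = (if c' = c then 1 else 0)"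
      using lc(2)[OF B(1)] nz by (simp add: a_def E_def)
  qed
qed

lemma dim_even_weight:
  assumes "even k" "k \<ge> 4"
  shows "(\<exists>B. finite B \<and> cfun.span B = eisenstein_space k G) \<and> cfun.dim (eisenstein_space k G) = card (cusps G)"
proof (rule eisenstein_dimension_criterion[OF order_refl])
  have k: "k \<ge> 3" using assms by simp
  show "\<exists>g\<in>modular_forms k G. \<forall>c'\<in>cusps G. cusp_value k g (cusp_rep c') = (if c' = c then 1 else 0)"
    if c: "c \<in> cusps G" for c
    using eis_values(2)[OF k cusp_rep(1)[OF c] cusp_rep(1)[OF c]] assms
    by (intro scaled_eis_dual k order_refl c) auto
  show "cusp_value k f A = 0" if "f \<in> eisenstein_space k G" "\<And>c. c \<in> cusps G \<Longrightarrow> cusp_value k f (cusp_rep c) = 0"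
    "A \<in> carrier SL2Z" for f A
    using cusp_value_zero_same_cusp[OF eisenstein_modular[OF that(1)] that(3), of "cusp_rep (cusp_of A)"]
      that cusp_rep[of "cusp_of A"] by (auto simp: cusps_eq)
qed

lemma dim_odd_weight:
  assumes "odd k" "k \<ge> 2" "- mat 1 \<notin> G"
  shows "(\<exists>B. finite B \<and> cfun.span B = eisenstein_space k G) \<and> cfun.dim (eisenstein_space k G) = card (regular_cusps G)"
proof (rule eisenstein_dimension_criterion)
  have k: "k \<ge> 3" using assms by (cases "k = 2") auto
  show reg: "regular_cusps G \<subseteq> cusps G" by (auto simp: regular_cusps_def)
  show "\<exists>g\<in>modular_forms k G. \<forall>c'\<in>regular_cusps G. cusp_value k g (cusp_rep c') = (if c' = c then 1 else 0)"
    if c: "c \<in> regular_cusps G" for c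
  proof (rule scaled_eis_dual[OF k reg c])
    have A: "cusp_rep c \<in> carrier SL2Z" "cusp_of (cusp_rep c) = c" using cusp_rep reg c by auto
    then have "\<not> irregular (cusp_rep c)" using cusp_of_regular_iff[OF A(1) assms(3)] c by simp
    then show "cusp_value k (eis k (eis_rows (SL2Z_inv (cusp_rep c)))) (cusp_rep c) \<noteq> 0"
      using eis_values(2)[OF k A(1) A(1)] by simp
  qed
  fix f A assume f: "f \<in> eisenstein_space k G" and van: "\<And>c. c \<in> regular_cusps G \<Longrightarrow> cusp_value k f (cusp_rep c) = 0"
    and A: "A \<in> carrier SL2Z"
  show "cusp_value k f A = 0"
  proof (cases "irregular A")
    case True
    then show ?thesis by (rule irregular_cusp_value[OF eisenstein_modular[OF f] A assms(1)])
  next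
    case False
    then have "cusp_of A \<in> regular_cusps G" using cusp_of_regular_iff[OF A assms(3)] by simp
    then show ?thesis
      using cusp_value_zero_same_cusp[OF eisenstein_modular[OF f] A, of "cusp_rep (cusp_of A)"]
        van cusp_rep[of "cusp_of A"] reg by auto
  qed
qed

lemma dim_odd_weight_zero:
  assumes "odd k" "- mat 1 \<in> G"
  shows "(\<exists>B. finite B \<and> cfun.span B = eisenstein_space k G) \<and> cfun.dim (eisenstein_space k G) = 0"
proof -
  have "cusp_value k f A = 0" if f: "f \<in> modular_forms k G" and A: "A \<in> carrier SL2Z" for f A
  proof -
    have "cusp_value k f A = cusp_value k f (- mat 1 ** A)"
      using cusp_value_left_invariant[OF f assms(2) A] by simp
    also have "\<dots> = - cusp_value k f A"
      using cusp_value_uminus[OF f A] assms(1) by (simp add: uminus_mat_mult)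
    finally show ?thesis by simp
  qed
  then show ?thesis
    using eisenstein_dimension_criterion[of "{}" k] eisenstein_modular by auto
qed

lemma dim_weight_two:
  shows "(\<exists>B. finite B \<and> cfun.span B = eisenstein_space 2 G) \<and>
    cfun.dim (eisenstein_space 2 G) = card (cusps G) - 1" and "card (cusps G) \<ge> 1"
proof -
  define c0 where "c0 = cusp_of (mat 1)"
  have c0: "c0 \<in> cusps G" by (simp add: c0_def cusps_eq)
  from c0 obtain f0 K0 where f0: "f0 \<in> modular_forms 2 G"
    "\<forall>A\<in>carrier SL2Z. cusp_value 2 f0 A = (if cusp_of A = c0 then 1 else 0) + K0" "K0 \<noteq> 0"
    by (rule weight_two_form_at_cusp)
  have "(\<exists>B. finite B \<and> cfun.span B = eisenstein_space 2 G) \<and>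
    cfun.dim (eisenstein_space 2 G) = card (cusps G - {c0})"
  proof (rule eisenstein_dimension_criterion)
    show "\<exists>g\<in>modular_forms 2 G. \<forall>c'\<in>cusps G - {c0}. cusp_value 2 g (cusp_rep c') = (if c' = c then 1 else 0)"
      if c: "c \<in> cusps G - {c0}" for c
    proof -
      have "c \<in> cusps G" using c by simp
      then obtain f K where f: "f \<in> modular_forms 2 G"
        "\<forall>A\<in>carrier SL2Z. cusp_value 2 f A = (if cusp_of A = c then 1 else 0) + K" "K \<noteq> 0"
        by (rule weight_two_form_at_cusp)
      \<comment> \<open>The combination cancels the additive constants, at the expense of the value at \<open>c0\<close>.\<close>
      note lc = modular_forms_lincomb[OF f(1) f0(1), where a = 1 and b = "- K / K0"]
      show ?thesis
      proof (intro bexI[OF _ lc(1)] ballI)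
        fix c' assume "c' \<in> cusps G - {c0}"
        then show "cusp_value 2 (\<lambda>\<tau>. 1 * f \<tau> + (- K / K0) * f0 \<tau>) (cusp_rep c') = (if c' = c then 1 else 0)"
          using cusp_rep[of c'] f0(3) by (subst lc(2)) (auto simp: f(2) f0(2))
      qed
    qed
    show "cusp_value 2 f A = 0" if "f \<in> eisenstein_space 2 G"
      "\<And>c. c \<in> cusps G - {c0} \<Longrightarrow> cusp_value 2 f (cusp_rep c) = 0" "A \<in> carrier SL2Z" for f A
      by (rule weight_two_vanishing[OF eisenstein_modular[OF that(1)] c0 that(2,3)])
  qed simp
  then show "(\<exists>B. finite B \<and> cfun.span B = eisenstein_space 2 G) \<and>
    cfun.dim (eisenstein_space 2 G) = card (cusps G) - 1"
    using c0 finite_cusps by simp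
  show "card (cusps G) \<ge> 1" using c0 finite_cusps by (metis One_nat_def Suc_leI card_gt_0_iff empty_iff)
qed

end

theorem corollary4p6:
  fixes k :: nat and G :: "(int ^ 2 ^ 2) set"
  assumes "k \<ge> 2" and "congruence_subgroup G"
  shows "finite (cusps G) \<and>
    (\<exists>B. finite B \<and> cfun.span B = eisenstein_space k G) \<and>
    int (cfun.dim (eisenstein_space k G)) =
      (if even k \<and> k \<ge> 4 then int (card (cusps G))
       else if odd k \<and> - mat 1 \<notin> G then int (card (regular_cusps G))
       else if k = 2 then int (card (cusps G)) - 1
       else 0)"
proof -
  interpret congruence_group G by unfold_locales (rule assms)
  have "k \<ge> 4" if "even k" "k \<noteq> 2" using that assms(1) by presburger
  then consider (even) "even k" "k \<ge> 4" | (odd) "odd k" "- mat 1 \<notin> G"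
    | (odd_zero) "odd k" "- mat 1 \<in> G" | (two) "k = 2"
    by blast
  then show ?thesis
  proof cases
    case even
    then show ?thesis using dim_even_weight finite_cusps by simp
  next
    case odd
    then show ?thesis using dim_odd_weight assms(1) finite_cusps by simp
  next
    case odd_zero
    then show ?thesis using dim_odd_weight_zero finite_cusps by auto
  next
    case two
    then show ?thesis using dim_weight_two finite_cusps by (simp add: of_nat_diff)
  qed
qed

end
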